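(* Let $(V,\{,\})$ be a graded (left) Leibniz algebra over a field $\mathbb{K}$ of characteristic zero. For any (homogeneous) derivations $D,D'\in\mathrm{Der}(V)$ and any $i,j\ge1$, $$N_{i+j-1}[D,D']=(N_iD,N_jD'),$$ or equivalently, in $\mathrm{Coder}(\bar TV)$, $$N_{i+j-1}^c[D,D']=[N_i^cD,N_j^cD'].$$
   Context: All vector spaces are graded; $(-1)^{x}$ means $(-1)^{|x|}$, and the Koszul sign convention is used. A graded (left) Leibniz algebra is a graded vector space with a bilinear bracket of degree $0$ satisfying $\{x,\{y,z\}\}=\{\{x,y\},z\}+(-1)^{|x||y|}\{y,\{x,z\}\}$. $\mathrm{Der}(V)$ is the space of derivations: $D\{x,y\}=\{Dx,y\}+(-1)^{|D||x|}\{x,Dy\}$, with graded commutator $[D,D']=DD'-(-1)^{|D||D'|}D'D$. For $D\in\mathrm{Der}(V)$ and $i\ge1$, $N_iD:V^{\otimes i}\to V$ is $N_iD(x_1,\dots,x_i)=\{\dots\{\{Dx_1,x_2\},x_3\},\dots,x_i\}$, with $N_1D=D$. $\bar{T}V=V\oplus V^{\otimes2}\oplus V^{\otimes3}\oplus\cdots$, with comultiplication given by $\Delta(V)=0$ and, for $n\ge1$, $\Delta(x_1,\dots,x_{n+1})=\sum_{i=1}^{n}\sum_\sigma\epsilon(\sigma)(x_{\sigma(1)},\dots,x_{\sigma(i)})\otimes(x_{\sigma(i+1)},\dots,x_{\sigma(n)},x_{n+1})$, $\sigma\in S_n$ running over $(i,n-i)$-unshuffles ($\sigma(1)<\cdots<\sigma(i)$,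 $\sigma(i+1)<\cdots<\sigma(n)$) and $\epsilon(\sigma)$ being the Koszul sign. $\mathrm{Coder}(\bar TV)$ is the space of maps $D^c$ with $\Delta D^c=(D^c\otimes1)\Delta+(1\otimes D^c)\Delta$, a Lie algebra under the graded commutator $[\cdot,\cdot]$. There is an isomorphism $\mathrm{Hom}(\bar TV,V)\cong\mathrm{Coder}(\bar TV)$, $f\mapsto f^c$ (inverse: corestriction to $V$), where for $f:V^{\otimes i}\to V$ one has $f^c(V^{\otimes n})=0$ for $n<i$ and, for $n\ge i$, $$f^c(x_1,\dots,x_n)=\sum_{k=i}^n\sum_\sigma\epsilon(\sigma)(-1)^{|f|(x_{\sigma(1)}+\cdots+x_{\sigma(k-i)})}(x_{\sigma(1)},\dots,x_{\sigma(k-i)},f(x_{\sigma(k+1-i)},\dots,x_{\sigma(k-1)},x_k),x_{k+1},\dots,x_n),$$ $\sigma\in S_{k-1}$ running over $(k-i,i-1)$-unshuffles. The Lie bracket $(f,g)$ on $\mathrm{Hom}(\bar TV,V)$ is defined by $(f,g)^c=[f^c,g^c]$; if $f$ is $i$-ary and $g$ is $j$-ary then $(f,g)$ is $(i+j-1)$-ary. Finally $N_i^cD:=(N_iD)^c$. *)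

theory Defs
  imports
    Complex_Main
    "HOL-Library.Poly_Mapping"
    "HOL-Combinatorics.Permutations"
begin

text \<open>
  The graded vector space V is a whole type, with scalar multiplication s, graded over the
  integers by G: the degree n component is G n.
\<close>

locale graded_vector_space = vector_space s
  for s :: "'k::field \<Rightarrow> 'v::ab_group_add \<Rightarrow> 'v" +
  fixes G :: "int \<Rightarrow> 'v set"
  assumes subspace_component: "subspace (G n)"
    and direct_sum:
      "\<exists>!c :: int \<Rightarrow> 'v. (\<forall>n. c n \<in> G n) \<and> finite {n. c n \<noteq> 0} \<and> x = (\<Sum>n | c n \<noteq> 0. c n)"

locale graded_leibniz_algebra = graded_vector_space s G
  for s :: "'k::field \<Rightarrow> 'v::ab_group_add \<Rightarrow> 'v" and G :: "int \<Rightarrow> 'v set" +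
  fixes br :: "'v \<Rightarrow> 'v \<Rightarrow> 'v"
  assumes linear_left: "Vector_Spaces.linear s s (\<lambda>x. br x y)"
    and linear_right: "Vector_Spaces.linear s s (\<lambda>y. br x y)"
    and degree_br: "x \<in> G a \<Longrightarrow> y \<in> G b \<Longrightarrow> br x y \<in> G (a + b)"
    and leibniz: "x \<in> G a \<Longrightarrow> y \<in> G b \<Longrightarrow>
      br x (br y z) = br (br x y) z + s ((-1) powi (a * b)) (br y (br x z))"

text \<open>Homogeneous derivations of degree d.\<close>

definition derivation ::
  "('k::field \<Rightarrow> 'v::ab_group_add \<Rightarrow> 'v) \<Rightarrow> (int \<Rightarrow> 'v set) \<Rightarrow> ('v \<Rightarrow> 'v \<Rightarrow> 'v) \<Rightarrow> int \<Rightarrow> ('v \<Rightarrow> 'v) \<Rightarrow> bool"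
  where "derivation s G br d D \<longleftrightarrow>
    Vector_Spaces.linear s s D \<and>
    (\<forall>n. D ` G n \<subseteq> G (n + d)) \<and>
    (\<forall>a x y. x \<in> G a \<longrightarrow> D (br x y) = br (D x) y + s ((-1) powi (d * a)) (br x (D y)))"

text \<open>Graded commutator of operators A, B of degrees p, q on a space with scalar multiplication s.\<close>

definition gcomm ::
  "('k::field \<Rightarrow> 'a::ab_group_add \<Rightarrow> 'a) \<Rightarrow> int \<Rightarrow> int \<Rightarrow> ('a \<Rightarrow> 'a) \<Rightarrow> ('a \<Rightarrow> 'a) \<Rightarrow> 'a \<Rightarrow> 'a"
  where "gcomm s p q A B = (\<lambda>x. A (B x) - s ((-1) powi (p * q)) (B (A x)))"

text \<open>
  A linear map from the i-th tensor power of V to V is a multilinear function of lists of length i;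
  it is regarded as an element of Hom(TV, V) by making it 0 on lists of any other length.
\<close>

definition hom_arity ::
  "('k::field \<Rightarrow> 'v::ab_group_add \<Rightarrow> 'v) \<Rightarrow> (int \<Rightarrow> 'v set) \<Rightarrow> nat \<Rightarrow> int \<Rightarrow> ('v list \<Rightarrow> 'v) set"
  where "hom_arity s G i p = {f.
    (\<forall>ys zs. length ys + length zs + 1 = i \<longrightarrow>
       Vector_Spaces.linear s s (\<lambda>x. f (ys @ x # zs))) \<and>
    (\<forall>xs. length xs \<noteq> i \<longrightarrow> f xs = 0) \<and>
    (\<forall>xs ds. length xs = i \<longrightarrow> list_all2 (\<lambda>x a. x \<in> G a) xs ds \<longrightarrow> f xs \<in> G (sum_list ds + p))}"

definition N_op ::
  "('v::zero \<Rightarrow> 'v \<Rightarrow> 'v) \<Rightarrow> nat \<Rightarrow> ('v \<Rightarrow> 'v) \<Rightarrow> 'v list \<Rightarrow> 'v"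
  where "N_op br i D xs =
    (if 1 \<le> i \<and> length xs = i then foldl br (D (hd xs)) (tl xs) else 0)"


section \<open>Free vector spaces\<close>

definition fscale :: "'k::mult_zero \<Rightarrow> ('a \<Rightarrow>\<^sub>0 'k) \<Rightarrow> ('a \<Rightarrow>\<^sub>0 'k)"
  where "fscale c = Poly_Mapping.map ((*) c)"

lemma lookup_fscale: "Poly_Mapping.lookup (fscale c t) a = c * Poly_Mapping.lookup t a"
  by (simp add: fscale_def Poly_Mapping.map.rep_eq when_def)

lemma vector_space_fscale: "vector_space (fscale :: 'k::field \<Rightarrow> ('a \<Rightarrow>\<^sub>0 'k) \<Rightarrow> _)"
  by unfold_locales
    (auto intro!: poly_mapping_eqI simp: lookup_fscale lookup_add algebra_simps)

definition lin_ext :: "('a \<Rightarrow> ('b \<Rightarrow>\<^sub>0 'k)) \<Rightarrow> ('a \<Rightarrow>\<^sub>0 'k::field) \<Rightarrow> ('b \<Rightarrow>\<^sub>0 'k)"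
  where "lin_ext F t = (\<Sum>a\<in>Poly_Mapping.keys t. fscale (Poly_Mapping.lookup t a) (F a))"

definition ftensor ::
  "('a \<Rightarrow>\<^sub>0 'k) \<Rightarrow> ('b \<Rightarrow>\<^sub>0 'k::field) \<Rightarrow> ('a \<times> 'b \<Rightarrow>\<^sub>0 'k)"
  where "ftensor t u = (\<Sum>a\<in>Poly_Mapping.keys t. \<Sum>b\<in>Poly_Mapping.keys u.
    Poly_Mapping.single (a, b) (Poly_Mapping.lookup t a * Poly_Mapping.lookup u b))"


section \<open>The reduced tensor space\<close>

text \<open>
  As a graded vector space, the reduced tensor space TV of V is spanned by the nonempty lists
  (pure tensors) of homogeneous vectors, modulo the relations of multilinearity. An element of TV is
  represented by an element of the free vector space on these lists, and equality in TV is the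
  congruence modulo the subspace of relations. Lists with a non-homogeneous entry, for
  which the Koszul signs have no meaning, are not in the carrier.

  The relations make each list with an entry 0 vanish in TV, so it does not matter
  which degree is chosen for the vector 0.
\<close>

definition homog :: "(int \<Rightarrow> 'v set) \<Rightarrow> 'v set"
  where "homog G = (\<Union>n. G n)"

definition deg :: "(int \<Rightarrow> 'v set) \<Rightarrow> 'v \<Rightarrow> int"
  where "deg G x = (SOME n. x \<in> G n)"

definition words :: "(int \<Rightarrow> 'v set) \<Rightarrow> 'v list set"
  where "words G = {xs. xs \<noteq> [] \<and> set xs \<subseteq> homog G}"

definition tensors :: "(int \<Rightarrow> 'v set) \<Rightarrow> ('v list \<Rightarrow>\<^sub>0 'k::field) set"
  where "tensors G = {t. Poly_Mapping.keys t \<subseteq> words G}"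

definition tensor_relations ::
  "('k::field \<Rightarrow> 'v::ab_group_add \<Rightarrow> 'v) \<Rightarrow> (int \<Rightarrow> 'v set) \<Rightarrow> ('v list \<Rightarrow>\<^sub>0 'k) set"
  where "tensor_relations s G = module.span fscale
    ({Poly_Mapping.single (ys @ (x + x') # zs) 1
        - Poly_Mapping.single (ys @ x # zs) 1 - Poly_Mapping.single (ys @ x' # zs) 1
      | ys x x' zs n. set ys \<subseteq> homog G \<and> set zs \<subseteq> homog G \<and> x \<in> G n \<and> x' \<in> G n} \<union>
     {Poly_Mapping.single (ys @ s c x # zs) 1 - Poly_Mapping.single (ys @ x # zs) c
      | ys x c zs. set ys \<subseteq> homog G \<and> set zs \<subseteq> homog G \<and> x \<in> homog G})"

definition tensor_eq ::
  "('k::field \<Rightarrow> 'v::ab_group_add \<Rightarrow> 'v) \<Rightarrow> (int \<Rightarrow> 'v set) \<Rightarrow> ('v list \<Rightarrow>\<^sub>0 'k) \<Rightarrow> ('v list \<Rightarrow>\<^sub>0 'k) \<Rightarrow> bool"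
  where "tensor_eq s G t u \<longleftrightarrow> t - u \<in> tensor_relations s G"

text \<open>Representatives of the elements of TV of total degree n.\<close>

definition tensors_deg ::
  "('k::field \<Rightarrow> 'v::ab_group_add \<Rightarrow> 'v) \<Rightarrow> (int \<Rightarrow> 'v set) \<Rightarrow> int \<Rightarrow> ('v list \<Rightarrow>\<^sub>0 'k) set"
  where "tensors_deg s G n = {t. \<exists>u. tensor_eq s G t u \<and>
    u \<in> module.span fscale {Poly_Mapping.single xs 1 | xs ds.
      xs \<noteq> [] \<and> list_all2 (\<lambda>x a. x \<in> G a) xs ds \<and> sum_list ds = n}}"

text \<open>
  The tensor square of TV: the tensor square of the free vector space modulo the
  relations in either factor.
\<close>

definition tensor2_relations ::
  "('k::field \<Rightarrow> 'v::ab_group_add \<Rightarrow> 'v) \<Rightarrow> (int \<Rightarrow> 'v set) \<Rightarrow> ('v list \<times> 'v list \<Rightarrow>\<^sub>0 'k) set"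
  where "tensor2_relations s G = module.span fscale
    ({ftensor r t | r t. r \<in> tensor_relations s G \<and> t \<in> tensors G} \<union>
     {ftensor t r | r t. r \<in> tensor_relations s G \<and> t \<in> tensors G})"

definition tensor2_eq ::
  "('k::field \<Rightarrow> 'v::ab_group_add \<Rightarrow> 'v) \<Rightarrow> (int \<Rightarrow> 'v set) \<Rightarrow>
    ('v list \<times> 'v list \<Rightarrow>\<^sub>0 'k) \<Rightarrow> ('v list \<times> 'v list \<Rightarrow>\<^sub>0 'k) \<Rightarrow> bool"
  where "tensor2_eq s G t u \<longleftrightarrow> t - u \<in> tensor2_relations s G"

text \<open>
  Positions in lists are counted from 0, so that permutations act on the positions
  below p + q.
\<close>

definition unshuffles :: "nat \<Rightarrow> nat \<Rightarrow> (nat \<Rightarrow> nat) set"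
  where "unshuffles p q = {\<sigma>. \<sigma> permutes {..<p + q} \<and>
    strict_mono_on {..<p} \<sigma> \<and> strict_mono_on {p..<p + q} \<sigma>}"

definition koszul :: "(int \<Rightarrow> 'v set) \<Rightarrow> (nat \<Rightarrow> nat) \<Rightarrow> 'v list \<Rightarrow> 'k::field"
  where "koszul G \<sigma> xs = (\<Prod>(a, b) \<in> {(a, b). a < b \<and> b < length xs \<and> \<sigma> b < \<sigma> a}.
    (-1) powi (deg G (xs ! \<sigma> a) * deg G (xs ! \<sigma> b)))"

definition pick :: "'v list \<Rightarrow> (nat \<Rightarrow> nat) \<Rightarrow> nat \<Rightarrow> nat \<Rightarrow> 'v list"
  where "pick xs \<sigma> a b = map (\<lambda>m. xs ! \<sigma> m) [a..<b]"


section \<open>The coalgebra structure and coderivations\<close>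

definition comult ::
  "(int \<Rightarrow> 'v set) \<Rightarrow> ('v list \<Rightarrow>\<^sub>0 'k::field) \<Rightarrow> ('v list \<times> 'v list \<Rightarrow>\<^sub>0 'k)"
  where "comult G = lin_ext (\<lambda>xs. let n = length xs - 1 in
    \<Sum>i = 1..n. \<Sum>\<sigma>\<in>unshuffles i (n - i).
      Poly_Mapping.single (pick xs \<sigma> 0 i, pick xs \<sigma> i n @ [xs ! n]) (koszul G \<sigma> (take n xs)))"

definition tensor_id_right ::
  "(('v list \<Rightarrow>\<^sub>0 'k::field) \<Rightarrow> ('v list \<Rightarrow>\<^sub>0 'k)) \<Rightarrow>
    ('v list \<times> 'v list \<Rightarrow>\<^sub>0 'k) \<Rightarrow> ('v list \<times> 'v list \<Rightarrow>\<^sub>0 'k)"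
  where "tensor_id_right P = lin_ext (\<lambda>(xs, ys).
    ftensor (P (Poly_Mapping.single xs 1)) (Poly_Mapping.single ys 1))"

text \<open>By the Koszul convention, an operator P of degree p acquires a sign when it passes xs.\<close>

definition tensor_id_left ::
  "(int \<Rightarrow> 'v set) \<Rightarrow> int \<Rightarrow> (('v list \<Rightarrow>\<^sub>0 'k::field) \<Rightarrow> ('v list \<Rightarrow>\<^sub>0 'k)) \<Rightarrow>
    ('v list \<times> 'v list \<Rightarrow>\<^sub>0 'k) \<Rightarrow> ('v list \<times> 'v list \<Rightarrow>\<^sub>0 'k)"
  where "tensor_id_left G p P = lin_ext (\<lambda>(xs, ys).
    fscale ((-1) powi (p * (\<Sum>x\<leftarrow>xs. deg G x)))
      (ftensor (Poly_Mapping.single xs 1) (P (Poly_Mapping.single ys 1))))"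

text \<open>
  Coderivations of degree p, given by representing operators on the free vector space
  that descend to TV. Two of them are the same if they agree on TV.
\<close>

definition Coder ::
  "('k::field \<Rightarrow> 'v::ab_group_add \<Rightarrow> 'v) \<Rightarrow> (int \<Rightarrow> 'v set) \<Rightarrow> int \<Rightarrow>
    (('v list \<Rightarrow>\<^sub>0 'k) \<Rightarrow> ('v list \<Rightarrow>\<^sub>0 'k)) set"
  where "Coder s G p = {P.
    Vector_Spaces.linear fscale fscale P \<and>
    P ` tensors G \<subseteq> tensors G \<and>
    P ` tensor_relations s G \<subseteq> tensor_relations s G \<and>
    (\<forall>n. P ` tensors_deg s G n \<subseteq> tensors_deg s G (n + p)) \<and>
    (\<forall>t\<in>tensors G. tensor2_eq s G (comult G (P t))
      (tensor_id_right P (comult G t) + tensor_id_left G p P (comult G t)))}"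

definition coder_eq ::
  "('k::field \<Rightarrow> 'v::ab_group_add \<Rightarrow> 'v) \<Rightarrow> (int \<Rightarrow> 'v set) \<Rightarrow>
    (('v list \<Rightarrow>\<^sub>0 'k) \<Rightarrow> ('v list \<Rightarrow>\<^sub>0 'k)) \<Rightarrow> (('v list \<Rightarrow>\<^sub>0 'k) \<Rightarrow> ('v list \<Rightarrow>\<^sub>0 'k)) \<Rightarrow> bool"
  where "coder_eq s G P Q \<longleftrightarrow> (\<forall>t\<in>tensors G. tensor_eq s G (P t) (Q t))"

text \<open>
  The coderivation extending an i-ary map f of degree p. The vector that f leaves in its
  place, the k-th one, is the list entry k - 1.
\<close>

definition coder_ext ::
  "(int \<Rightarrow> 'v set) \<Rightarrow> nat \<Rightarrow> int \<Rightarrow> ('v list \<Rightarrow> 'v) \<Rightarrow> ('v list \<Rightarrow>\<^sub>0 'k::field) \<Rightarrow> ('v list \<Rightarrow>\<^sub>0 'k)"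
  where "coder_ext G i p f = lin_ext (\<lambda>xs.
    \<Sum>k = i..length xs. \<Sum>\<sigma>\<in>unshuffles (k - i) (i - 1).
      Poly_Mapping.single
        (pick xs \<sigma> 0 (k - i) @ [f (pick xs \<sigma> (k - i) (k - 1) @ [xs ! (k - 1)])] @ drop k xs)
        (koszul G \<sigma> (take (k - 1) xs)
          * (-1) powi (p * (\<Sum>x\<leftarrow>pick xs \<sigma> 0 (k - i). deg G x))))"

text \<open>
  The Lie bracket of an i-ary map f of degree p and a j-ary map g of degree q: the unique map of
  arity i + j - 1 and degree p + q that extends to the graded commutator of the extensions.
\<close>

definition hom_bracket ::
  "('k::field \<Rightarrow> 'v::ab_group_add \<Rightarrow> 'v) \<Rightarrow> (int \<Rightarrow> 'v set) \<Rightarrow>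
    nat \<Rightarrow> int \<Rightarrow> ('v list \<Rightarrow> 'v) \<Rightarrow> nat \<Rightarrow> int \<Rightarrow> ('v list \<Rightarrow> 'v) \<Rightarrow> 'v list \<Rightarrow> 'v"
  where "hom_bracket s G i p f j q g = (THE h.
    h \<in> hom_arity s G (i + j - 1) (p + q) \<and>
    coder_eq s G (coder_ext G (i + j - 1) (p + q) h)
      (gcomm fscale p q (coder_ext G i p f) (coder_ext G j q g)))"

definition N_coder ::
  "(int \<Rightarrow> 'v::zero set) \<Rightarrow> ('v \<Rightarrow> 'v \<Rightarrow> 'v) \<Rightarrow> nat \<Rightarrow> int \<Rightarrow> ('v \<Rightarrow> 'v) \<Rightarrow>
    ('v list \<Rightarrow>\<^sub>0 'k::field) \<Rightarrow> ('v list \<Rightarrow>\<^sub>0 'k)"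
  where "N_coder G br i d D = coder_ext G i d (N_op br i D)"

end

theory Submission
  imports Defs
begin

text \<open>
  Write the extension of f as a recursion on the last letter of a word:
  f^c(w x) = f^c(w) x + sum of the terms A f(B x), over the unshuffles (A, B) of w. With
  coassociativity and cocommutativity of the unshuffle coproduct, this recursion shows that f^c is a
  coderivation, and that [f^c, g^c] is the extension of f g^c - (-1)^(|f||g|) g f^c, because the
  terms where f and g act side by side cancel. It remains to evaluate this map on N_i D and
  N_j D'. Removing the last letter gives a recursion in which the double brackets
  {N_i D(A), {N_j D'(B), x}} are reordered by the Leibniz identity; the exchange lemma
  \<open>nest_comp_exchange\<close> moves the arities so that the terms recombine to N_(i+j-1) [D, D'].

  Signs are exact for words of pairs (vector, degree). The given operators take their
  degrees from a choice function that is arbitrary at the vector 0, but on multilinear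
  functions the two versions agree, since words with an entry 0 contribute nothing.
\<close>

section \<open>Signed sums over unshuffles\<close>

text \<open>The comultiplication pins the last letter to the right factor, so it is not
  cocommutative. Once the last letter is split off, however, the letters before it are free to go to
  either side. This is why the coderivation property is proved for the full coproduct
  \<open>unsh\<close> and only then carried over to \<open>hunsh\<close>.

  The bracket has no antisymmetry, so the exchange of arities between N D and N D' is not claimed as
  an equation in V, but for the left multiplications that the two sides induce. That suffices:
  wherever it is used, the recursion has already put a bracket with the last letter around it.

  Sums are always paired with a test function \<phi>. Multilinear test functions on words correspond
  to linear functions on TV, and a projection with the relations as its kernel is a test function
  that detects equality in TV. So the sign calculations for coproducts and coderivations take place
  in an arbitrary abelian group, and the quotient enters only through the choice of \<phi>.\<close>

definition sg :: "int \<Rightarrow> 'a::ab_group_add \<Rightarrow> 'a"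
  where "sg n x = (if even n then x else - x)"

lemma sg_0 [simp]: "sg n 0 = 0"
  by (simp add: sg_def)

lemma sg_zero [simp]: "sg 0 x = x"
  by (simp add: sg_def)

lemma sg_sg [simp]: "sg m (sg n x) = sg (m + n) x"
  by (simp add: sg_def)

lemma sg_add: "sg n (x + y) = sg n x + sg n y"
  by (simp add: sg_def)

lemma sg_diff: "sg n (x - y) = sg n x - sg n y"
  by (simp add: sg_def)

lemma sg_cong: "even (m - n) \<Longrightarrow> sg m x = sg n x"
  by (auto simp: sg_def)

lemma sg_if: "sg n (if P then x else 0) = (if P then sg n x else 0)"
  by simp

definition dg :: "('l \<Rightarrow> int) \<Rightarrow> 'l list \<Rightarrow> int"
  where "dg \<delta> w = (\<Sum>x\<leftarrow>w. \<delta> x)"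

lemma dg_simps [simp]:
  "dg \<delta> [] = 0" "dg \<delta> (x # w) = \<delta> x + dg \<delta> w" "dg \<delta> (v @ w) = dg \<delta> v + dg \<delta> w"
  by (simp_all add: dg_def)

text \<open>
  A sum over the terms of a coproduct or of a coderivation is represented by the function that maps
  \<open>\<phi>\<close> to the sum of the values of \<open>\<phi>\<close>: \<open>unsh \<delta> w \<phi>\<close> is the sum of
  the values \<open>\<plusminus>\<phi> A B\<close> over all unshuffles (A, B) of w, A or B possibly empty.
\<close>

fun unsh :: "('l \<Rightarrow> int) \<Rightarrow> 'l list \<Rightarrow> ('l list \<Rightarrow> 'l list \<Rightarrow> 'w::ab_group_add) \<Rightarrow> 'w"
  where
    "unsh \<delta> [] \<phi> = \<phi> [] []"
  | "unsh \<delta> (x # w) \<phi> =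
      unsh \<delta> w (\<lambda>A B. \<phi> (x # A) B) + unsh \<delta> w (\<lambda>A B. sg (\<delta> x * dg \<delta> A) (\<phi> A (x # B)))"

text \<open>The multiset equation says that A and B together use up the letters of w. It determines
  what the applications need: the letters, the total length and the total degree.\<close>

lemma unsh_cong:
  assumes "\<And>A B. mset A + mset B = mset w \<Longrightarrow> \<phi> A B = \<psi> A B"
  shows "unsh \<delta> w \<phi> = unsh \<delta> w \<psi>"
  using assms
proof (induction w arbitrary: \<phi> \<psi>)
  case Nil
  then show ?case by simp
next
  case (Cons x w)
  have "unsh \<delta> w (\<lambda>A B. \<phi> (x # A) B) = unsh \<delta> w (\<lambda>A B. \<psi> (x # A) B)"
    by (rule Cons.IH, rule Cons.prems) simp
  moreover have "unsh \<delta> w (\<lambda>A B. sg (\<delta> x * dg \<delta> A) (\<phi> A (x # B)))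
      = unsh \<delta> w (\<lambda>A B. sg (\<delta> x * dg \<delta> A) (\<psi> A (x # B)))"
    by (rule Cons.IH, subst Cons.prems) simp_all
  ultimately show ?case by simp
qed

lemma dg_mset: "dg \<delta> w = (\<Sum>x\<in>#mset w. \<delta> x)"
  by (induction w) auto

lemma split_mset:
  assumes "mset A + mset B = mset w"
  shows "set A \<union> set B = set w" "length A + length B = length w" "dg \<delta> A + dg \<delta> B = dg \<delta> w"
proof -
  show "set A \<union> set B = set w"
    by (metis assms set_mset_mset set_mset_union)
  show "length A + length B = length w"
    by (metis assms size_mset size_union)
  show "dg \<delta> A + dg \<delta> B = dg \<delta> w"
    by (simp add: dg_mset flip: assms)
qed

lemma unsh_cong':
  assumes "\<And>A B. set A \<subseteq> set w \<Longrightarrow> set B \<subseteq> set w \<Longrightarrow> length A + length B = length w \<Longrightarrow>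
     dg \<delta> A + dg \<delta> B = dg \<delta> w \<Longrightarrow> \<phi> A B = \<psi> A B"
  shows "unsh \<delta> w \<phi> = unsh \<delta> w \<psi>"
  by (rule unsh_cong, rule assms) (use split_mset in blast)+

lemma unsh_add: "unsh \<delta> w (\<lambda>A B. \<phi> A B + \<psi> A B) = unsh \<delta> w \<phi> + unsh \<delta> w \<psi>"
  by (induction w arbitrary: \<phi> \<psi>) (simp_all add: sg_add algebra_simps)

lemma unsh_0 [simp]: "unsh \<delta> w (\<lambda>A B. 0) = 0"
  by (induction w) simp_all

text \<open>Additivity of L is asked for on a subset S only, because a multilinear function is
  additive only within one homogeneous component. With L the identity, the first conjunct serves as
  a closure property of S.\<close>

lemma unsh_hom:
  assumes "\<And>x y. x \<in> S \<Longrightarrow> y \<in> S \<Longrightarrow> x + y \<in> S" "\<And>x. x \<in> S \<Longrightarrow> - x \<in> S"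
    and "\<And>x y. x \<in> S \<Longrightarrow> y \<in> S \<Longrightarrow> L (x + y) = L x + L y" "\<And>x. x \<in> S \<Longrightarrow> L (- x) = - L x"
    and "\<And>A B. mset A + mset B = mset w \<Longrightarrow> \<phi> A B \<in> S"
  shows "unsh \<delta> w \<phi> \<in> S \<and> L (unsh \<delta> w \<phi>) = unsh \<delta> w (\<lambda>A B. L (\<phi> A B))"
  using assms(5)
proof (induction w arbitrary: \<phi>)
  case Nil
  then show ?case by simp
next
  case (Cons x w)
  have sg: "sg n y \<in> S \<and> L (sg n y) = sg n (L y)" if "y \<in> S" for n y
    using that assms(2,4) by (simp add: sg_def)
  have 1: "unsh \<delta> w (\<lambda>A B. \<phi> (x # A) B) \<in> S \<and>
      L (unsh \<delta> w (\<lambda>A B. \<phi> (x # A) B)) = unsh \<delta> w (\<lambda>A B. L (\<phi> (x # A) B))"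
    by (rule Cons.IH, rule Cons.prems) simp
  have in_S: "\<phi> A (x # B) \<in> S" if "mset A + mset B = mset w" for A B
    by (rule Cons.prems) (simp add: that)
  have "unsh \<delta> w (\<lambda>A B. sg (\<delta> x * dg \<delta> A) (\<phi> A (x # B))) \<in> S \<and>
      L (unsh \<delta> w (\<lambda>A B. sg (\<delta> x * dg \<delta> A) (\<phi> A (x # B))))
      = unsh \<delta> w (\<lambda>A B. L (sg (\<delta> x * dg \<delta> A) (\<phi> A (x # B))))"
    by (rule Cons.IH) (use in_S sg in blast)
  moreover have "unsh \<delta> w (\<lambda>A B. L (sg (\<delta> x * dg \<delta> A) (\<phi> A (x # B))))
      = unsh \<delta> w (\<lambda>A B. sg (\<delta> x * dg \<delta> A) (L (\<phi> A (x # B))))"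
    by (rule unsh_cong) (use in_S sg in blast)
  ultimately show ?case
    using 1 assms(1,3) by simp
qed

lemma unsh_additive:
  assumes "\<And>x y. L (x + y) = L x + L y"
  shows "L (unsh \<delta> w \<phi>) = unsh \<delta> w (\<lambda>A B. L (\<phi> A B))"
proof -
  interpret additive L by standard (rule assms)
  show ?thesis using unsh_hom[where S = UNIV and L = L] add minus by blast
qed

lemma unsh_sg: "unsh \<delta> w (\<lambda>A B. sg n (\<phi> A B)) = sg n (unsh \<delta> w \<phi>)"
  by (rule unsh_additive[symmetric]) (rule sg_add)

lemma unsh_minus: "unsh \<delta> w (\<lambda>A B. - \<phi> A B) = - unsh \<delta> w \<phi>"
  by (rule unsh_additive[symmetric]) simp

lemma unsh_diff: "unsh \<delta> w (\<lambda>A B. \<phi> A B - \<psi> A B) = unsh \<delta> w \<phi> - unsh \<delta> w \<psi>"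
  using unsh_add[of \<delta> w \<phi> "\<lambda>A B. - \<psi> A B"] by (simp add: unsh_minus)

lemma unsh_append:
  "unsh \<delta> (v @ w) \<phi> =
    unsh \<delta> v (\<lambda>A B. unsh \<delta> w (\<lambda>A' B'. sg (dg \<delta> B * dg \<delta> A') (\<phi> (A @ A') (B @ B'))))"
proof (induction v arbitrary: \<phi>)
  case Nil
  then show ?case by simp
next
  case (Cons x v)
  show ?case
    by (simp add: Cons.IH unsh_sg[symmetric] algebra_simps)
qed

lemma unsh_snoc:
  "unsh \<delta> (w @ [x]) \<phi> =
    unsh \<delta> w (\<lambda>A B. \<phi> A (B @ [x])) + unsh \<delta> w (\<lambda>A B. sg (\<delta> x * dg \<delta> B) (\<phi> (A @ [x]) B))"
  by (simp add: unsh_append unsh_add algebra_simps)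

text \<open>Both sides distribute the letters over three blocks. A first letter that goes to the
  third block passes the two others, and \<open>dg \<delta> A\<close> is the sum of their degrees,
  so its sign is the same on both sides.\<close>

lemma unsh_coassoc:
  "unsh \<delta> w (\<lambda>A B. unsh \<delta> A (\<lambda>A1 A2. \<phi> A1 A2 B)) =
    unsh \<delta> w (\<lambda>A B. unsh \<delta> B (\<lambda>B1 B2. \<phi> A B1 B2))"
proof (induction w arbitrary: \<phi>)
  case Nil
  then show ?case by simp
next
  case (Cons x w)
  have *: "unsh \<delta> A (\<lambda>A1 A2. sg (\<delta> x * dg \<delta> A) (\<phi> A1 A2 B))
    = unsh \<delta> A (\<lambda>A1 A2. sg (\<delta> x * dg \<delta> A1 + \<delta> x * dg \<delta> A2) (\<phi> A1 A2 B))" for A B \<phi>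
    by (rule unsh_cong') (simp flip: distrib_left)
  show ?case
    by (simp add: unsh_add sg_add Cons.IH * flip: unsh_sg add.assoc)
qed

text \<open>Interchanging the blocks has the Koszul sign of A passing B. In the induction, a first
  letter put into one block on the left side is put into the other on the right side, and its own
  sign makes up the difference of the exponents.\<close>

lemma unsh_cocomm: "unsh \<delta> w \<phi> = unsh \<delta> w (\<lambda>A B. sg (dg \<delta> A * dg \<delta> B) (\<phi> B A))"
proof (induction w arbitrary: \<phi>)
  case Nil
  then show ?case by simp
next
  case (Cons x w)
  let ?f = "\<lambda>A B. \<phi> (x # A) B"
  let ?g = "\<lambda>A B. sg (\<delta> x * dg \<delta> A) (\<phi> A (x # B))"
  have "unsh \<delta> w ?f = unsh \<delta> w (\<lambda>A B. sg (dg \<delta> A * dg \<delta> B) (?f B A))"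
    by (rule Cons.IH)
  also have "\<dots> = unsh \<delta> w (\<lambda>A B. sg (\<delta> x * dg \<delta> A + dg \<delta> A * (\<delta> x + dg \<delta> B)) (\<phi> (x # B) A))"
    by (rule unsh_cong, rule sg_cong) (simp add: algebra_simps)
  finally have 1: "unsh \<delta> w ?f = \<dots>" .
  have "unsh \<delta> w ?g = unsh \<delta> w (\<lambda>A B. sg (dg \<delta> A * dg \<delta> B) (?g B A))"
    by (rule Cons.IH)
  also have "\<dots> = unsh \<delta> w (\<lambda>A B. sg ((\<delta> x + dg \<delta> A) * dg \<delta> B) (\<phi> B (x # A)))"
    by (simp add: algebra_simps)
  finally have "unsh \<delta> w ?g = \<dots>" .
  with 1 show ?case by simp
qed

lemma unsh_map: "unsh \<delta> (map h w) \<phi> = unsh (\<delta> \<circ> h) w (\<lambda>A B. \<phi> (map h A) (map h B))"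
  by (induction w arbitrary: \<phi>) (simp_all add: dg_def comp_def)

lemma dg_cong: "(\<And>x. x \<in> set w \<Longrightarrow> \<delta> x = \<delta>' x) \<Longrightarrow> dg \<delta> w = dg \<delta>' w"
  by (simp add: dg_def cong: map_cong)

lemma unsh_deg_cong:
  assumes "\<And>x. x \<in> set w \<Longrightarrow> \<delta> x = \<delta>' x"
  shows "unsh \<delta> w \<phi> = unsh \<delta>' w \<phi>"
  using assms
proof (induction w arbitrary: \<phi>)
  case Nil
  then show ?case by simp
next
  case (Cons x w)
  have "unsh \<delta>' w (\<lambda>A B. sg (\<delta> x * dg \<delta> A) (\<phi> A (x # B)))
      = unsh \<delta>' w (\<lambda>A B. sg (\<delta>' x * dg \<delta>' A) (\<phi> A (x # B)))"
  proof (rule unsh_cong')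
    fix A assume "set A \<subseteq> set w"
    then have "dg \<delta> A = dg \<delta>' A" by (intro dg_cong) (use Cons.prems in auto)
    then show "sg (\<delta> x * dg \<delta> A) (\<phi> A (x # B)) = sg (\<delta>' x * dg \<delta>' A) (\<phi> A (x # B))" for B
      by (simp add: Cons.prems)
  qed
  then show ?case using Cons by simp
qed

lemma unsh_left_empty: "unsh \<delta> w (\<lambda>A B. if A = [] then \<phi> A B else 0) = \<phi> [] w"
  by (induction w arbitrary: \<phi>) (simp_all add: sg_if cong: if_cong)

lemma unsh_right_empty: "unsh \<delta> w (\<lambda>A B. if B = [] then \<phi> A B else 0) = \<phi> w []"
  by (induction w arbitrary: \<phi>) (simp_all add: sg_if cong: if_cong)


section \<open>The coderivation extending a map, on words with a degree function\<close>

text \<open>\<open>cext \<delta> i p f \<phi> w\<close> is \<open>\<phi>\<close> applied to f^c(w). The arity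
  is a side condition, since an output of f is not 0 in general on words of the wrong length.\<close>

definition cext ::
  "('l \<Rightarrow> int) \<Rightarrow> nat \<Rightarrow> int \<Rightarrow> ('l list \<Rightarrow> 'l) \<Rightarrow> ('l list \<Rightarrow> 'w::ab_group_add) \<Rightarrow> 'l list \<Rightarrow> 'w"
  where "cext \<delta> i p f \<phi> w = (\<Sum>k<length w. unsh \<delta> (take k w) (\<lambda>A B.
    if length B + 1 = i then sg (p * dg \<delta> A) (\<phi> (A @ f (B @ [w ! k]) # drop (Suc k) w)) else 0))"

lemma cext_Nil [simp]: "cext \<delta> i p f \<phi> [] = 0"
  by (simp add: cext_def)

lemma cext_snoc:
  "cext \<delta> i p f \<phi> (w @ [x]) = cext \<delta> i p f (\<lambda>u. \<phi> (u @ [x])) w +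
    unsh \<delta> w (\<lambda>A B. if length B + 1 = i then sg (p * dg \<delta> A) (\<phi> (A @ [f (B @ [x])])) else 0)"
  by (simp add: cext_def nth_append cong: if_cong)

text \<open>Demanded for all words. With \<open>deg G\<close> this could fail where f takes the
  value 0; with degrees recorded as data it holds by construction, see
  \<open>shifts_hat\<close>.\<close>

definition shifts :: "('l \<Rightarrow> int) \<Rightarrow> int \<Rightarrow> ('l list \<Rightarrow> 'l) \<Rightarrow> bool"
  where "shifts \<delta> p f \<longleftrightarrow> (\<forall>w. \<delta> (f w) = dg \<delta> w + p)"

lemma cext_cong:
  assumes "\<And>A B C. mset A + mset B + mset C = mset w \<Longrightarrow> length B = i \<Longrightarrow> B \<noteq> [] \<Longrightarrow>
     \<phi> (A @ f B # C) = \<psi> (A @ f B # C)"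
  shows "cext \<delta> i p f \<phi> w = cext \<delta> i p f \<psi> w"
  unfolding cext_def
proof (intro sum.cong refl unsh_cong if_cong)
  fix k A B assume k: "k \<in> {..<length w}" and "mset A + mset B = mset (take k w)"
    and i: "length B + 1 = i"
  moreover have "mset (take k w) + mset (w ! k # drop (Suc k) w) = mset w"
    using k by (metis Cons_nth_drop_Suc append_take_drop_id lessThan_iff mset_append)
  ultimately have "mset A + mset (B @ [w ! k]) + mset (drop (Suc k) w) = mset w"
    by (simp add: algebra_simps)
  then show "sg (p * dg \<delta> A) (\<phi> (A @ f (B @ [w ! k]) # drop (Suc k) w))
    = sg (p * dg \<delta> A) (\<psi> (A @ f (B @ [w ! k]) # drop (Suc k) w))"
    by (subst assms) (use i in auto)
qed

lemma cext_cong':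
  assumes "shifts \<delta> p f"
    and "\<And>u. u \<noteq> [] \<Longrightarrow> length u + i = length w + 1 \<Longrightarrow> dg \<delta> u = dg \<delta> w + p \<Longrightarrow> \<phi> u = \<psi> u"
  shows "cext \<delta> i p f \<phi> w = cext \<delta> i p f \<psi> w"
proof (rule cext_cong, rule assms(2))
  fix A B C assume *: "mset A + mset B + mset C = mset w" and i: "length B = i"
  have "length A + length B + length C = length w"
    by (metis * size_mset size_union)
  then show "length (A @ f B # C) + i = length w + 1"
    using i by simp
  show "dg \<delta> (A @ f B # C) = dg \<delta> w + p"
    using assms(1) by (simp add: shifts_def) (simp add: dg_mset flip: *)
qed auto

lemma cext_add: "cext \<delta> i p f (\<lambda>u. \<phi> u + \<psi> u) w = cext \<delta> i p f \<phi> w + cext \<delta> i p f \<psi> w"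
  unfolding cext_def sum.distrib[symmetric] unsh_add[symmetric]
  by (intro sum.cong refl unsh_cong) (simp add: sg_add)

lemma cext_0 [simp]: "cext \<delta> i p f (\<lambda>u. 0) w = 0"
  by (simp add: cext_def cong: if_cong)

text \<open>The analogue of \<open>unsh_hom\<close>. Here 0 must belong to S, since f may find no
  block of length i in w.\<close>

lemma cext_hom:
  assumes "0 \<in> S" "\<And>x y. x \<in> S \<Longrightarrow> y \<in> S \<Longrightarrow> x + y \<in> S" "\<And>x. x \<in> S \<Longrightarrow> - x \<in> S"
    and "\<And>x y. x \<in> S \<Longrightarrow> y \<in> S \<Longrightarrow> L (x + y) = L x + L y" "\<And>x. x \<in> S \<Longrightarrow> L (- x) = - L x"
    and "\<And>A B C. mset A + mset B + mset C = mset w \<Longrightarrow> length B = i \<Longrightarrow> B \<noteq> [] \<Longrightarrow>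
     \<phi> (A @ f B # C) \<in> S"
  shows "cext \<delta> i p f \<phi> w \<in> S \<and> L (cext \<delta> i p f \<phi> w) = cext \<delta> i p f (\<lambda>u. L (\<phi> u)) w"
  using assms(6)
proof (induction w arbitrary: \<phi> rule: rev_induct)
  case Nil
  have "L 0 = L 0 + L 0" using assms(4)[of 0 0] assms(1) by simp
  then show ?case using assms(1) by simp
next
  case (snoc x w)
  have L0: "L 0 = 0" using assms(4)[of 0 0] assms(1) by simp
  have sg: "sg n y \<in> S \<and> L (sg n y) = sg n (L y)" if "y \<in> S" for n y
    using that assms(3,5) by (simp add: sg_def)
  have 1: "cext \<delta> i p f (\<lambda>u. \<phi> (u @ [x])) w \<in> S \<and>
      L (cext \<delta> i p f (\<lambda>u. \<phi> (u @ [x])) w) = cext \<delta> i p f (\<lambda>u. L (\<phi> (u @ [x]))) w"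
    by (rule snoc.IH) (use snoc.prems[of _ _ "_ @ [x]"] in simp)
  let ?g = "\<lambda>A B. if length B + 1 = i then sg (p * dg \<delta> A) (\<phi> (A @ [f (B @ [x])])) else 0"
  have in_S: "\<phi> (A @ [f (B @ [x])]) \<in> S" if "mset A + mset B = mset w" "length B + 1 = i" for A B
    using snoc.prems[of A "B @ [x]" "[]"] that by simp
  have "unsh \<delta> w ?g \<in> S \<and> L (unsh \<delta> w ?g) = unsh \<delta> w (\<lambda>A B. L (?g A B))"
    by (rule unsh_hom) (use assms in_S sg in auto)
  moreover have "unsh \<delta> w (\<lambda>A B. L (?g A B)) =
      unsh \<delta> w (\<lambda>A B. if length B + 1 = i then sg (p * dg \<delta> A) (L (\<phi> (A @ [f (B @ [x])]))) else 0)"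
    by (rule unsh_cong) (use in_S sg L0 in simp)
  ultimately show ?case
    using 1 assms(2,4) by (simp add: cext_snoc)
qed

lemma cext_additive:
  assumes "\<And>x y. L (x + y) = L x + L y"
  shows "L (cext \<delta> i p f \<phi> w) = cext \<delta> i p f (\<lambda>u. L (\<phi> u)) w"
proof -
  interpret additive L by standard (rule assms)
  show ?thesis using cext_hom[where S = UNIV and L = L] add minus by blast
qed

lemma cext_sg: "cext \<delta> i p f (\<lambda>u. sg n (\<phi> u)) w = sg n (cext \<delta> i p f \<phi> w)"
  by (rule cext_additive[symmetric]) (rule sg_add)

lemma cext_length: "length w < i \<Longrightarrow> cext \<delta> i p f \<phi> w = 0"
proof (induction w arbitrary: \<phi> rule: rev_induct)
  case (snoc x w)
  have "unsh \<delta> w (\<lambda>A B. if length B + 1 = i then sg (p * dg \<delta> A) (\<phi> (A @ [f (B @ [x])])) else 0)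
    = unsh \<delta> w (\<lambda>A B. 0)"
    by (rule unsh_cong') (use snoc.prems in auto)
  then show ?case using snoc by (simp add: cext_snoc)
qed simp

text \<open>Only the last position with A = [] leaves room for i arguments. So f is recovered from
  its extension on words of length i, which gives both the injectivity of the extension and the
  starting value for nested composites.\<close>

lemma cext_full:
  assumes "length w = i" "w \<noteq> []"
  shows "cext \<delta> i p f \<phi> w = \<phi> [f w]"
proof -
  obtain v x where w: "w = v @ [x]" using \<open>w \<noteq> []\<close> by (metis append_butlast_last_id)
  have "unsh \<delta> v (\<lambda>A B. if length B + 1 = i then sg (p * dg \<delta> A) (\<phi> (A @ [f (B @ [x])])) else 0)
    = unsh \<delta> v (\<lambda>A B. if A = [] then \<phi> (A @ [f (B @ [x])]) else 0)"
    by (rule unsh_cong') (use assms(1) w in auto)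
  then show ?thesis
    using assms(1) by (simp add: w cext_snoc unsh_left_empty cext_length)
qed

text \<open>The coderivation property with respect to the cocommutative unshuffle coproduct.\<close>

lemma cext_unsh:
  assumes f: "shifts \<delta> p f"
  shows "cext \<delta> i p f (\<lambda>u. unsh \<delta> u \<phi>) w =
    unsh \<delta> w (\<lambda>A B. cext \<delta> i p f (\<lambda>u. \<phi> u B) A) +
    unsh \<delta> w (\<lambda>A B. sg (p * dg \<delta> A) (cext \<delta> i p f (\<phi> A) B))"
proof (induction w arbitrary: \<phi> rule: rev_induct)
  case Nil
  then show ?case by simp
next
  case (snoc x w)
  let ?F = "cext \<delta> i p f" and ?U = "unsh \<delta>" and ?d = "dg \<delta>"
  let ?c = "\<lambda>B y. if length (B :: 'a list) + 1 = i then y else (0 :: 'b)"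
  note [cong] = if_cong
  have df: "\<delta> (f B) = ?d B + p" for B using f by (simp add: shifts_def)
  \<comment> \<open>The sums record where x and f go. In \<open>T1\<close> to \<open>T4\<close>, f
    does not use x: x ends the right part in \<open>T1\<close>, \<open>T2\<close> and the left part
    in \<open>T3\<close>, \<open>T4\<close>, while f acts in the left part in \<open>T1\<close>,
    \<open>T3\<close> and in the right part in \<open>T2\<close>, \<open>T4\<close>. In
    \<open>T5\<close> and \<open>T6\<close>, x is the last argument of f, whose value ends the right
    or the left part, respectively.\<close>
  define T1 where "T1 = ?U w (\<lambda>A B. ?F (\<lambda>u. \<phi> u (B @ [x])) A)"
  define T2 where "T2 = ?U w (\<lambda>A B. sg (p * ?d A) (?F (\<lambda>u. \<phi> A (u @ [x])) B))"
  define T3 where "T3 = ?U w (\<lambda>A B. sg (\<delta> x * ?d B) (?F (\<lambda>u. \<phi> (u @ [x]) B) A))"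
  define T4 where "T4 = ?U w (\<lambda>A B. sg (\<delta> x * ?d B + p * (?d A + \<delta> x)) (?F (\<phi> (A @ [x])) B))"
  define T5 where "T5 = ?U w (\<lambda>A B. ?U B (\<lambda>B1 B2. ?c B2 (sg (p * (?d A + ?d B1)) (\<phi> A (B1 @ [f (B2 @ [x])])))))"
  define T6 where "T6 = ?U w (\<lambda>A B. ?U A (\<lambda>A1 A2. ?c A2 (sg (\<delta> x * ?d B + p * ?d A1) (\<phi> (A1 @ [f (A2 @ [x])]) B))))"
  have "?F (\<lambda>u. ?U u \<phi>) (w @ [x]) = ?F (\<lambda>u. ?U (u @ [x]) \<phi>) w
      + ?U w (\<lambda>A B. ?c B (sg (p * ?d A) (?U (A @ [f (B @ [x])]) \<phi>)))"
    by (simp add: cext_snoc)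
  also have "?F (\<lambda>u. ?U (u @ [x]) \<phi>) w =
     ?F (\<lambda>u. ?U u (\<lambda>A B. \<phi> A (B @ [x]))) w + ?F (\<lambda>u. ?U u (\<lambda>A B. sg (\<delta> x * ?d B) (\<phi> (A @ [x]) B))) w"
    by (simp add: unsh_snoc cext_add)
  also have "?F (\<lambda>u. ?U u (\<lambda>A B. \<phi> A (B @ [x]))) w = T1 + T2"
    by (simp add: snoc.IH T1_def T2_def)
  also have "?F (\<lambda>u. ?U u (\<lambda>A B. sg (\<delta> x * ?d B) (\<phi> (A @ [x]) B))) w = T3 + T4"
  proof -
    \<comment> \<open>The sign belongs to x passing the word after f has acted on it;
      \<open>shifts\<close> gives the degree of that word.\<close>
    have "?F (\<lambda>u. sg (\<delta> x * ?d u) (\<phi> (A @ [x]) u)) B = sg (\<delta> x * (?d B + p)) (?F (\<phi> (A @ [x])) B)" for A B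
      unfolding cext_sg[symmetric] by (rule cext_cong'[OF f]) simp
    then show ?thesis
      by (simp add: snoc.IH T3_def T4_def cext_sg algebra_simps)
  qed
  also have "?U w (\<lambda>A B. ?c B (sg (p * ?d A) (?U (A @ [f (B @ [x])]) \<phi>))) = T5 + T6"
  proof -
    have "?U w (\<lambda>A B. ?c B (sg (p * ?d A) (?U (A @ [f (B @ [x])]) \<phi>))) =
      ?U w (\<lambda>A B. ?U A (\<lambda>A1 A2. ?c B (sg (p * (?d A1 + ?d A2)) (\<phi> A1 (A2 @ [f (B @ [x])]))))) +
      ?U w (\<lambda>A B. ?U A (\<lambda>A1 A2. ?c B (sg (p * (?d A1 + ?d A2) + (?d B + \<delta> x + p) * ?d A2) (\<phi> (A1 @ [f (B @ [x])]) A2))))"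
      unfolding unsh_add[symmetric]
    proof (rule unsh_cong)
      fix A B
      have e: "?U A (\<lambda>A1 A2. sg (p * ?d A) (\<psi> A1 A2)) = ?U A (\<lambda>A1 A2. sg (p * (?d A1 + ?d A2)) (\<psi> A1 A2))" for \<psi> :: "'a list \<Rightarrow> 'a list \<Rightarrow> 'b"
        by (rule unsh_cong') simp
      show "?c B (sg (p * ?d A) (?U (A @ [f (B @ [x])]) \<phi>)) =
        ?U A (\<lambda>A1 A2. ?c B (sg (p * (?d A1 + ?d A2)) (\<phi> A1 (A2 @ [f (B @ [x])]))) +
          ?c B (sg (p * (?d A1 + ?d A2) + (?d B + \<delta> x + p) * ?d A2) (\<phi> (A1 @ [f (B @ [x])]) A2)))"
        by (cases "length B + 1 = i";
            simp add: e unsh_snoc sg_add unsh_add df flip: unsh_sg; rule unsh_cong'; simp)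
    qed
    also have "?U w (\<lambda>A B. ?U A (\<lambda>A1 A2. ?c B (sg (p * (?d A1 + ?d A2)) (\<phi> A1 (A2 @ [f (B @ [x])]))))) = T5"
      unfolding T5_def by (rule unsh_coassoc)
    also have "?U w (\<lambda>A B. ?U A (\<lambda>A1 A2. ?c B (sg (p * (?d A1 + ?d A2) + (?d B + \<delta> x + p) * ?d A2) (\<phi> (A1 @ [f (B @ [x])]) A2)))) =
      ?U w (\<lambda>A B. ?U B (\<lambda>A2 B. ?c B (sg (p * (?d A + ?d A2) + (?d B + \<delta> x + p) * ?d A2) (\<phi> (A @ [f (B @ [x])]) A2))))"
      by (rule unsh_coassoc)
    \<comment> \<open>The value of f has passed A2 to reach the left part. Swapping the blocks A2
      and B cancels the product of their degrees, the two terms p * dg A2 cancel mod 2, and the sign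
      of \<open>T6\<close> remains.\<close>
    also have "\<dots> = ?U w (\<lambda>A B. ?U B (\<lambda>B A2. ?c B (sg (\<delta> x * ?d A2 + p * ?d A) (\<phi> (A @ [f (B @ [x])]) A2))))"
      by (subst (2) unsh_cocomm, intro unsh_cong) (auto intro!: sg_cong)
    also have "\<dots> = T6"
      unfolding T6_def by (rule unsh_coassoc[symmetric])
    finally show ?thesis .
  qed
  finally have L: "?F (\<lambda>u. ?U u \<phi>) (w @ [x]) = T1 + T2 + (T3 + T4) + (T5 + T6)" .
  have "?U (w @ [x]) (\<lambda>A B. ?F (\<lambda>u. \<phi> u B) A) = T1 + (T3 + T6)"
    by (simp add: unsh_snoc cext_snoc T1_def T3_def T6_def sg_add unsh_add sg_if flip: unsh_sg)
  moreover have "?U (w @ [x]) (\<lambda>A B. sg (p * ?d A) (?F (\<phi> A) B)) = (T2 + T5) + T4"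
    by (simp add: unsh_snoc cext_snoc T2_def T4_def T5_def sg_add unsh_add sg_if algebra_simps flip: unsh_sg)
  ultimately show ?case using L by (simp add: algebra_simps)
qed


text \<open>The comultiplication of the coalgebra, except that the left factor may be empty.\<close>

definition hunsh ::
  "('l \<Rightarrow> int) \<Rightarrow> 'l list \<Rightarrow> ('l list \<Rightarrow> 'l list \<Rightarrow> 'w::ab_group_add) \<Rightarrow> 'w"
  where "hunsh \<delta> w \<phi> = unsh \<delta> (butlast w) (\<lambda>A B. \<phi> A (B @ [last w]))"

text \<open>If f does not use the last letter x, \<open>cext_unsh\<close> applies to the letters
  before it. If it does, the value of f is the new last letter and stays in the right factor;
  coassociativity then reads the remaining split as one made before f acts on the right
  factor.\<close>

lemma cext_hunsh:
  assumes f: "shifts \<delta> p f" and "w \<noteq> []"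
  shows "cext \<delta> i p f (\<lambda>u. hunsh \<delta> u \<phi>) w =
    hunsh \<delta> w (\<lambda>A B. cext \<delta> i p f (\<lambda>u. \<phi> u B) A) +
    hunsh \<delta> w (\<lambda>A B. sg (p * dg \<delta> A) (cext \<delta> i p f (\<phi> A) B))"
proof -
  obtain v x where w: "w = v @ [x]"
    using \<open>w \<noteq> []\<close> by (metis append_butlast_last_id)
  let ?F = "cext \<delta> i p f" and ?U = "unsh \<delta>" and ?d = "dg \<delta>"
  let ?c = "\<lambda>B y. if length (B :: 'a list) + 1 = i then y else (0 :: 'b)"
  note [cong] = if_cong
  have "?U v (\<lambda>A B. ?c B (sg (p * ?d A) (?U A (\<lambda>A1 A2. \<phi> A1 (A2 @ [f (B @ [x])]))))) =
      ?U v (\<lambda>A B. ?U A (\<lambda>A1 A2. ?c B (sg (p * (?d A1 + ?d A2)) (\<phi> A1 (A2 @ [f (B @ [x])])))))"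
    by (rule unsh_cong) (auto simp flip: unsh_sg intro!: unsh_cong')
  also have "\<dots> = ?U v (\<lambda>A B. ?U B (\<lambda>B1 B2. ?c B2 (sg (p * (?d A + ?d B1)) (\<phi> A (B1 @ [f (B2 @ [x])])))))"
    by (rule unsh_coassoc)
  finally show ?thesis
    by (simp add: w hunsh_def cext_snoc cext_unsh[OF f] sg_add unsh_add sg_if algebra_simps flip: unsh_sg)
qed

text \<open>The terms in which f and g act side by side cancel; in the remaining ones, both act
  on the block that contains the last letter.\<close>

lemma cext_commutator_snoc:
  assumes f: "shifts \<delta> p f" and g: "shifts \<delta> q g"
  shows "cext \<delta> j q g (cext \<delta> i p f \<phi>) (w @ [x]) - sg (p * q) (cext \<delta> i p f (cext \<delta> j q g \<phi>) (w @ [x])) =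
    cext \<delta> j q g (cext \<delta> i p f (\<lambda>u. \<phi> (u @ [x]))) w
      - sg (p * q) (cext \<delta> i p f (cext \<delta> j q g (\<lambda>u. \<phi> (u @ [x]))) w) +
    unsh \<delta> w (\<lambda>A B. sg ((p + q) * dg \<delta> A)
      (cext \<delta> j q g (\<lambda>u. if length u = i then \<phi> (A @ [f u]) else 0) (B @ [x])
       - sg (p * q) (cext \<delta> i p f (\<lambda>u. if length u = j then \<phi> (A @ [g u]) else 0) (B @ [x]))))"
proof -
  \<comment> \<open>The four sums: neither map uses x; they act side by side and f uses x; they act
    side by side and g uses x; the value of g is an argument of f. The formula is proved for all f
    and g because both orders are needed.\<close>
  have *: "cext \<delta> j q g (cext \<delta> i p f \<phi>) (w @ [x]) =
    cext \<delta> j q g (cext \<delta> i p f (\<lambda>u. \<phi> (u @ [x]))) w +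
    unsh \<delta> w (\<lambda>A B. if length B + 1 = i then sg (p * (dg \<delta> A + q)) (cext \<delta> j q g (\<lambda>u. \<phi> (u @ [f (B @ [x])])) A) else 0) +
    unsh \<delta> w (\<lambda>A B. if length B + 1 = j then sg (q * dg \<delta> A) (cext \<delta> i p f (\<lambda>u. \<phi> (u @ [g (B @ [x])])) A) else 0) +
    unsh \<delta> w (\<lambda>A B. sg ((p + q) * dg \<delta> A)
      (cext \<delta> j q g (\<lambda>u. if length u = i then \<phi> (A @ [f u]) else 0) (B @ [x])))"
    if f: "shifts \<delta> p f" and g: "shifts \<delta> q g" for i j p q f g
  proof -
    let ?F = "cext \<delta> i p f" and ?G = "cext \<delta> j q g" and ?U = "unsh \<delta>" and ?d = "dg \<delta>"
    let ?c = "\<lambda>i B y. if length (B :: 'a list) + 1 = i then y else (0 :: 'b)"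
    note [cong] = if_cong
    have ifs: "?G (\<lambda>u. if P then \<psi> u else 0) A = (if P then ?G \<psi> A else 0)" for \<psi> A P by simp
    have "?G (?F \<phi>) (w @ [x]) = ?G (\<lambda>u. ?F (\<lambda>u. \<phi> (u @ [x])) u) w +
        ?G (\<lambda>u. ?U u (\<lambda>A B. ?c i B (sg (p * ?d A) (\<phi> (A @ [f (B @ [x])]))))) w +
        ?U w (\<lambda>A B. ?c j B (sg (q * ?d A) (?F \<phi> (A @ [g (B @ [x])]))))"
      by (simp add: cext_snoc cext_add)
    also have "?G (\<lambda>u. ?U u (\<lambda>A B. ?c i B (sg (p * ?d A) (\<phi> (A @ [f (B @ [x])]))))) w =
      ?U w (\<lambda>A B. ?c i B (sg (p * (?d A + q)) (?G (\<lambda>u. \<phi> (u @ [f (B @ [x])])) A))) +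
      ?U w (\<lambda>A B. sg ((p + q) * ?d A) (?G (\<lambda>u. ?c i u (\<phi> (A @ [f (u @ [x])]))) B))"
    proof -
      have "?G (\<lambda>u. sg (p * ?d u) (\<psi> u)) A = sg (p * (?d A + q)) (?G \<psi> A)" for \<psi> :: "'a list \<Rightarrow> 'b" and A
        unfolding cext_sg[symmetric] by (rule cext_cong'[OF g]) simp
      moreover have "?G (\<lambda>u. ?c i u (sg (p * ?d A) (\<phi> (A @ [f (u @ [x])])))) B =
         sg (p * ?d A) (?G (\<lambda>u. ?c i u (\<phi> (A @ [f (u @ [x])]))) B)" for A B
        unfolding cext_sg[symmetric] by (simp add: sg_if)
      ultimately show ?thesis
        by (simp add: cext_unsh[OF g] ifs algebra_simps)
    qed
    also have "?U w (\<lambda>A B. ?c j B (sg (q * ?d A) (?F \<phi> (A @ [g (B @ [x])])))) =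
      ?U w (\<lambda>A B. ?c j B (sg (q * ?d A) (?F (\<lambda>u. \<phi> (u @ [g (B @ [x])])) A))) +
      ?U w (\<lambda>A B. sg ((p + q) * ?d A) (?U B (\<lambda>B1 B2. ?c j B2 (sg (q * ?d B1) (?c i B1 (\<phi> (A @ [f (B1 @ [g (B2 @ [x])])])))))))"
    proof -
      have "?U w (\<lambda>A B. ?c j B (sg (q * ?d A) (?U A (\<lambda>A1 A2. ?c i A2 (sg (p * ?d A1) (\<phi> (A1 @ [f (A2 @ [g (B @ [x])])]))))))) =
        ?U w (\<lambda>A B. ?U A (\<lambda>A1 A2. ?c j B (?c i A2 (sg (q * (?d A1 + ?d A2) + p * ?d A1) (\<phi> (A1 @ [f (A2 @ [g (B @ [x])])]))))))"
        by (rule unsh_cong) (auto simp: sg_if simp flip: unsh_sg intro!: unsh_cong')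
      also have "\<dots> = ?U w (\<lambda>A B. ?U B (\<lambda>B1 B2. ?c j B2 (?c i B1 (sg (q * (?d A + ?d B1) + p * ?d A) (\<phi> (A @ [f (B1 @ [g (B2 @ [x])])]))))))"
        by (rule unsh_coassoc)
      finally have "?U w (\<lambda>A B. ?c j B (sg (q * ?d A) (?U A (\<lambda>A1 A2. ?c i A2 (sg (p * ?d A1) (\<phi> (A1 @ [f (A2 @ [g (B @ [x])])]))))))) = \<dots>" .
      moreover have "?c i B (y + z) = ?c i B y + ?c i B z" for i B y z by simp
      ultimately show ?thesis
        by (simp add: cext_snoc sg_add unsh_add sg_if algebra_simps flip: unsh_sg)
    qed
    finally show ?thesis
      by (simp add: cext_snoc sg_add unsh_add sg_if add.assoc flip: unsh_sg)
  qed
  \<comment> \<open>Up to the sign of p * q, the second sum of one order is the third sum of the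
    other, so they cancel in the commutator.\<close>
  have "unsh \<delta> w (\<lambda>A B. if length B + 1 = i then sg (p * (dg \<delta> A + q)) (cext \<delta> j q g (\<lambda>u. \<phi> (u @ [f (B @ [x])])) A) else 0)
    = sg (p * q) (unsh \<delta> w (\<lambda>A B. if length B + 1 = i then sg (p * dg \<delta> A) (cext \<delta> j q g (\<lambda>u. \<phi> (u @ [f (B @ [x])])) A) else 0))" for i j p q f g
    unfolding unsh_sg[symmetric] by (rule unsh_cong) (simp add: algebra_simps)
  moreover have "sg (p * q + p * q) y = y" for y :: 'b by (simp add: sg_def)
  ultimately show ?thesis
    by (simp add: *[OF f g] *[OF g f] sg_add unsh_diff sg_diff unsh_sg[symmetric] mult.commute[of q p] add.commute[of q p])
      (simp add: algebra_simps)
qed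


section \<open>Nested brackets with a derivation\<close>

definition typed :: "(int \<Rightarrow> 'v set) \<Rightarrow> ('v \<times> int) list \<Rightarrow> bool"
  where "typed G w \<longleftrightarrow> (\<forall>(x, n)\<in>set w. x \<in> G n)"

lemma typed_simps [simp]:
  "typed G []" "typed G (l # w) \<longleftrightarrow> fst l \<in> G (snd l) \<and> typed G w"
  "typed G (v @ w) \<longleftrightarrow> typed G v \<and> typed G w"
  by (auto simp: typed_def case_prod_beta)

lemma typed_subset: "typed G w \<Longrightarrow> set A \<subseteq> set w \<Longrightarrow> typed G A"
  by (auto simp: typed_def)

text \<open>The value of f with its formal degree, which also makes sense if the value is 0.\<close>

definition hat :: "int \<Rightarrow> ('v list \<Rightarrow> 'v) \<Rightarrow> ('v \<times> int) list \<Rightarrow> 'v \<times> int"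
  where "hat p f w = (f (map fst w), dg snd w + p)"

lemma hat_simps [simp]: "fst (hat p f w) = f (map fst w)" "snd (hat p f w) = dg snd w + p"
  by (simp_all add: hat_def)

lemma shifts_hat: "shifts snd p (hat p f)"
  by (simp add: shifts_def)

context vector_space
begin

lemma powi_minus_one_scale: "scale ((-1) powi n) x = sg n x"
  by (auto simp: sg_def power_int_minus_left)

end

text \<open>\<open>N_op\<close> without the arity test: the arity is read off the length of the
  word, so that splitting off the last letter needs no case distinction on nonempty words.\<close>

definition nest :: "('v \<Rightarrow> 'v \<Rightarrow> 'v) \<Rightarrow> ('v \<Rightarrow> 'v) \<Rightarrow> 'v list \<Rightarrow> 'v"
  where "nest br D xs = foldl br (D (hd xs)) (tl xs)"

lemma nest_single [simp]: "nest br D [x] = D x"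
  by (simp add: nest_def)

lemma nest_snoc [simp]: "xs \<noteq> [] \<Longrightarrow> nest br D (xs @ [x]) = br (nest br D xs) x"
  by (cases xs) (simp_all add: nest_def)

lemma nest_snoc' [simp]: "nest br D (xs @ y # ys @ [x]) = br (nest br D (xs @ y # ys)) x"
  using nest_snoc[of "xs @ y # ys"] by simp

text \<open>The composite of N E' with the extension of the i-ary map N E. The arity of N E' is
  determined by the length of the word.\<close>

definition nest_comp ::
  "('v::ab_group_add \<Rightarrow> 'v \<Rightarrow> 'v) \<Rightarrow> ('v \<Rightarrow> 'v) \<Rightarrow> int \<Rightarrow> ('v \<Rightarrow> 'v) \<Rightarrow> nat \<Rightarrow> ('v \<times> int) list \<Rightarrow> 'v"
  where "nest_comp br E p E' i w = cext snd i p (hat p (nest br E)) (\<lambda>u. nest br E' (map fst u)) w"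

context graded_leibniz_algebra
begin

lemma br_add: "br (x + y) z = br x z + br y z" "br x (y + z) = br x y + br x z"
  using linear_left[of z] linear_right[of x] by (simp_all add: Vector_Spaces.linear_iff)

lemma br_scale: "br (s c x) y = s c (br x y)" "br x (s c y) = s c (br x y)"
  using linear_left[of y] linear_right[of x] by (simp_all add: Vector_Spaces.linear_iff)

lemma br_zero [simp]: "br 0 y = 0" "br x 0 = 0"
  using br_add(1)[of 0 0 y] br_add(2)[of x 0 0] by simp_all

lemma br_minus: "br (- x) y = - br x y" "br x (- y) = - br x y"
proof -
  interpret l: additive "\<lambda>x. br x y" by standard (rule br_add)
  interpret r: additive "\<lambda>y. br x y" by standard (rule br_add)
  show "br (- x) y = - br x y" "br x (- y) = - br x y" by (rule l.minus, rule r.minus)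
qed

lemma br_diff: "br (x - y) z = br x z - br y z"
  using br_add(1)[of x "- y" z] by (simp add: br_minus)

lemma br_sg: "br (sg n x) y = sg n (br x y)" "br x (sg n y) = sg n (br x y)"
  by (simp_all add: sg_def br_minus)

lemma br_unsh: "br (unsh \<delta> w \<phi>) y = unsh \<delta> w (\<lambda>A B. br (\<phi> A B) y)"
  by (rule unsh_additive) (rule br_add)

lemma leibniz_sg:
  "x \<in> G a \<Longrightarrow> y \<in> G b \<Longrightarrow> br x (br y z) = br (br x y) z + sg (a * b) (br y (br x z))"
  using leibniz[of x a y b z] by (simp only: powi_minus_one_scale)

text \<open>The bracket need not be graded antisymmetric, but left multiplications see only its
  antisymmetric part.\<close>

lemma br_antisym_left:
  assumes "x \<in> G a" "y \<in> G b"
  shows "br (br x y) z = - sg (a * b) (br (br y x) z)"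
proof -
  \<comment> \<open>The Leibniz identities for x, y and for y, x express the two threefold brackets
    through each other; substituting one into the other leaves the claim.\<close>
  have "u = - sg k v" if "x1 = u + sg k y1" "y1 = v + sg k x1" for u v x1 y1 :: 'v and k
    using that by (cases "even k") (simp_all add: sg_def algebra_simps eq_neg_iff_add_eq_0)
  from this[OF leibniz_sg[OF assms] leibniz_sg[OF assms(2,1), unfolded mult.commute[of b a]]]
  show ?thesis .
qed

lemma nest_degree:
  assumes "\<And>n x. x \<in> G n \<Longrightarrow> E x \<in> G (n + p)" and "typed G u" "u \<noteq> []"
  shows "nest br E (map fst u) \<in> G (dg snd u + p)"
  using assms(2,3)
proof (induction u rule: rev_induct)
  case (snoc x u)
  then show ?case
    using degree_br[of "nest br E (map fst u)" "dg snd u + p" "fst x" "snd x"] assms(1)[of "fst x" "snd x"]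
    by (cases "u = []") (auto simp: algebra_simps)
qed simp

lemma nest_comp_top:
  assumes "length w = i" "w \<noteq> []"
  shows "nest_comp br E p E' i w = E' (nest br E (map fst w))"
  by (simp add: nest_comp_def cext_full[OF assms])

text \<open>The last letter is the last argument either of the outer bracket or of the inner map; in
  the second case the inner value is the last argument of the outer bracket, and A holds the others.
  The outer arity is a on w and a + 1 on w x. It must be positive on w because \<open>nest\<close>
  means nothing on the empty word.\<close>

lemma nest_comp_snoc:
  assumes "length w = a + i - 1" "1 \<le> a" "1 \<le> i"
  shows "nest_comp br E p E' i (w @ [x]) = br (nest_comp br E p E' i w) (fst x) +
    unsh snd w (\<lambda>A B. if length A = a
      then sg (p * dg snd A) (br (nest br E' (map fst A)) (nest br E (map fst (B @ [x])))) else 0)"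
proof -
  have "cext snd i p (hat p (nest br E)) (\<lambda>u. nest br E' (map fst (u @ [x]))) w
      = br (nest_comp br E p E' i w) (fst x)"
    unfolding nest_comp_def
    by (subst cext_additive[where L = "\<lambda>z. br z (fst x)"]) (auto simp: br_add intro!: cext_cong)
  moreover have "unsh snd w (\<lambda>A B. if length B + 1 = i then sg (p * dg snd A) (nest br E' (map fst (A @ [hat p (nest br E) (B @ [x])]))) else 0)
    = unsh snd w (\<lambda>A B. if length A = a
      then sg (p * dg snd A) (br (nest br E' (map fst A)) (nest br E (map fst (B @ [x])))) else 0)"
  proof (rule unsh_cong')
    fix A B :: "('v \<times> int) list" assume *: "length A + length B = length w"
    then have "length B + 1 = i \<longleftrightarrow> length A = a" "length A = a \<Longrightarrow> A \<noteq> []"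
      using assms by auto
    then show "(if length B + 1 = i then sg (p * dg snd A) (nest br E' (map fst (A @ [hat p (nest br E) (B @ [x])]))) else 0) =
      (if length A = a then sg (p * dg snd A) (br (nest br E' (map fst A)) (nest br E (map fst (B @ [x])))) else 0)"
      by (auto simp del: append_Cons)
  qed
  ultimately show ?thesis
    by (simp add: nest_comp_def[of _ _ _ _ _ "w @ [x]"] cext_snoc)
qed

end

section \<open>Composites of the nested brackets of two derivations\<close>

locale leibniz_derivations = graded_leibniz_algebra s G br
  for s :: "'k::field \<Rightarrow> 'v::ab_group_add \<Rightarrow> 'v" and G :: "int \<Rightarrow> 'v set" and br :: "'v \<Rightarrow> 'v \<Rightarrow> 'v" +
  fixes D D' :: "'v \<Rightarrow> 'v" and p q :: int
  assumes derivation_D: "derivation s G br p D" and derivation_D': "derivation s G br q D'"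
begin

lemma D_degree: "x \<in> G n \<Longrightarrow> D x \<in> G (n + p)" "x \<in> G n \<Longrightarrow> D' x \<in> G (n + q)"
  using derivation_D derivation_D' unfolding derivation_def by blast+

lemma D_br:
  "x \<in> G a \<Longrightarrow> D (br x y) = br (D x) y + sg (p * a) (br x (D y))"
  "x \<in> G a \<Longrightarrow> D' (br x y) = br (D' x) y + sg (q * a) (br x (D' y))"
  using derivation_D derivation_D' by (simp_all add: derivation_def powi_minus_one_scale)

abbreviation "n \<equiv> \<lambda>E u. nest br E (map fst u)"
text \<open>The two composites in (N_i D, N_j D'): D is outermost in \<open>P\<close>, D' in
  \<open>Q\<close>, and the index is the arity of the inner map.\<close>

abbreviation "P \<equiv> nest_comp br D' q D"
abbreviation "Q \<equiv> nest_comp br D p D'"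

text \<open>Taking one argument from the inner map and giving it to the outer one costs, by the
  Leibniz identity, brackets of N D'(A) with N D(B). The other terms come in pairs {t, m}, {m, t}
  and cancel only under \<open>br _ y\<close>, by \<open>br_antisym_left\<close>; so y belongs to
  the claim. The outer arity is a for \<open>Q b v\<close> and a + 1 for
  \<open>Q (b - 1) v\<close>.\<close>

lemma nest_comp_exchange:
  assumes "typed G v" "length v = a + b - 1" "1 \<le> a" "2 \<le> b"
  shows "br (Q b v + unsh snd v (\<lambda>A B. if length A = a
      then sg (p * dg snd A) (br (n D' A) (n D B)) else 0)) y = br (Q (b - 1) v) y"
  using assms(3,1,2)
proof (induction a arbitrary: v y rule: dec_induct)
  case base
  have "v \<noteq> []" using base assms(4) by auto
  then obtain v' x where v: "v = v' @ [x]" by (metis append_butlast_last_id)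
  let ?d = "dg snd"
  have v': "length v' = 1 + (b - 1) - 1" "length v' = b - 1" "v' \<noteq> []" "typed G v'" and x: "fst x \<in> G (snd x)"
    using base assms(4) v by auto
  define S1 where "S1 = unsh snd v' (\<lambda>A B. if length A = 1
    then sg (p * ?d A) (br (n D' A) (n D (B @ [x]))) else 0)"
  have 1: "Q (b - 1) v = br (Q (b - 1) v') (fst x) + S1"
    unfolding v S1_def by (rule nest_comp_snoc) (use v' assms(4) in auto)
  have 2: "Q (b - 1) v' = D' (n D v')"
    by (rule nest_comp_top) (use v' in auto)
  have 3: "Q b v = D' (br (n D v') (fst x))"
    using nest_comp_top[of v b D p D'] v v' assms(4) by simp
  have "unsh snd v' (\<lambda>A B. sg (snd x * ?d B) (if length (A @ [x]) = 1
      then sg (p * ?d (A @ [x])) (br (n D' (A @ [x])) (n D B)) else 0)) =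
      unsh snd v' (\<lambda>A B. if A = [] then sg (snd x * ?d B + p * snd x) (br (D' (fst x)) (n D B)) else 0)"
    by (rule unsh_cong) auto
  then have 4: "unsh snd v (\<lambda>A B. if length A = 1 then sg (p * ?d A) (br (n D' A) (n D B)) else 0)
      = S1 + sg (snd x * ?d v' + p * snd x) (br (D' (fst x)) (n D v'))"
    unfolding v unsh_snoc S1_def unsh_left_empty by simp
  \<comment> \<open>The derivation rule for D' leaves {N D(v'), D' x}, and the unshuffle with A =
    [x] leaves {D' x, N D(v')}: one antisymmetric pair.\<close>
  have "n D v' \<in> G (?d v' + p)" "D' (fst x) \<in> G (snd x + q)"
    using v' x D_degree by (auto intro: nest_degree)
  then show ?case
    unfolding 1 2 3 4
    by (simp add: br_add D_br br_sg br_antisym_left[of "n D v'" "?d v' + p" "D' (fst x)" "snd x + q"])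
      (auto simp: sg_def)
next
  case (step a)
  have "v \<noteq> []" using step assms(4) by auto
  then obtain v' x where v: "v = v' @ [x]" by (metis append_butlast_last_id)
  let ?d = "dg snd"
  let ?c = "\<lambda>A y. if length (A :: ('v \<times> int) list) = a then y else (0 :: 'v)"
  note [cong] = if_cong
  have v': "length v' = a + b - 1" "typed G v'" and x: "fst x \<in> G (snd x)"
    using step.prems assms(4) v by auto
  define S1 where "S1 = unsh snd v' (\<lambda>A B. if length A = Suc a
    then sg (p * ?d A) (br (n D' A) (n D (B @ [x]))) else 0)"
  have 1: "Q (b - 1) v = br (Q (b - 1) v') (fst x) + S1"
    unfolding v S1_def by (rule nest_comp_snoc) (use v' assms(4) in auto)
  have 2: "unsh snd v (\<lambda>A B. if length A = Suc a then sg (p * ?d A) (br (n D' A) (n D B)) else 0)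
      = S1 + unsh snd v' (\<lambda>A B. ?c A (sg (snd x * ?d B + p * (?d A + snd x)) (br (n D' (A @ [x])) (n D B))))"
    unfolding v unsh_snoc S1_def by (simp add: sg_if)
  have 3: "Q b v = br (Q b v') (fst x) + unsh snd v' (\<lambda>A B. ?c A (sg (p * ?d A) (br (n D' A) (n D (B @ [x])))))"
    unfolding v by (rule nest_comp_snoc) (use v' step assms(4) in auto)
  \<comment> \<open>The induction hypothesis for v', with x in the place of y.\<close>
  have 4: "br (br (Q (b - 1) v') (fst x)) y = br (br (Q b v') (fst x)) y +
      unsh snd v' (\<lambda>A B. br (br (?c A (sg (p * ?d A) (br (n D' A) (n D B)))) (fst x)) y)"
    unfolding step.IH[OF v'(2,1), symmetric] by (simp add: br_add br_unsh)
  \<comment> \<open>With u = N D'(A) and t = N D(B), the Leibniz identity splits {u, {t, x}} into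
    {{u, t}, x} and {t, {u, x}}. The latter cancels against {{u, x}, t}, which comes from x at the
    end of the block A.\<close>
  have 5: "unsh snd v' (\<lambda>A B. br (?c A (sg (p * ?d A) (br (n D' A) (n D (B @ [x]))))) y) +
      unsh snd v' (\<lambda>A B. br (?c A (sg (snd x * ?d B + p * (?d A + snd x)) (br (n D' (A @ [x])) (n D B)))) y)
    = unsh snd v' (\<lambda>A B. br (br (?c A (sg (p * ?d A) (br (n D' A) (n D B)))) (fst x)) y)"
    unfolding unsh_add[symmetric]
  proof (rule unsh_cong')
    fix A B assume AB: "set A \<subseteq> set v'" "set B \<subseteq> set v'" "length A + length B = length v'"
    show "br (?c A (sg (p * ?d A) (br (n D' A) (n D (B @ [x]))))) y +
      br (?c A (sg (snd x * ?d B + p * (?d A + snd x)) (br (n D' (A @ [x])) (n D B)))) y =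
      br (br (?c A (sg (p * ?d A) (br (n D' A) (n D B)))) (fst x)) y"
    proof (cases "length A = a")
      case True
      then have "A \<noteq> []" "B \<noteq> []" using AB v' step assms(4) by auto
      then have u: "n D' A \<in> G (?d A + q)" and t: "n D B \<in> G (?d B + p)"
        using AB v' typed_subset by (auto intro!: nest_degree D_degree)
      have m: "br (n D' A) (fst x) \<in> G (?d A + q + snd x)"
        using u x by (rule degree_br)
      show ?thesis
        using True \<open>A \<noteq> []\<close> \<open>B \<noteq> []\<close>
        by (simp add: leibniz_sg[OF u t] br_add br_sg sg_add br_antisym_left[OF t m])
          (auto simp: sg_def)
    qed simp
  qed
  show ?case
    unfolding 1 2 3 using 4 5 by (simp add: br_add br_unsh algebra_simps)
qed

text \<open>Splitting off the last letter x produces {N D(A), N D'(B x)} and {N D'(B), N D(A x)},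
  which the Leibniz identity for N D'(B), N D(A), x compares. What is left over, {{N D'(B), N D(A)},
  x}, is the correction by which the exchange lemma replaces \<open>Q i w\<close> by
  \<open>Q (i - 1) w\<close>, and then the induction hypothesis for i - 1 and j applies.\<close>

lemma nest_comp_commutator:
  assumes "typed G z" "length z = i + j - 1" "1 \<le> i" "1 \<le> j"
  shows "P j z - sg (p * q) (Q i z) = n (gcomm s p q D D') z"
  using assms
proof (induction z arbitrary: i j rule: rev_induct)
  case Nil
  then show ?case by simp
next
  case (snoc x w)
  let ?d = "dg snd" and ?h = "gcomm s p q D D'"
  have x: "fst x \<in> G (snd x)" and w: "typed G w" using snoc.prems by auto
  have h: "?h y = D (D' y) - sg (p * q) (D' (D y))" for y
    by (simp add: gcomm_def powi_minus_one_scale)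
  \<comment> \<open>A unary inner map that acts on x uses no other letter, so a single unshuffle
    remains.\<close>
  have lone: "nest_comp br E r E' 1 (w @ [x]) = br (nest_comp br E r E' 1 w) (fst x) +
      sg (r * ?d w) (br (n E' w) (E (fst x)))" if "w \<noteq> []" for E r E'
  proof -
    have "unsh snd w (\<lambda>A B. if length A = length w
        then sg (r * ?d A) (br (n E' A) (n E (B @ [x]))) else 0) =
      unsh snd w (\<lambda>A B. if B = [] then sg (r * ?d A) (br (n E' A) (E (fst x))) else 0)"
      by (rule unsh_cong') auto
    then show ?thesis
      using that by (subst nest_comp_snoc[where a = "length w"]) (auto simp: unsh_right_empty Suc_le_eq)
  qed
  consider "w = []" | "w \<noteq> []" "i = 1" "2 \<le> j" | "w \<noteq> []" "j = 1" "2 \<le> i" | "w \<noteq> []" "2 \<le> i" "2 \<le> j"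
    using snoc.prems by (cases w) fastforce+
  then show ?case
  proof cases
    case 1
    then have "i = 1" "j = 1" using snoc.prems by auto
    then show ?thesis
      using 1 nest_comp_top[of "[x]" 1] by (simp add: h)
  next
    \<comment> \<open>For i = 1, D is applied to a whole nested bracket, and the derivation rule
      plays the part of the Leibniz identity: the term {N D'(w), D x} cancels against the one from
      \<open>lone\<close>. The case j = 1 is symmetric.\<close>
    case 2
    have "n D' w \<in> G (?d w + q)" using 2 w by (auto intro: nest_degree D_degree)
    moreover have "P j (w @ [x]) = D (br (n D' w) (fst x))"
      using 2 snoc.prems by (subst nest_comp_top) auto
    moreover have "P (j - 1) w = D (n D' w)"
      using 2 snoc.prems by (subst nest_comp_top) auto
    moreover have "P (j - 1) w - sg (p * q) (Q 1 w) = n ?h w"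
      by (rule snoc.IH) (use 2 w snoc.prems in auto)
    ultimately show ?thesis
      using 2 lone[of D p D'] unfolding \<open>i = 1\<close>
      by (simp add: D_br br_diff br_sg flip: \<open>_ = n ?h w\<close>) (auto simp: sg_def)
  next
    case 3
    have "n D w \<in> G (?d w + p)" using 3 w by (auto intro: nest_degree D_degree)
    moreover have "Q i (w @ [x]) = D' (br (n D w) (fst x))"
      using 3 snoc.prems by (subst nest_comp_top) auto
    moreover have "Q (i - 1) w = D' (n D w)"
      using 3 snoc.prems by (subst nest_comp_top) auto
    moreover have "P 1 w - sg (p * q) (Q (i - 1) w) = n ?h w"
      by (rule snoc.IH) (use 3 w snoc.prems in auto)
    ultimately show ?thesis
      using 3 lone[of D' q D] unfolding \<open>j = 1\<close>
      by (simp add: D_br br_diff br_sg flip: \<open>_ = n ?h w\<close>) (auto simp: sg_def)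
  next
    case 4
    let ?c = "\<lambda>a A y. if length (A :: ('v \<times> int) list) = a then y else (0 :: 'v)"
    have 1: "P j (w @ [x]) = br (P j w) (fst x) +
        unsh snd w (\<lambda>A B. ?c (i - 1) A (sg (q * ?d A) (br (n D A) (n D' (B @ [x])))))"
      by (rule nest_comp_snoc) (use 4 snoc.prems in auto)
    have "Q i (w @ [x]) = br (Q i w) (fst x) +
        unsh snd w (\<lambda>A B. ?c (j - 1) A (sg (p * ?d A) (br (n D' A) (n D (B @ [x])))))"
      by (rule nest_comp_snoc) (use 4 snoc.prems in auto)
    \<comment> \<open>Cocommutativity renames the blocks so that D acts on A and D' on B in both
      sums.\<close>
    then have 2: "Q i (w @ [x]) = br (Q i w) (fst x) +
        unsh snd w (\<lambda>A B. sg (?d A * ?d B) (?c (j - 1) B (sg (p * ?d B) (br (n D' B) (n D (A @ [x]))))))"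
      by (subst (asm) unsh_cocomm)
    have 3: "br (Q i w + unsh snd w (\<lambda>A B. ?c (j - 1) A (sg (p * ?d A) (br (n D' A) (n D B))))) (fst x)
        = br (Q (i - 1) w) (fst x)"
      by (rule nest_comp_exchange) (use 4 w snoc.prems in auto)
    then have 3: "br (Q (i - 1) w) (fst x) = br (Q i w) (fst x) +
        unsh snd w (\<lambda>A B. sg (?d A * ?d B) (br (?c (j - 1) B (sg (p * ?d B) (br (n D' B) (n D A)))) (fst x)))"
      by (subst (asm) unsh_cocomm) (simp add: br_add br_unsh br_sg)
    have IH: "P j w - sg (p * q) (Q (i - 1) w) = n ?h w"
      by (rule snoc.IH) (use 4 w snoc.prems in auto)
    have 5: "unsh snd w (\<lambda>A B. ?c (i - 1) A (sg (q * ?d A) (br (n D A) (n D' (B @ [x]))))) -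
      unsh snd w (\<lambda>A B. sg (p * q) (sg (?d A * ?d B) (?c (j - 1) B (sg (p * ?d B) (br (n D' B) (n D (A @ [x]))))))) =
      - unsh snd w (\<lambda>A B. sg (p * q) (sg (?d A * ?d B) (br (?c (j - 1) B (sg (p * ?d B) (br (n D' B) (n D A)))) (fst x))))"
      unfolding unsh_diff[symmetric] unsh_minus[symmetric]
    proof (rule unsh_cong')
      fix A B assume AB: "set A \<subseteq> set w" "set B \<subseteq> set w" "length A + length B = length w"
      \<comment> \<open>Since w has i + j - 2 letters, the two arity conditions are the
        same.\<close>
      have len: "length A = i - 1 \<longleftrightarrow> length B = j - 1" using AB 4 snoc.prems by auto
      show "?c (i - 1) A (sg (q * ?d A) (br (n D A) (n D' (B @ [x])))) -
        sg (p * q) (sg (?d A * ?d B) (?c (j - 1) B (sg (p * ?d B) (br (n D' B) (n D (A @ [x])))))) =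
        - sg (p * q) (sg (?d A * ?d B) (br (?c (j - 1) B (sg (p * ?d B) (br (n D' B) (n D A)))) (fst x)))"
      proof (cases "length B = j - 1")
        case True
        then have "A \<noteq> []" "B \<noteq> []" using AB len 4 by auto
        then have u: "n D' B \<in> G (?d B + q)" and t: "n D A \<in> G (?d A + p)"
          using AB w typed_subset by (auto intro!: nest_degree D_degree)
        show ?thesis
          using True len \<open>A \<noteq> []\<close> \<open>B \<noteq> []\<close>
          by (simp add: leibniz_sg[OF u t] sg_add br_sg) (auto simp: sg_def)
      qed (use len in auto)
    qed
    have "P j (w @ [x]) - sg (p * q) (Q i (w @ [x])) = br (P j w) (fst x) - sg (p * q) (br (Q (i - 1) w) (fst x))"
      unfolding 1 2 3 using 5 by (simp add: sg_add algebra_simps flip: unsh_sg)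
    also have "\<dots> = n ?h (w @ [x])"
      using 4 by (simp add: br_diff br_sg flip: IH)
    finally show ?thesis .
  qed
qed

end


section \<open>Unshuffles as subsets\<close>

lemma nths_eq_map_filter: "nths w I = map ((!) w) (filter (\<lambda>m. m \<in> I) [0..<length w])"
proof (induction w rule: rev_induct)
  case (snoc x w)
  have "map ((!) (w @ [x])) (filter (\<lambda>m. m \<in> I) [0..<length w]) = map ((!) w) (filter (\<lambda>m. m \<in> I) [0..<length w])"
    by (auto simp: nth_append)
  then show ?case by (simp add: nths_append snoc)
qed simp

lemma dg_nths: "dg \<delta> (nths w I) = (\<Sum>m | m < length w \<and> m \<in> I. \<delta> (w ! m))"
proof -
  have "dg \<delta> (nths w I) = (\<Sum>m\<leftarrow>filter (\<lambda>m. m \<in> I) [0..<length w]. \<delta> (w ! m))"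
    by (simp add: dg_def nths_eq_map_filter comp_def)
  also have "\<dots> = (\<Sum>m\<in>set (filter (\<lambda>m. m \<in> I) [0..<length w]). \<delta> (w ! m))"
    by (rule sum_list_distinct_conv_sum_set) simp
  finally show ?thesis by simp
qed

text \<open>The exponent of the Koszul sign of the unshuffle that moves the positions in I to the front.\<close>

definition cross :: "('l \<Rightarrow> int) \<Rightarrow> 'l list \<Rightarrow> nat set \<Rightarrow> int"
  where "cross \<delta> w I =
    (\<Sum>(u, v)\<in>{(u, v). u \<in> I \<and> v < u \<and> u < length w \<and> v \<notin> I}. \<delta> (w ! u) * \<delta> (w ! v))"

lemma finite_cross: "finite {(u, v). u \<in> I \<and> v < u \<and> u < (n :: nat) \<and> v \<notin> I}"
  by (rule finite_subset[of _ "{..<n} \<times> {..<n}"]) auto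

text \<open>A last letter left at the back crosses nothing; moved to the front block, it crosses the
  whole complement. These are the two signs in \<open>unsh_snoc\<close>.\<close>

lemma cross_snoc:
  assumes "I \<subseteq> {..<length w}"
  shows "cross \<delta> (w @ [x]) I = cross \<delta> w I"
    and "cross \<delta> (w @ [x]) (insert (length w) I) = \<delta> x * dg \<delta> (nths w (- I)) + cross \<delta> w I"
proof -
  let ?n = "length w"
  let ?C = "{(u, v). u \<in> I \<and> v < u \<and> u < ?n \<and> v \<notin> I}"
  have *: "{(u, v). u \<in> I \<and> v < u \<and> u < Suc ?n \<and> v \<notin> I} = ?C"
    "{(u, v). u \<in> insert ?n I \<and> v < u \<and> u < Suc ?n \<and> v \<notin> insert ?n I} = ?C \<union> {?n} \<times> {v. v < ?n \<and> v \<notin> I}"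
    using assms by auto
  have C: "(\<Sum>(u, v)\<in>?C. \<delta> ((w @ [x]) ! u) * \<delta> ((w @ [x]) ! v)) = cross \<delta> w I"
    unfolding cross_def by (rule sum.cong) (auto simp: nth_append)
  then show "cross \<delta> (w @ [x]) I = cross \<delta> w I"
    by (simp add: cross_def[of _ "w @ [x]"] *)
  have "cross \<delta> (w @ [x]) (insert ?n I) = cross \<delta> w I +
      (\<Sum>(u, v)\<in>{?n} \<times> {v. v < ?n \<and> v \<notin> I}. \<delta> ((w @ [x]) ! u) * \<delta> ((w @ [x]) ! v))"
    unfolding cross_def[of _ "w @ [x]"] length_append_singleton * C[symmetric]
    by (rule sum.union_disjoint) (use finite_cross[of I ?n] in auto)
  also have "(\<Sum>(u, v)\<in>{?n} \<times> {v. v < ?n \<and> v \<notin> I}. \<delta> ((w @ [x]) ! u) * \<delta> ((w @ [x]) ! v)) =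
      (\<Sum>v | v < ?n \<and> v \<notin> I. \<delta> ((w @ [x]) ! ?n) * \<delta> ((w @ [x]) ! v))"
    by (simp add: sum.cartesian_product[symmetric])
  also have "\<dots> = \<delta> x * dg \<delta> (nths w (- I))"
    unfolding dg_nths sum_distrib_left by (rule sum.cong) (auto simp: nth_append)
  finally show "cross \<delta> (w @ [x]) (insert ?n I) = \<delta> x * dg \<delta> (nths w (- I)) + cross \<delta> w I"
    by simp
qed

text \<open>The bridge from the recursion to explicit sums: the sets of positions without and with
  the last one give the two terms of \<open>unsh_snoc\<close>.\<close>

lemma unsh_eq_sum_subsets:
  "unsh \<delta> w \<phi> = (\<Sum>I\<in>Pow {..<length w}. sg (cross \<delta> w I) (\<phi> (nths w I) (nths w (- I))))"
proof (induction w arbitrary: \<phi> rule: rev_induct)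
  case Nil
  then show ?case by (simp add: cross_def)
next
  case (snoc x w)
  let ?n = "length w"
  have nths_insert: "nths w (insert ?n I) = nths w I" "nths w (- insert ?n I) = nths w (- I)" for I
    unfolding nths_eq_map_filter by (auto intro!: arg_cong[where f = "map ((!) w)"] filter_cong)
  have "(\<Sum>I\<in>Pow {..<length (w @ [x])}. sg (cross \<delta> (w @ [x]) I) (\<phi> (nths (w @ [x]) I) (nths (w @ [x]) (- I)))) =
    (\<Sum>I\<in>Pow {..<?n}. sg (cross \<delta> (w @ [x]) I) (\<phi> (nths (w @ [x]) I) (nths (w @ [x]) (- I)))) +
    (\<Sum>I\<in>insert ?n ` Pow {..<?n}. sg (cross \<delta> (w @ [x]) I) (\<phi> (nths (w @ [x]) I) (nths (w @ [x]) (- I))))"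
    unfolding length_append_singleton lessThan_Suc Pow_insert
    by (rule sum.union_disjoint) auto
  also have "(\<Sum>I\<in>Pow {..<?n}. sg (cross \<delta> (w @ [x]) I) (\<phi> (nths (w @ [x]) I) (nths (w @ [x]) (- I)))) =
      unsh \<delta> w (\<lambda>A B. \<phi> A (B @ [x]))"
    unfolding snoc by (rule sum.cong) (auto simp: cross_snoc nths_append)
  also have "(\<Sum>I\<in>insert ?n ` Pow {..<?n}. sg (cross \<delta> (w @ [x]) I) (\<phi> (nths (w @ [x]) I) (nths (w @ [x]) (- I)))) =
      unsh \<delta> w (\<lambda>A B. sg (\<delta> x * dg \<delta> B) (\<phi> (A @ [x]) B))"
    unfolding snoc
  proof (subst sum.reindex)
    show "inj_on (insert ?n) (Pow {..<?n})"
      by (rule inj_onI) (subst (asm) insert_ident, auto)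
  qed (rule sum.cong, auto simp: cross_snoc nths_append nths_insert add.commute)
  finally show ?case by (simp add: unsh_snoc)
qed

section \<open>Unshuffle permutations, their front blocks and their Koszul signs\<close>

lemma sorted_list_of_set_strict_mono_on:
  fixes \<sigma> :: "nat \<Rightarrow> nat"
  assumes "strict_mono_on {a..<b} \<sigma>"
  shows "map \<sigma> [a..<b] = sorted_list_of_set (\<sigma> ` {a..<b})"
proof -
  have "sorted_wrt (<) (map \<sigma> [a..<b])"
    unfolding sorted_wrt_map
    by (rule sorted_wrt_mono_rel[OF _ sorted_wrt_upt]) (use assms in \<open>auto simp: strict_mono_on_def\<close>)
  then have "sorted (map \<sigma> [a..<b])" "distinct (map \<sigma> [a..<b])"
    using strict_sorted_iff by blast+
  then have "sorted_list_of_set (set (map \<sigma> [a..<b])) = map \<sigma> [a..<b]"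
    by (rule sorted_list_of_set.idem_if_sorted_distinct)
  then show ?thesis by simp
qed

lemma sorted_list_of_set_filter:
  assumes "I \<subseteq> {..<n}"
  shows "sorted_list_of_set I = filter (\<lambda>m. m \<in> I) [0..<n]"
proof -
  have "sorted_list_of_set (set (filter (\<lambda>m. m \<in> I) [0..<n])) = filter (\<lambda>m. m \<in> I) [0..<n]"
    by (rule sorted_list_of_set.idem_if_sorted_distinct) (auto intro: sorted_wrt_filter)
  also have "set (filter (\<lambda>m. m \<in> I) [0..<n]) = I" using assms by auto
  finally show ?thesis .
qed

lemma unshufflesD:
  assumes "\<sigma> \<in> unshuffles p q" and I: "I = \<sigma> ` {..<p}"
  shows "\<sigma> ` {p..<p + q} = {..<p + q} - I" "I \<subseteq> {..<p + q}" "card I = p"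
    and "map \<sigma> [0..<p] = sorted_list_of_set I"
    and "map \<sigma> [p..<p + q] = sorted_list_of_set ({..<p + q} - I)"
proof -
  have \<sigma>: "\<sigma> permutes {..<p + q}" "strict_mono_on {0..<p} \<sigma>" "strict_mono_on {p..<p + q} \<sigma>"
    using assms(1) by (auto simp: unshuffles_def atLeast0LessThan)
  have inj: "inj \<sigma>" using \<sigma>(1) by (rule permutes_inj)
  have "\<sigma> ` ({..<p + q} - {..<p}) = \<sigma> ` {..<p + q} - \<sigma> ` {..<p}"
    by (rule image_set_diff[OF inj])
  moreover have "{..<p + q} - {..<p} = {p..<p + q}" by auto
  ultimately show *: "\<sigma> ` {p..<p + q} = {..<p + q} - I"
    using permutes_image[OF \<sigma>(1)] I by simp
  show "I \<subseteq> {..<p + q}" using permutes_image[OF \<sigma>(1)] I by auto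
  show "card I = p" unfolding I using inj by (simp add: card_image inj_on_subset)
  show "map \<sigma> [0..<p] = sorted_list_of_set I"
    using sorted_list_of_set_strict_mono_on[OF \<sigma>(2)] I by (simp add: atLeast0LessThan)
  show "map \<sigma> [p..<p + q] = sorted_list_of_set ({..<p + q} - I)"
    using sorted_list_of_set_strict_mono_on[OF \<sigma>(3)] * by simp
qed

text \<open>Both blocks are increasing, so an unshuffle is known once the set I of front positions
  is known; the inverse lists I and then its complement in increasing order.\<close>

lemma bij_betw_unshuffles:
  "bij_betw (\<lambda>\<sigma>. \<sigma> ` {..<p}) (unshuffles p q) {I \<in> Pow {..<p + q}. card I = p}"
  unfolding bij_betw_def
proof (intro conjI inj_onI equalityI subsetI)
  fix \<sigma> \<tau> assume st: "\<sigma> \<in> unshuffles p q" "\<tau> \<in> unshuffles p q" "\<sigma> ` {..<p} = \<tau> ` {..<p}"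
  have "map \<sigma> [0..<p] = map \<tau> [0..<p]" "map \<sigma> [p..<p + q] = map \<tau> [p..<p + q]"
    using unshufflesD(4,5)[OF st(1) refl] unshufflesD(4,5)[OF st(2) refl] st(3) by simp_all
  then have "\<sigma> m = \<tau> m" if "m < p + q" for m
    using that by (cases "m < p") (auto simp: map_eq_conv)
  moreover have "\<sigma> m = m" "\<tau> m = m" if "\<not> m < p + q" for m
    using that st by (auto simp: unshuffles_def permutes_def)
  ultimately show "\<sigma> = \<tau>" by (metis ext)
next
  fix I assume "I \<in> (\<lambda>\<sigma>. \<sigma> ` {..<p}) ` unshuffles p q"
  then show "I \<in> {I \<in> Pow {..<p + q}. card I = p}" using unshufflesD(2,3) by blast
next
  fix I assume "I \<in> {I \<in> Pow {..<p + q}. card I = p}"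
  then have I: "I \<subseteq> {..<p + q}" "card I = p" by auto
  let ?J = "{..<p + q} - I"
  have fin: "finite I" "finite ?J" using I(1) finite_subset by blast+
  have J: "card ?J = q" using I by (simp add: card_Diff_subset fin)
  define k l where "k = sorted_list_of_set I" and "l = sorted_list_of_set ?J"
  have kl: "length k = p" "length l = q" "set k = I" "set l = ?J" "distinct k" "distinct l"
      "sorted_wrt (<) k" "sorted_wrt (<) l"
    using I J fin by (auto simp: k_def l_def)
  define \<sigma> where "\<sigma> = (\<lambda>m. if m < p + q then (k @ l) ! m else m)"
  have set_kl: "set (k @ l) = {..<p + q}" using I kl by auto
  have "distinct (k @ l)" using kl by auto
  have "bij_betw \<sigma> {..<p + q} {..<p + q}"
  proof -
    have "bij_betw ((!) (k @ l)) {..<p + q} {..<p + q}"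
      by (rule bij_betw_nth[OF \<open>distinct (k @ l)\<close>]) (use kl set_kl in auto)
    then show ?thesis by (subst bij_betw_cong[where g = "(!) (k @ l)"]) (auto simp: \<sigma>_def)
  qed
  then have "\<sigma> permutes {..<p + q}"
    by (rule bij_imp_permutes) (simp add: \<sigma>_def)
  moreover have "strict_mono_on {..<p} \<sigma>"
    using kl by (auto simp: strict_mono_on_def \<sigma>_def nth_append sorted_wrt_iff_nth_less)
  moreover have "strict_mono_on {p..<p + q} \<sigma>"
    using kl by (auto simp: strict_mono_on_def \<sigma>_def nth_append sorted_wrt_iff_nth_less)
  moreover have "\<sigma> ` {..<p} = I"
  proof -
    have "\<sigma> ` {..<p} = (!) k ` {..<p}"
      by (rule image_cong) (use kl in \<open>auto simp: \<sigma>_def nth_append\<close>)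
    also have "\<dots> = I" using kl by (metis list.set_map map_nth set_upt atLeast0LessThan)
    finally show ?thesis .
  qed
  ultimately show "I \<in> (\<lambda>\<sigma>. \<sigma> ` {..<p}) ` unshuffles p q"
    unfolding unshuffles_def by blast
qed

lemma pick_unshuffle:
  assumes "\<sigma> \<in> unshuffles p q" and I: "I = \<sigma> ` {..<p}" and w: "length w = p + q"
  shows "pick w \<sigma> 0 p = nths w I" "pick w \<sigma> p (p + q) = nths w (- I)"
proof -
  have pick: "pick w \<sigma> a b = map ((!) w) (map \<sigma> [a..<b])" for a b by (simp add: pick_def)
  show "pick w \<sigma> 0 p = nths w I"
    unfolding pick unshufflesD(4)[OF assms(1) I] nths_eq_map_filter
    using unshufflesD(2)[OF assms(1) I] by (simp add: sorted_list_of_set_filter w)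
  show "pick w \<sigma> p (p + q) = nths w (- I)"
    unfolding pick unshufflesD(5)[OF assms(1) I] nths_eq_map_filter
    by (subst sorted_list_of_set_filter[of _ "p + q"])
      (auto simp: w intro!: arg_cong[where f = "map ((!) w)"] filter_cong)
qed

text \<open>Monotonicity on each block forces an inversion to have its first index in the front
  block and its second in the back block, so \<sigma> carries inversions bijectively to the pairs
  counted by \<open>cross\<close>.\<close>

lemma koszul_unshuffle:
  assumes \<sigma>: "\<sigma> \<in> unshuffles p q" and I: "I = \<sigma> ` {..<p}" and w: "length w = p + q"
  shows "koszul G \<sigma> w = ((-1) powi cross (deg G) w I :: 'k::field)"
proof -
  have perm: "\<sigma> permutes {..<p + q}" and mono: "strict_mono_on {..<p} \<sigma>" "strict_mono_on {p..<p + q} \<sigma>"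
    using \<sigma> by (auto simp: unshuffles_def)
  have inj: "\<sigma> a = \<sigma> b \<longleftrightarrow> a = b" for a b using permutes_inj[OF perm] by (auto dest: injD)
  have ran: "\<sigma> a < p + q \<longleftrightarrow> a < p + q" for a using permutes_in_image[OF perm, of a] by simp
  have prod: "(\<Prod>a\<in>S. (-1) powi f a) = ((-1) powi (\<Sum>a\<in>S. f a) :: 'k)" for f and S :: "(nat \<times> nat) set"
    by (induction S rule: infinite_finite_induct) (simp_all add: power_int_add)
  let ?S = "{(a, b). a < b \<and> b < length w \<and> \<sigma> b < \<sigma> a}"
  let ?T = "{(u, v). u \<in> I \<and> v < u \<and> u < length w \<and> v \<notin> I}"
  have "bij_betw (\<lambda>(a, b). (\<sigma> a, \<sigma> b)) ?S ?T"
    unfolding bij_betw_def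
  proof (intro conjI equalityI subsetI)
    show "inj_on (\<lambda>(a, b). (\<sigma> a, \<sigma> b)) ?S" by (auto simp: inj_on_def inj)
  next
    fix y assume "y \<in> (\<lambda>(a, b). (\<sigma> a, \<sigma> b)) ` ?S"
    then obtain a b where y: "y = (\<sigma> a, \<sigma> b)" and ab: "a < b" "b < p + q" "\<sigma> b < \<sigma> a"
      using w by auto
    have "\<not> b < p" using strict_mono_onD[OF mono(1), of a b] ab by auto
    moreover have "a < p" using strict_mono_onD[OF mono(2), of a b] ab by (cases "a < p") auto
    ultimately show "y \<in> ?T" using ab y ran inj w by (auto simp: I)
  next
    fix y assume "y \<in> ?T"
    then obtain u v where y: "y = (u, v)" "u \<in> I" "v < u" "u < p + q" "v \<notin> I" using w by auto
    then obtain a where a: "a < p" "u = \<sigma> a" by (auto simp: I)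
    obtain b where b: "v = \<sigma> b" using permutes_surj[OF perm] by (metis surjD)
    have "b < p + q" using y b ran[of b] by simp
    moreover have "\<not> b < p" using y b by (auto simp: I)
    ultimately have "(a, b) \<in> ?S" using a b y w by auto
    then show "y \<in> (\<lambda>(a, b). (\<sigma> a, \<sigma> b)) ` ?S" using y a b by force
  qed
  from sum.reindex_bij_betw[OF this, of "\<lambda>(u, v). deg G (w ! u) * deg G (w ! v)"]
  have "(\<Sum>(a, b)\<in>?S. deg G (w ! \<sigma> a) * deg G (w ! \<sigma> b)) = cross (deg G) w I"
    by (simp add: cross_def case_prod_unfold)
  then show ?thesis
    by (simp add: koszul_def case_prod_unfold prod)
qed

context vector_space
begin

lemma sum_unshuffles:
  assumes w: "length w = p + q"
  shows "(\<Sum>\<sigma>\<in>unshuffles p q. scale (koszul G \<sigma> w) (\<phi> (pick w \<sigma> 0 p) (pick w \<sigma> p (p + q)))) =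
    unsh (deg G) w (\<lambda>A B. if length A = p then \<phi> A B else 0)"
proof -
  have len: "length (nths w I) = card I" if "I \<subseteq> {..<length w}" for I
  proof -
    have "{m. m < length w \<and> m \<in> I} = I" using that by auto
    then show ?thesis by (simp add: length_nths)
  qed
  have "(\<Sum>\<sigma>\<in>unshuffles p q. scale (koszul G \<sigma> w) (\<phi> (pick w \<sigma> 0 p) (pick w \<sigma> p (p + q)))) =
      (\<Sum>\<sigma>\<in>unshuffles p q. sg (cross (deg G) w (\<sigma> ` {..<p})) (\<phi> (nths w (\<sigma> ` {..<p})) (nths w (- (\<sigma> ` {..<p})))))"
    by (rule sum.cong) (simp_all add: pick_unshuffle[OF _ refl w] koszul_unshuffle[OF _ refl w] powi_minus_one_scale)
  also have "\<dots> = (\<Sum>I\<in>{I \<in> Pow {..<p + q}. card I = p}. sg (cross (deg G) w I) (\<phi> (nths w I) (nths w (- I))))"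
    by (rule sum.reindex_bij_betw[OF bij_betw_unshuffles])
  also have "\<dots> = unsh (deg G) w (\<lambda>A B. if length A = p then \<phi> A B else 0)"
    unfolding unsh_eq_sum_subsets w by (rule sum.mono_neutral_cong_left) (auto simp: len w)
  finally show ?thesis .
qed

end


section \<open>Multilinearity and graded words\<close>

interpretation free: vector_space "fscale :: 'k::field \<Rightarrow> ('a \<Rightarrow>\<^sub>0 'k) \<Rightarrow> ('a \<Rightarrow>\<^sub>0 'k)"
  by (rule vector_space_fscale)

lemma sg_fscale: "sg n (fscale c t) = fscale c (sg n t)" for c :: "'k::field"
  by (simp add: sg_def free.scale_minus_right)

text \<open>Made for linearity in one letter: the three functions will be the same expression with a
  linear combination, or one of its two vectors, in a fixed slot.\<close>

lemma unsh_comb: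
  fixes a b :: "'k::field" and \<phi> \<psi> :: "'l list \<Rightarrow> 'l list \<Rightarrow> 'c \<Rightarrow>\<^sub>0 'k"
  assumes "\<And>A B. set A \<subseteq> set w \<Longrightarrow> set B \<subseteq> set w \<Longrightarrow> length A + length B = length w \<Longrightarrow>
    \<chi> A B = fscale a (\<phi> A B) + fscale b (\<psi> A B)"
  shows "unsh \<delta> w \<chi> = fscale a (unsh \<delta> w \<phi>) + fscale b (unsh \<delta> w \<psi>)"
proof -
  have "fscale c (unsh \<delta> w \<phi>) = unsh \<delta> w (\<lambda>A B. fscale c (\<phi> A B))" for c :: 'k and \<phi> :: "'l list \<Rightarrow> 'l list \<Rightarrow> 'c \<Rightarrow>\<^sub>0 'k"
    by (rule unsh_additive) (rule free.scale_right_distrib)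
  then show ?thesis
    by (simp flip: unsh_add) (rule unsh_cong', rule assms)
qed

lemma cext_comb:
  fixes a b :: "'k::field" and \<phi> \<psi> :: "'l list \<Rightarrow> 'c \<Rightarrow>\<^sub>0 'k"
  assumes "\<And>A B C. set A \<subseteq> set w \<Longrightarrow> set B \<subseteq> set w \<Longrightarrow> set C \<subseteq> set w \<Longrightarrow> length B = i \<Longrightarrow> B \<noteq> [] \<Longrightarrow>
    \<chi> (A @ f B # C) = fscale a (\<phi> (A @ f B # C)) + fscale b (\<psi> (A @ f B # C))"
  shows "cext \<delta> i p f \<chi> w = fscale a (cext \<delta> i p f \<phi> w) + fscale b (cext \<delta> i p f \<psi> w)"
proof -
  have "fscale c (cext \<delta> i p f \<phi> w) = cext \<delta> i p f (\<lambda>u. fscale c (\<phi> u)) w" for c :: 'k and \<phi> :: "'l list \<Rightarrow> 'c \<Rightarrow>\<^sub>0 'k"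
    by (rule cext_additive) (rule free.scale_right_distrib)
  moreover have "cext \<delta> i p f \<chi> w = cext \<delta> i p f (\<lambda>u. fscale a (\<phi> u) + fscale b (\<psi> u)) w"
  proof (rule cext_cong, rule assms)
    fix A B C assume "mset A + mset B + mset C = mset w"
    then have "set A \<union> set B \<union> set C = set w" by (metis set_mset_mset set_mset_union)
    then show "set A \<subseteq> set w" "set B \<subseteq> set w" "set C \<subseteq> set w" by auto
  qed
  ultimately show ?thesis by (simp add: cext_add)
qed

text \<open>Applied with h = \<open>fst\<close>, which forgets the recorded degrees.\<close>

lemma cext_map:
  assumes "\<And>u. f (map h u) = h (f' u)"
  shows "cext \<delta> i p f \<phi> (map h w) = cext (\<delta> \<circ> h) i p f' (\<lambda>u. \<phi> (map h u)) w"
proof (induction w arbitrary: \<phi> rule: rev_induct)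
  case (snoc x w)
  have "dg (\<delta> \<circ> h) A = dg \<delta> (map h A)" for A by (simp add: dg_def comp_def)
  moreover have "f (map h B @ [h x]) = h (f' (B @ [x]))" for B
    using assms[of "B @ [x]"] by simp
  ultimately show ?case by (simp add: cext_snoc snoc unsh_map comp_def cong: if_cong)
qed simp

lemma cext_deg_cong:
  assumes "\<And>x. x \<in> set w \<Longrightarrow> \<delta> x = \<delta>' x"
  shows "cext \<delta> i p f \<phi> w = cext \<delta>' i p f \<phi> w"
  using assms
proof (induction w arbitrary: \<phi> rule: rev_induct)
  case (snoc x w)
  have "dg \<delta> A = dg \<delta>' A" if "set A \<subseteq> set w" for A
    by (rule dg_cong) (use snoc that in auto)
  moreover have "unsh \<delta> w \<psi> = unsh \<delta>' w \<psi>" for \<psi> :: "'a list \<Rightarrow> 'a list \<Rightarrow> 'b"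
    by (rule unsh_deg_cong) (use snoc in auto)
  ultimately show ?case using snoc
    by (auto simp: cext_snoc intro!: unsh_cong')
qed simp

section \<open>Homogeneous components and multilinear functions of typed words\<close>

context graded_vector_space
begin

lemma G_add: "x \<in> G n \<Longrightarrow> y \<in> G n \<Longrightarrow> x + y \<in> G n"
  using subspace_component subspace_add by blast

lemma G_scale: "x \<in> G n \<Longrightarrow> s c x \<in> G n"
  using subspace_component subspace_scale by blast

lemma G_0: "0 \<in> G n"
  using subspace_component subspace_0 by blast

lemma G_minus: "x \<in> G n \<Longrightarrow> - x \<in> G n"
  using subspace_component subspace_neg by blast

lemma G_sg: "x \<in> G n \<Longrightarrow> sg m x \<in> G n"
  by (simp add: sg_def G_minus)

lemma degree_unique:
  assumes "x \<in> G m" "x \<in> G n" "x \<noteq> 0"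
  shows "m = n"
proof (rule ccontr)
  assume "m \<noteq> n"
  \<comment> \<open>The family with x in degree m and the one with x in degree n both sum to
    x.\<close>
  let ?c = "\<lambda>k (l :: int). if l = k then x else 0"
  have *: "{l. ?c k l \<noteq> 0} = {k}" for k using assms by auto
  define R where "R c \<longleftrightarrow> (\<forall>l. c l \<in> G l) \<and> finite {l. c l \<noteq> 0} \<and> x = (\<Sum>l | c l \<noteq> 0. c l)" for c
  have "R (?c k)" if "x \<in> G k" for k
    unfolding R_def * using that G_0 by simp
  then have "R (?c m)" "R (?c n)" using assms by blast+
  moreover have "\<exists>!c. R c" unfolding R_def by (rule direct_sum)
  ultimately have "?c m = ?c n" by blast
  then show False using \<open>m \<noteq> n\<close> assms(3) by (metis (full_types))
qed

lemma homog_deg: "x \<in> homog G \<Longrightarrow> x \<in> G (deg G x)"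
  unfolding homog_def deg_def by (auto intro: someI)

lemma deg_eq: "x \<in> G n \<Longrightarrow> x \<noteq> 0 \<Longrightarrow> deg G x = n"
  using degree_unique homog_deg unfolding homog_def by blast

definition canon :: "'v list \<Rightarrow> ('v \<times> int) list"
  where "canon xs = map (\<lambda>x. (x, deg G x)) xs"

lemma map_fst_canon [simp]: "map fst (canon xs) = xs"
  by (simp add: canon_def comp_def)

lemma canon_eq_Nil [simp]: "canon xs = [] \<longleftrightarrow> xs = []"
  by (simp add: canon_def)

lemma typed_canon: "set xs \<subseteq> homog G \<Longrightarrow> typed G (canon xs)"
  using homog_deg by (auto simp: typed_def canon_def)

lemma typed_homog: "typed G w \<Longrightarrow> set (map fst w) \<subseteq> homog G"
  by (fastforce simp: typed_def homog_def)

lemma hom_arity_linear: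
  assumes "f \<in> hom_arity s G i p" "length ys + length zs + 1 = i"
  shows "f (ys @ (s a x + s b y) # zs) = s a (f (ys @ x # zs)) + s b (f (ys @ y # zs))"
  using assms by (auto simp: hom_arity_def Vector_Spaces.linear_iff)

lemma hom_arity_degree:
  assumes "f \<in> hom_arity s G i p" "length B = i" "typed G B"
  shows "f (map fst B) \<in> G (dg snd B + p)"
proof -
  have "list_all2 (\<lambda>x a. x \<in> G a) (map fst B) (map snd B)"
    using assms(3) by (auto simp: typed_def list_all2_map1 list_all2_map2 list_all2_same)
  then show ?thesis
    using assms(1,2) by (auto simp: hom_arity_def dg_def)
qed

lemma hom_arity_zero:
  assumes "f \<in> hom_arity s G i p" "0 \<in> set ys"
  shows "f ys = 0"
proof (cases "length ys = i")
  case True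
  obtain us vs where "ys = us @ 0 # vs" using assms(2) by (metis split_list)
  then show ?thesis
    using hom_arity_linear[OF assms(1), of us vs 0 0 0 0] True by simp
qed (use assms in \<open>auto simp: hom_arity_def\<close>)

text \<open>Linearity is asked for only between typed words and for vectors of one degree, which is
  what the relations of TV provide.\<close>

definition multi :: "(('v \<times> int) list \<Rightarrow> ('c \<Rightarrow>\<^sub>0 'k)) \<Rightarrow> bool"
  where "multi \<phi> \<longleftrightarrow> (\<forall>A C n x y a b. typed G A \<longrightarrow> typed G C \<longrightarrow> x \<in> G n \<longrightarrow> y \<in> G n \<longrightarrow>
    \<phi> (A @ (s a x + s b y, n) # C) = fscale a (\<phi> (A @ (x, n) # C)) + fscale b (\<phi> (A @ (y, n) # C)))"

lemma multiD:
  assumes "multi \<phi>" "typed G A" "typed G C" "x \<in> G n" "y \<in> G n"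
  shows "\<phi> (A @ (s a x + s b y, n) # C) = fscale a (\<phi> (A @ (x, n) # C)) + fscale b (\<phi> (A @ (y, n) # C))"
  using assms unfolding multi_def by blast

lemma multi_zero:
  assumes "multi \<phi>" "typed G w" "0 \<in> fst ` set w"
  shows "\<phi> w = 0"
proof -
  obtain A n C where "w = A @ (0, n) # C" using assms(3) by (metis imageE prod.collapse split_list)
  then show ?thesis
    using multiD[OF assms(1), of A C 0 n 0 0 0] assms(2) G_0 by simp
qed

definition bimulti :: "(('v \<times> int) list \<Rightarrow> ('v \<times> int) list \<Rightarrow> ('c \<Rightarrow>\<^sub>0 'k)) \<Rightarrow> bool"
  where "bimulti \<phi> \<longleftrightarrow> (\<forall>B. typed G B \<longrightarrow> multi (\<lambda>A. \<phi> A B)) \<and> (\<forall>A. typed G A \<longrightarrow> multi (\<phi> A))"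

text \<open>The three letters compared carry the same formal degree n, so their signs agree term by
  term even if the linear combination is 0.\<close>

lemma multi_unsh:
  assumes "bimulti \<phi>"
  shows "multi (\<lambda>w. unsh snd w \<phi>)"
  unfolding multi_def
proof (intro allI impI)
  fix A C n x y a b
  assume t: "typed G A" "typed G C" and xy: "x \<in> G n" "y \<in> G n"
  have *: "unsh snd ((z, n) # C) (\<lambda>A' B'. sg (dg snd B * dg snd A') (\<phi> (A @ A') (B @ B'))) =
      unsh snd C (\<lambda>A' B'. sg (dg snd B * (n + dg snd A')) (\<phi> (A @ (z, n) # A') (B @ B'))
       + sg (n * dg snd A' + dg snd B * dg snd A') (\<phi> (A @ A') (B @ (z, n) # B')))" for z A B
    by (simp add: unsh_add)
  show "unsh snd (A @ (s a x + s b y, n) # C) \<phi> =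
      fscale a (unsh snd (A @ (x, n) # C) \<phi>) + fscale b (unsh snd (A @ (y, n) # C) \<phi>)"
    unfolding unsh_append *
  proof (intro unsh_comb)
    fix A1 B1 A2 B2
    assume sets: "set A1 \<subseteq> set A" "set B1 \<subseteq> set A" "set A2 \<subseteq> set C" "set B2 \<subseteq> set C"
    then have ty: "typed G A1" "typed G B1" "typed G A2" "typed G B2"
      using t by (auto intro: typed_subset)
    have "\<phi> (A1 @ (s a x + s b y, n) # A2) (B1 @ B2) =
      fscale a (\<phi> (A1 @ (x, n) # A2) (B1 @ B2)) + fscale b (\<phi> (A1 @ (y, n) # A2) (B1 @ B2))"
      by (rule multiD) (use assms ty xy in \<open>auto simp: bimulti_def\<close>)
    moreover have "\<phi> (A1 @ A2) (B1 @ (s a x + s b y, n) # B2) =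
      fscale a (\<phi> (A1 @ A2) (B1 @ (x, n) # B2)) + fscale b (\<phi> (A1 @ A2) (B1 @ (y, n) # B2))"
      by (rule multiD) (use assms ty xy in \<open>auto simp: bimulti_def\<close>)
    ultimately show "sg (dg snd B1 * (n + dg snd A2)) (\<phi> (A1 @ (s a x + s b y, n) # A2) (B1 @ B2)) +
       sg (n * dg snd A2 + dg snd B1 * dg snd A2) (\<phi> (A1 @ A2) (B1 @ (s a x + s b y, n) # B2)) =
       fscale a (sg (dg snd B1 * (n + dg snd A2)) (\<phi> (A1 @ (x, n) # A2) (B1 @ B2)) +
       sg (n * dg snd A2 + dg snd B1 * dg snd A2) (\<phi> (A1 @ A2) (B1 @ (x, n) # B2))) +
       fscale b (sg (dg snd B1 * (n + dg snd A2)) (\<phi> (A1 @ (y, n) # A2) (B1 @ B2)) +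
       sg (n * dg snd A2 + dg snd B1 * dg snd A2) (\<phi> (A1 @ A2) (B1 @ (y, n) # B2)))"
      by (simp add: sg_add sg_fscale free.scale_right_distrib)
  qed
qed

lemma typed_hat:
  assumes "f \<in> hom_arity s G i p" "length B = i" "typed G B"
  shows "fst (hat p f B) \<in> G (snd (hat p f B))"
  using hom_arity_degree[OF assms] by simp

lemma multi_hat:
  assumes f: "f \<in> hom_arity s G i p" and \<phi>: "multi \<phi>" and "typed G A" "typed G C"
    and "length B1 + length B2 + 1 = i" "typed G B1" "typed G B2" "x \<in> G n" "y \<in> G n"
  shows "\<phi> (A @ hat p f (B1 @ (s a x + s b y, n) # B2) # C) =
    fscale a (\<phi> (A @ hat p f (B1 @ (x, n) # B2) # C)) + fscale b (\<phi> (A @ hat p f (B1 @ (y, n) # B2) # C))"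
proof -
  let ?m = "dg snd B1 + n + dg snd B2 + p"
  have "f (map fst (B1 @ (x, n) # B2)) \<in> G ?m" "f (map fst (B1 @ (y, n) # B2)) \<in> G ?m"
    using hom_arity_degree[OF f, of "B1 @ (x, n) # B2"] hom_arity_degree[OF f, of "B1 @ (y, n) # B2"] assms(5-)
    by (simp_all add: algebra_simps)
  from multiD[OF \<phi> assms(3,4) this, of a b] show ?thesis
    using assms(5) by (simp add: hat_def hom_arity_linear[OF f] algebra_simps)
qed

text \<open>Induction on the letters after the varied slot. If there are none, the slot is either
  untouched by f or its last argument. Otherwise the terms in which f uses the last letter c form a
  bimultilinear function of the split of the other letters.\<close>

lemma multi_cext:
  assumes f: "f \<in> hom_arity s G i p" and "multi \<phi>"
  shows "multi (cext snd i p (hat p f) \<phi>)"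
  unfolding multi_def
proof (intro allI impI)
  fix A C n x y a b
  assume "typed G A" "typed G C" and xy: "x \<in> G n" "y \<in> G n"
  with \<open>multi \<phi>\<close> show "cext snd i p (hat p f) \<phi> (A @ (s a x + s b y, n) # C) =
    fscale a (cext snd i p (hat p f) \<phi> (A @ (x, n) # C)) + fscale b (cext snd i p (hat p f) \<phi> (A @ (y, n) # C))"
  proof (induction C arbitrary: \<phi> rule: rev_induct)
    case Nil
    have "cext snd i p (hat p f) (\<lambda>u. \<phi> (u @ [(s a x + s b y, n)])) A =
      fscale a (cext snd i p (hat p f) (\<lambda>u. \<phi> (u @ [(x, n)])) A) +
      fscale b (cext snd i p (hat p f) (\<lambda>u. \<phi> (u @ [(y, n)])) A)"
    proof (rule cext_comb)
      fix A' B C assume "set A' \<subseteq> set A" "set B \<subseteq> set A" "set C \<subseteq> set A" "length B = i"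
      then have "typed G A'" "typed G C" "fst (hat p f B) \<in> G (snd (hat p f B))"
        using Nil typed_hat[OF f] by (blast intro: typed_subset)+
      then have "typed G (A' @ hat p f B # C)" by simp
      from multiD[OF \<open>multi \<phi>\<close> this, of "[]"]
      show "\<phi> ((A' @ hat p f B # C) @ [(s a x + s b y, n)]) =
        fscale a (\<phi> ((A' @ hat p f B # C) @ [(x, n)])) + fscale b (\<phi> ((A' @ hat p f B # C) @ [(y, n)]))"
        using xy by simp
    qed
    moreover have "unsh snd A (\<lambda>A B. if length B + 1 = i then sg (p * dg snd A) (\<phi> (A @ [hat p f (B @ [(s a x + s b y, n)])])) else 0) =
      fscale a (unsh snd A (\<lambda>A B. if length B + 1 = i then sg (p * dg snd A) (\<phi> (A @ [hat p f (B @ [(x, n)])])) else 0)) +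
      fscale b (unsh snd A (\<lambda>A B. if length B + 1 = i then sg (p * dg snd A) (\<phi> (A @ [hat p f (B @ [(y, n)])])) else 0))"
    proof (rule unsh_comb)
      fix A' B assume "set A' \<subseteq> set A" "set B \<subseteq> set A"
      then have "typed G A'" "typed G B" using Nil by (auto intro: typed_subset)
      then show "(if length B + 1 = i then sg (p * dg snd A') (\<phi> (A' @ [hat p f (B @ [(s a x + s b y, n)])])) else 0) =
        fscale a (if length B + 1 = i then sg (p * dg snd A') (\<phi> (A' @ [hat p f (B @ [(x, n)])])) else 0) +
        fscale b (if length B + 1 = i then sg (p * dg snd A') (\<phi> (A' @ [hat p f (B @ [(y, n)])])) else 0)"
        using multi_hat[OF f \<open>multi \<phi>\<close>, of A' "[]" B "[]"] xy by (simp add: sg_add sg_fscale)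
    qed
    ultimately show ?case
      by (simp add: cext_snoc free.scale_right_distrib)
  next
    case (snoc c C)
    have c: "typed G [c]" "typed G C" using snoc.prems by auto
    let ?g = "\<lambda>A B. if length B + 1 = i then sg (p * dg snd A) (\<phi> (A @ [hat p f (B @ [c])])) else 0"
    have "multi (\<lambda>u. \<phi> (u @ [c]))"
      using multiD[OF \<open>multi \<phi>\<close>] c by (auto simp: multi_def)
    note IH = snoc.IH[OF this \<open>typed G A\<close> c(2) xy]
    have "bimulti ?g"
      unfolding bimulti_def
    proof (intro conjI allI impI)
      fix B assume B: "typed G B"
      show "multi (\<lambda>A. ?g A B)"
        unfolding multi_def
      proof (intro allI impI)
        fix A C n x y a b
        assume A: "typed G A" "typed G C" "x \<in> G n" "y \<in> G n"
        show "?g (A @ (s a x + s b y, n) # C) B = fscale a (?g (A @ (x, n) # C) B) + fscale b (?g (A @ (y, n) # C) B)"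
        proof (cases "length B + 1 = i")
          case True
          then have "typed G (C @ [hat p f (B @ [c])])"
            using typed_hat[OF f, of "B @ [c]"] A B c by simp
          from multiD[OF \<open>multi \<phi>\<close> A(1) this A(3,4)] True show ?thesis
            by (simp add: sg_add sg_fscale)
        qed auto
      qed
    next
      fix A assume A: "typed G A"
      show "multi (?g A)"
        unfolding multi_def
      proof (intro allI impI)
        fix B B' n x y a b
        assume B: "typed G B" "typed G B'" "x \<in> G n" "y \<in> G n"
        show "?g A (B @ (s a x + s b y, n) # B') = fscale a (?g A (B @ (x, n) # B')) + fscale b (?g A (B @ (y, n) # B'))"
          using multi_hat[OF f \<open>multi \<phi>\<close> A, of "[]" B "B' @ [c]" x n y a b] B c
          by (simp add: sg_add sg_fscale)
      qed
    qed
    from multiD[OF multi_unsh[OF this] \<open>typed G A\<close> c(2) xy, of a b] IH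
    show ?case
      by (simp add: cext_snoc free.scale_right_distrib flip: append_Cons append_assoc)
  qed
qed

lemma typed_deg:
  assumes "typed G w" "0 \<notin> fst ` set w" "l \<in> set w"
  shows "(deg G \<circ> fst) l = snd l"
  using assms deg_eq[of "fst l" "snd l"] by (force simp: typed_def)

text \<open>The degree of the vector 0 is ambiguous, but words with an entry 0 do not contribute.\<close>

lemma cext_typed:
  assumes f: "f \<in> hom_arity s G i p" and \<phi>: "multi (\<lambda>u. \<phi> (map fst u))" and w: "typed G w"
  shows "cext (deg G) i p f \<phi> (map fst w) = cext snd i p (hat p f) (\<lambda>u. \<phi> (map fst u)) w"
proof -
  have *: "cext (deg G) i p f \<phi> (map fst w) = cext (deg G \<circ> fst) i p (hat p f) (\<lambda>u. \<phi> (map fst u)) w"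
    by (rule cext_map) simp
  show ?thesis
  proof (cases "0 \<in> fst ` set w")
    case False
    then show ?thesis
      unfolding * by (intro cext_deg_cong typed_deg) (use w in auto)
  next
    case True
    \<comment> \<open>An entry 0 of w either stays in place or is an argument of f, whose value is
      then 0. So every word that occurs has an entry 0, whatever the degree function.\<close>
    have "cext \<delta> i p (hat p f) (\<lambda>u. \<phi> (map fst u)) w = cext \<delta> i p (hat p f) (\<lambda>u. 0) w" for \<delta>
    proof (rule cext_cong)
      fix A B C assume m: "mset A + mset B + mset C = mset w" and B: "length B = i"
      have sets: "set A \<union> set B \<union> set C = set w" using m by (metis set_mset_mset set_mset_union)
      then have "typed G A" "typed G B" "typed G C" using w by (auto intro: typed_subset)
      then have "typed G (A @ hat p f B # C)" using typed_hat[OF f B] by simp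
      moreover have "0 \<in> fst ` set (A @ hat p f B # C)"
        using sets True hom_arity_zero[OF f, of "map fst B"] by (force simp: image_iff)
      ultimately show "\<phi> (map fst (A @ hat p f B # C)) = 0" by (rule multi_zero[OF \<phi>])
    qed
    then show ?thesis unfolding * by simp
  qed
qed

lemma hunsh_typed:
  fixes \<phi> :: "'v list \<Rightarrow> 'v list \<Rightarrow> 'c \<Rightarrow>\<^sub>0 'k"
  assumes \<phi>: "bimulti (\<lambda>A B. \<phi> (map fst A) (map fst B))" and w: "typed G w" "w \<noteq> []"
  shows "hunsh (deg G) (map fst w) \<phi> = hunsh snd w (\<lambda>A B. \<phi> (map fst A) (map fst B))"
proof -
  obtain v x where vx: "w = v @ [x]" using w by (metis append_butlast_last_id)
  have *: "hunsh (deg G) (map fst w) \<phi> = unsh (deg G \<circ> fst) v (\<lambda>A B. \<phi> (map fst A) (map fst (B @ [x])))"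
    by (simp add: vx hunsh_def unsh_map)
  show ?thesis
  proof (cases "0 \<in> fst ` set w")
    case False
    then have "unsh (deg G \<circ> fst) v \<psi> = unsh snd v \<psi>" for \<psi> :: "('v \<times> int) list \<Rightarrow> ('v \<times> int) list \<Rightarrow> 'c \<Rightarrow>\<^sub>0 'k"
      by (intro unsh_deg_cong typed_deg[OF w(1)]) (auto simp: vx)
    then show ?thesis
      unfolding * by (simp add: hunsh_def vx)
  next
    case True
    have "unsh \<delta> v (\<lambda>A B. \<phi> (map fst A) (map fst (B @ [x]))) = unsh \<delta> v (\<lambda>A B. 0)" for \<delta>
    proof (rule unsh_cong)
      fix A B assume "mset A + mset B = mset v"
      then have sets: "set A \<union> set B = set v" by (rule split_mset)
      then have ty: "typed G A" "typed G (B @ [x])" using w vx by (auto intro: typed_subset)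
      have "0 \<in> fst ` set A \<or> 0 \<in> fst ` set (B @ [x])" using True sets vx by auto
      then show "\<phi> (map fst A) (map fst (B @ [x])) = 0"
        using multi_zero[of "\<lambda>A. \<phi> (map fst A) (map fst (B @ [x]))" A]
          multi_zero[of "\<lambda>B. \<phi> (map fst A) (map fst B)" "B @ [x]"] \<phi> ty
        unfolding bimulti_def by blast
    qed
    then show ?thesis unfolding * by (simp add: hunsh_def vx)
  qed
qed

end


section \<open>The quotient by the relations\<close>

lemma unsh_sum: "unsh \<delta> w (\<lambda>A B. \<Sum>k\<in>K. \<phi> k A B) = (\<Sum>k\<in>K. unsh \<delta> w (\<phi> k))"
  by (induction K rule: infinite_finite_induct) (simp_all add: unsh_add)

lemma lookup_ftensor:
  "Poly_Mapping.lookup (ftensor t u) (a, b) = Poly_Mapping.lookup t a * Poly_Mapping.lookup u b"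
proof -
  have "Poly_Mapping.lookup (ftensor t u) (a, b) =
    (\<Sum>a'\<in>Poly_Mapping.keys t. \<Sum>b'\<in>Poly_Mapping.keys u.
      if a' = a then if b' = b then Poly_Mapping.lookup t a * Poly_Mapping.lookup u b else 0 else 0)"
    unfolding ftensor_def lookup_sum lookup_single
    by (intro sum.cong) (auto simp: when_def)
  also have "\<dots> = (\<Sum>a'\<in>Poly_Mapping.keys t. if a' = a then
      \<Sum>b'\<in>Poly_Mapping.keys u. if b' = b then Poly_Mapping.lookup t a * Poly_Mapping.lookup u b else 0 else 0)"
    by (intro sum.cong) auto
  also have "\<dots> = Poly_Mapping.lookup t a * Poly_Mapping.lookup u b"
    by (simp add: in_keys_iff)
  finally show ?thesis .
qed

lemma linear_ftensor:
  "Vector_Spaces.linear fscale fscale (\<lambda>t. ftensor t u)"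
  "Vector_Spaces.linear fscale fscale (ftensor t)"
  by (auto simp: Vector_Spaces.linear_iff free.vector_space_axioms lookup_ftensor lookup_fscale lookup_add algebra_simps
      intro!: poly_mapping_eqI)

lemma ftensor_single: "ftensor (Poly_Mapping.single a 1) (Poly_Mapping.single b 1) = Poly_Mapping.single (a, b) 1"
  by (simp add: ftensor_def)

lemma single_eq_fscale: "Poly_Mapping.single a c = fscale c (Poly_Mapping.single a (1 :: 'k::field))"
  by (rule poly_mapping_eqI) (simp add: lookup_fscale lookup_single when_def)

lemma single_mult_sg: "Poly_Mapping.single a (c * (-1) powi n) = fscale c (sg n (Poly_Mapping.single a (1 :: 'k::field)))"
  by (subst single_eq_fscale) (simp flip: free.powi_minus_one_scale)

text \<open>The target is general because both free vector spaces and V itself are needed.\<close>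

lemma (in vector_space) linear_extension:
  fixes F :: "'c \<Rightarrow> 'b"
  shows "Vector_Spaces.linear fscale scale
    (\<lambda>t. \<Sum>a\<in>Poly_Mapping.keys t. scale (Poly_Mapping.lookup t a) (F a))"
proof -
  let ?L = "\<lambda>t. \<Sum>a\<in>Poly_Mapping.keys t. scale (Poly_Mapping.lookup t a) (F a)"
  have superset: "?L t = (\<Sum>a\<in>A. scale (Poly_Mapping.lookup t a) (F a))"
    if "finite A" "Poly_Mapping.keys t \<subseteq> A" for t A
    by (rule sum.mono_neutral_left) (use that in \<open>auto simp: in_keys_iff\<close>)
  show ?thesis
  proof (subst Vector_Spaces.linear_iff, intro conjI allI vector_space_fscale vector_space_axioms)
    fix t u :: "'c \<Rightarrow>\<^sub>0 'a"
    let ?A = "Poly_Mapping.keys t \<union> Poly_Mapping.keys u"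
    have *: "?L t = (\<Sum>a\<in>?A. scale (Poly_Mapping.lookup t a) (F a))"
      "?L u = (\<Sum>a\<in>?A. scale (Poly_Mapping.lookup u a) (F a))"
      "?L (t + u) = (\<Sum>a\<in>?A. scale (Poly_Mapping.lookup (t + u) a) (F a))"
      by (intro superset; use Poly_Mapping.keys_add[of t u] in auto)+
    show "?L (t + u) = ?L t + ?L u"
      unfolding * by (simp add: lookup_add scale_left_distrib sum.distrib)
  next
    fix c :: 'a and t :: "'c \<Rightarrow>\<^sub>0 'a"
    have "Poly_Mapping.keys (fscale c t) \<subseteq> Poly_Mapping.keys t"
      by (auto simp: in_keys_iff lookup_fscale)
    then have "?L (fscale c t) = (\<Sum>a\<in>Poly_Mapping.keys t. scale (Poly_Mapping.lookup (fscale c t) a) (F a))"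
      by (intro superset) auto
    then show "?L (fscale c t) = scale c (?L t)"
      by (simp add: lookup_fscale scale_sum_right)
  qed
qed

lemma linear_lin_ext: "Vector_Spaces.linear fscale fscale (lin_ext F)"
  unfolding lin_ext_def by (rule free.linear_extension)

lemma lin_ext_single [simp]: "lin_ext F (Poly_Mapping.single a 1) = F a"
  by (simp add: lin_ext_def)

lemma lin_ext_single_eq: "lin_ext (\<lambda>a. Poly_Mapping.single a 1) t = t"
  for t :: "'a \<Rightarrow>\<^sub>0 'k::field"
  by (rule poly_mapping_eqI)
    (simp add: lin_ext_def lookup_sum lookup_fscale lookup_single when_def in_keys_iff if_distrib cong: if_cong)

lemma tensors_eq_span: "tensors G = free.span ((\<lambda>xs. Poly_Mapping.single xs (1 :: 'k::field)) ` words G)"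
proof (intro equalityI subsetI)
  fix t :: "'a list \<Rightarrow>\<^sub>0 'k" assume "t \<in> tensors G"
  then have "lin_ext (\<lambda>a. Poly_Mapping.single a 1) t \<in> free.span ((\<lambda>xs. Poly_Mapping.single xs (1 :: 'k)) ` words G)"
    unfolding lin_ext_def tensors_def
    by (intro free.span_sum free.span_scale free.span_base) auto
  then show "t \<in> free.span ((\<lambda>xs. Poly_Mapping.single xs (1 :: 'k)) ` words G)"
    by (simp add: lin_ext_single_eq)
next
  fix t :: "'a list \<Rightarrow>\<^sub>0 'k"
  assume "t \<in> free.span ((\<lambda>xs. Poly_Mapping.single xs 1) ` words G)"
  then show "t \<in> tensors G"
  proof (induction rule: free.span_induct_alt)
    case base
    then show ?case by (simp add: tensors_def)
  next
    case (step c x y)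
    have "Poly_Mapping.keys (fscale c x) \<subseteq> Poly_Mapping.keys x"
      by (auto simp: in_keys_iff lookup_fscale)
    then show ?case
      using step Poly_Mapping.keys_add[of "fscale c x" y] by (fastforce simp: tensors_def)
  qed
qed

lemma single_in_tensors: "xs \<in> words G \<Longrightarrow> Poly_Mapping.single xs (1 :: 'k::field) \<in> tensors G"
  by (simp add: tensors_def)

interpretation free_pair: vector_space_pair
  "fscale :: 'k::field \<Rightarrow> ('a \<Rightarrow>\<^sub>0 'k) \<Rightarrow> _" "fscale :: 'k \<Rightarrow> ('b \<Rightarrow>\<^sub>0 'k) \<Rightarrow> _"
  by (intro vector_space_pair.intro vector_space_fscale)

text \<open>A basis B of S is extended to a basis of the whole space, and \<pi> kills B and fixes
  the other basis vectors. The image of \<pi> stands in for the quotient by S.\<close>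

lemma exists_linear_kernel:
  fixes S :: "('a \<Rightarrow>\<^sub>0 'k::field) set"
  assumes S: "free.subspace S"
  obtains \<pi> :: "('a \<Rightarrow>\<^sub>0 'k) \<Rightarrow> ('a \<Rightarrow>\<^sub>0 'k)"
  where "Vector_Spaces.linear fscale fscale \<pi>" "\<And>x. \<pi> x = 0 \<longleftrightarrow> x \<in> S"
proof -
  obtain B where B: "B \<subseteq> S" "free.independent B" "S \<subseteq> free.span B"
    by (rule free.basis_exists[of S])
  have spanB: "free.span B = S" using free.span_minimal[OF B(1) S] B(3) by (rule equalityI)
  let ?E = "free.extend_basis B"
  have E: "free.independent ?E" "B \<subseteq> ?E" "free.span ?E = UNIV"
    by (rule free.independent_extend_basis[OF B(2)], rule free.extend_basis_superset[OF B(2)],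
        rule free.span_extend_basis[OF B(2)])
  define \<pi> :: "('a \<Rightarrow>\<^sub>0 'k) \<Rightarrow> ('a \<Rightarrow>\<^sub>0 'k)"
    where "\<pi> = free_pair.construct ?E (\<lambda>b. if b \<in> B then 0 else b)"
  have lin: "Vector_Spaces.linear fscale fscale \<pi>"
    unfolding \<pi>_def by (rule free_pair.linear_construct[OF E(1)])
  have base: "\<pi> b = (if b \<in> B then 0 else b)" if "b \<in> ?E" for b
    unfolding \<pi>_def by (subst free_pair.construct_basis[OF E(1) that]) (rule refl)
  have 0: "\<pi> x = 0" if "x \<in> S" for x
  proof (rule free_pair.linear_eq_0_on_span[OF lin])
    show "x \<in> free.span B" using that spanB by simp
    show "\<pi> b = 0" if "b \<in> B" for b using that base E(2) by (simp add: subset_iff)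
  qed
  have "x \<in> S" if "\<pi> x = 0" for x
  proof -
    have "x \<in> free.span (B \<union> (?E - B))" using E by (simp add: Un_absorb1)
    then obtain y z where yz: "x = y + z" "y \<in> S" "z \<in> free.span (?E - B)"
      unfolding free.span_Un spanB by auto
    \<comment> \<open>\<pi> is the identity on the complement spanned by the added basis
      vectors.\<close>
    have "\<pi> z = z"
      using free_pair.linear_eq_on_span[OF lin free.linear_ident _ yz(3)] base by simp
    then have "z = 0" using yz 0 that free_pair.linear_add[OF lin, of y z] by simp
    then show "x \<in> S" using yz by simp
  qed
  with 0 have "\<pi> x = 0 \<longleftrightarrow> x \<in> S" for x by blast
  with lin show thesis by (rule that)
qed

section \<open>The relations of TV, and the given operators on single words\<close>

context graded_vector_space
begin

lemma subspace_tensor_relations: "free.subspace (tensor_relations s G)"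
  unfolding tensor_relations_def by (rule free.subspace_span)

lemma subspace_tensor2_relations: "free.subspace (tensor2_relations s G)"
  unfolding tensor2_relations_def by (rule free.subspace_span)

text \<open>One half of the universal property of TV. Additivity and scalars are separate generators
  of the relations, and both are needed for a linear combination.\<close>

lemma multi_if_kills_relations:
  fixes L :: "('v list \<Rightarrow>\<^sub>0 'k) \<Rightarrow> ('c \<Rightarrow>\<^sub>0 'k)"
  assumes L: "Vector_Spaces.linear fscale fscale L" and "\<And>r. r \<in> tensor_relations s G \<Longrightarrow> L r = 0"
  shows "multi (\<lambda>u. L (Poly_Mapping.single (map fst u) 1))"
  unfolding multi_def
proof (intro allI impI)
  fix A C n x y a b
  assume t: "typed G A" "typed G C" and xy: "x \<in> G n" "y \<in> G n"
  interpret L: Vector_Spaces.linear fscale fscale L by (rule L)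
  let ?w = "\<lambda>z. Poly_Mapping.single (map fst A @ z # map fst C) (1 :: 'k)"
  have hom: "set (map fst A) \<subseteq> homog G" "set (map fst C) \<subseteq> homog G" "x \<in> homog G" "y \<in> homog G"
    using t xy typed_homog unfolding homog_def by blast+
  have scale: "L (?w (s c z)) = fscale c (L (?w z))" if "z \<in> homog G" for c z
  proof -
    have "?w (s c z) - Poly_Mapping.single (map fst A @ z # map fst C) c \<in> tensor_relations s G"
      unfolding tensor_relations_def by (rule free.span_base) (use hom that in blast)
    from assms(2)[OF this] show ?thesis
      by (simp add: L.diff single_eq_fscale[of _ c] L.scale)
  qed
  have "?w (s a x + s b y) - ?w (s a x) - ?w (s b y) \<in> tensor_relations s G"
    unfolding tensor_relations_def
    by (rule free.span_base) (use hom xy G_scale in blast)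
  from assms(2)[OF this] have "L (?w (s a x + s b y)) = L (?w (s a x)) + L (?w (s b y))"
    by (simp add: L.diff L.add algebra_simps)
  then show "L (Poly_Mapping.single (map fst (A @ (s a x + s b y, n) # C)) 1) =
    fscale a (L (Poly_Mapping.single (map fst (A @ (x, n) # C)) 1)) +
    fscale b (L (Poly_Mapping.single (map fst (A @ (y, n) # C)) 1))"
    using hom scale by simp
qed

text \<open>The other half. The generators are the cases of \<open>multi\<close> with coefficients
  1, 1 and c, 0, after each neighbour is given its canonical degree.\<close>

lemma multi_kills_relations:
  fixes L :: "('v list \<Rightarrow>\<^sub>0 'k) \<Rightarrow> ('c \<Rightarrow>\<^sub>0 'k)"
  assumes L: "Vector_Spaces.linear fscale fscale L" and m: "multi (\<lambda>u. L (Poly_Mapping.single (map fst u) 1))"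
    and "r \<in> tensor_relations s G"
  shows "L r = 0"
proof -
  interpret L: Vector_Spaces.linear fscale fscale L by (rule L)
  have *: "L (Poly_Mapping.single (ys @ (s a x + s b y) # zs) 1) =
      fscale a (L (Poly_Mapping.single (ys @ x # zs) 1)) + fscale b (L (Poly_Mapping.single (ys @ y # zs) 1))"
    if "set ys \<subseteq> homog G" "set zs \<subseteq> homog G" "x \<in> G n" "y \<in> G n" for ys zs x y n a b
    using multiD[OF m typed_canon[OF that(1)] typed_canon[OF that(2)] that(3,4), of a b] by simp
  from assms(3)[unfolded tensor_relations_def] show ?thesis
  proof (rule L.eq_0_on_span[rotated], elim UnE)
    fix r :: "'v list \<Rightarrow>\<^sub>0 'k" assume "r \<in> {Poly_Mapping.single (ys @ (x + x') # zs) 1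
        - Poly_Mapping.single (ys @ x # zs) 1 - Poly_Mapping.single (ys @ x' # zs) 1
      | ys x x' zs n. set ys \<subseteq> homog G \<and> set zs \<subseteq> homog G \<and> x \<in> G n \<and> x' \<in> G n}"
    then obtain ys x x' zs n where r: "r = Poly_Mapping.single (ys @ (x + x') # zs) 1
        - Poly_Mapping.single (ys @ x # zs) 1 - Poly_Mapping.single (ys @ x' # zs) 1"
      and h: "set ys \<subseteq> homog G" "set zs \<subseteq> homog G" "x \<in> G n" "x' \<in> G n" by blast
    from *[OF h, of 1 1] show "L r = 0" by (simp add: r L.diff)
  next
    fix r :: "'v list \<Rightarrow>\<^sub>0 'k" assume "r \<in> {Poly_Mapping.single (ys @ s c x # zs) 1 - Poly_Mapping.single (ys @ x # zs) c
      | ys x c zs. set ys \<subseteq> homog G \<and> set zs \<subseteq> homog G \<and> x \<in> homog G}"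
    then obtain ys x c zs where r: "r = Poly_Mapping.single (ys @ s c x # zs) 1 - Poly_Mapping.single (ys @ x # zs) c"
      and h: "set ys \<subseteq> homog G" "set zs \<subseteq> homog G" "x \<in> homog G" by blast
    from *[OF h(1,2) homog_deg[OF h(3)] G_0, of c 0] show "L r = 0"
      by (simp add: r L.diff single_eq_fscale[of _ c] L.scale)
  qed
qed

text \<open>\<open>pick\<close> reads xs itself, but an unshuffle of m positions never leaves them,
  so reading \<open>take m xs\<close> gives the same blocks.\<close>

lemma sum_unshuffles_pick:
  assumes "m \<le> length xs" "m = a + b"
  shows "(\<Sum>\<sigma>\<in>unshuffles a b. fscale (koszul G \<sigma> (take m xs)) (\<phi> (pick xs \<sigma> 0 a) (pick xs \<sigma> a m))) =
    unsh (deg G) (take m xs) (\<lambda>A B. if length A = a then \<phi> A B else 0)"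
proof -
  have "pick xs \<sigma> c d = pick (take m xs) \<sigma> c d" if "\<sigma> \<in> unshuffles a b" "d \<le> m" for \<sigma> c d
  proof -
    have "\<sigma> permutes {..<m}" using that assms by (simp add: unshuffles_def)
    then have "\<sigma> l < m" if "l < m" for l using that permutes_in_image by fastforce
    then show ?thesis using that by (auto simp: pick_def)
  qed
  then have "(\<Sum>\<sigma>\<in>unshuffles a b. fscale (koszul G \<sigma> (take m xs)) (\<phi> (pick xs \<sigma> 0 a) (pick xs \<sigma> a m))) =
    (\<Sum>\<sigma>\<in>unshuffles a b. fscale (koszul G \<sigma> (take m xs)) (\<phi> (pick (take m xs) \<sigma> 0 a) (pick (take m xs) \<sigma> a (a + b))))"
    using assms by (intro sum.cong) auto
  also have "\<dots> = unsh (deg G) (take m xs) (\<lambda>A B. if length A = a then \<phi> A B else 0)"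
    by (rule free.sum_unshuffles) (use assms in simp)
  finally show ?thesis .
qed

text \<open>The given sum counts the last argument of f from 1, \<open>cext\<close> counts it from
  0, and positions below i - 1 leave too few letters for f. A positive arity keeps i - 1 and k - 1
  from being truncated.\<close>

lemma coder_ext_single:
  assumes "1 \<le> i"
  shows "coder_ext G i p f (Poly_Mapping.single xs (1 :: 'k)) = cext (deg G) i p f (\<lambda>u. Poly_Mapping.single u 1) xs"
proof -
  let ?t = "\<lambda>m. unsh (deg G) (take m xs) (\<lambda>A B.
    if length B + 1 = i then sg (p * dg (deg G) A) (Poly_Mapping.single (A @ f (B @ [xs ! m]) # drop (Suc m) xs) (1 :: 'k)) else 0)"
  have "coder_ext G i p f (Poly_Mapping.single xs (1 :: 'k)) = (\<Sum>k = i..length xs. ?t (k - 1))"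
    unfolding coder_ext_def lin_ext_single
  proof (rule sum.cong)
    fix k assume "k \<in> {i..length xs}"
    then have k: "i \<le> k" "k \<le> length xs" by auto
    let ?\<phi> = "\<lambda>A B. sg (p * dg (deg G) A) (Poly_Mapping.single (A @ [f (B @ [xs ! (k - 1)])] @ drop k xs) (1 :: 'k))"
    have "(\<Sum>\<sigma>\<in>unshuffles (k - i) (i - 1).
        fscale (koszul G \<sigma> (take (k - 1) xs)) (?\<phi> (pick xs \<sigma> 0 (k - i)) (pick xs \<sigma> (k - i) (k - 1)))) =
      unsh (deg G) (take (k - 1) xs) (\<lambda>A B. if length A = k - i then ?\<phi> A B else 0)"
      by (rule sum_unshuffles_pick) (use k assms in auto)
    also have "\<dots> = ?t (k - 1)"
    proof (rule unsh_cong')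
      fix A B :: "'v list" assume "length A + length B = length (take (k - 1) xs)"
      then have "length A = k - i \<longleftrightarrow> length B + 1 = i" using k assms by auto
      then show "(if length A = k - i then ?\<phi> A B else 0) =
        (if length B + 1 = i then sg (p * dg (deg G) A) (Poly_Mapping.single (A @ f (B @ [xs ! (k - 1)]) # drop (Suc (k - 1)) xs) (1 :: 'k)) else 0)"
        using k assms by auto
    qed
    finally show "(\<Sum>\<sigma>\<in>unshuffles (k - i) (i - 1).
      Poly_Mapping.single
        (pick xs \<sigma> 0 (k - i) @ [f (pick xs \<sigma> (k - i) (k - 1) @ [xs ! (k - 1)])] @ drop k xs)
        (koszul G \<sigma> (take (k - 1) xs)
          * (-1) powi (p * (\<Sum>x\<leftarrow>pick xs \<sigma> 0 (k - i). deg G x)))) = ?t (k - 1)"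
      unfolding dg_def[symmetric] single_mult_sg .
  qed simp
  also have "\<dots> = (\<Sum>m\<in>{i - 1..<length xs}. ?t m)"
    by (rule sum.reindex_bij_witness[of _ Suc "\<lambda>k. k - 1"]) (use assms in auto)
  also have "\<dots> = (\<Sum>m<length xs. ?t m)"
  proof (rule sum.mono_neutral_left)
    show "\<forall>m\<in>{..<length xs} - {i - 1..<length xs}. ?t m = 0"
    proof
      fix m assume "m \<in> {..<length xs} - {i - 1..<length xs}"
      then have "?t m = unsh (deg G) (take m xs) (\<lambda>A B. 0)"
        by (intro unsh_cong') auto
      then show "?t m = 0" by simp
    qed
  qed auto
  finally show ?thesis by (simp add: cext_def)
qed

lemma linear_coder_ext: "Vector_Spaces.linear fscale fscale (coder_ext G i p f)"
  unfolding coder_ext_def by (rule linear_lin_ext)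

text \<open>Summing over the front sizes i >= 1 excludes exactly A = []; the right factor is never
  empty, as it holds the last letter.\<close>

lemma comult_single:
  assumes "xs \<noteq> []"
  shows "comult G (Poly_Mapping.single xs (1 :: 'k)) =
    hunsh (deg G) xs (\<lambda>A B. if A = [] then 0 else Poly_Mapping.single (A, B) 1)"
proof -
  obtain w x where xs: "xs = w @ [x]" using assms by (metis append_butlast_last_id)
  let ?n = "length w" and ?\<phi> = "\<lambda>A B. Poly_Mapping.single (A, B @ [x]) (1 :: 'k)"
  have "comult G (Poly_Mapping.single xs (1 :: 'k)) =
      (\<Sum>i = 1..?n. unsh (deg G) w (\<lambda>A B. if length A = i then ?\<phi> A B else 0))"
    unfolding comult_def lin_ext_single Let_def
  proof (rule sum.cong)
    fix i assume i: "i \<in> {1..?n}"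
    have "(\<Sum>\<sigma>\<in>unshuffles i (?n - i). fscale (koszul G \<sigma> (take ?n xs)) (?\<phi> (pick xs \<sigma> 0 i) (pick xs \<sigma> i ?n))) =
      unsh (deg G) (take ?n xs) (\<lambda>A B. if length A = i then ?\<phi> A B else 0)"
      by (rule sum_unshuffles_pick) (use i xs in auto)
    then show "(\<Sum>\<sigma>\<in>unshuffles i (length xs - 1 - i).
      Poly_Mapping.single (pick xs \<sigma> 0 i, pick xs \<sigma> i (length xs - 1) @ [xs ! (length xs - 1)])
        (koszul G \<sigma> (take (length xs - 1) xs))) = unsh (deg G) w (\<lambda>A B. if length A = i then ?\<phi> A B else 0)"
      by (subst single_eq_fscale) (simp add: xs)
  qed (simp add: xs)
  also have "\<dots> = unsh (deg G) w (\<lambda>A B. if A = [] then 0 else ?\<phi> A B)"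
    unfolding unsh_sum[symmetric]
  proof (rule unsh_cong')
    fix A B :: "'v list" assume "length A + length B = ?n"
    then have "(\<Sum>i = 1..?n. if length A = i then ?\<phi> A B else 0) = (if length A \<in> {1..?n} then ?\<phi> A B else 0)"
      by simp
    with \<open>length A + length B = ?n\<close> show "(\<Sum>i = 1..?n. if length A = i then ?\<phi> A B else 0) = (if A = [] then 0 else ?\<phi> A B)"
      by (auto simp: Suc_le_eq)
  qed
  finally show ?thesis by (simp add: hunsh_def xs)
qed

end


section \<open>Extensions are coderivations\<close>

lemma linear_additive: "Vector_Spaces.linear s1 s2 f \<Longrightarrow> f (x + y) = f x + f y"
  by (simp add: Vector_Spaces.linear_iff)

lemma linear_sg: "Vector_Spaces.linear fscale fscale L \<Longrightarrow> L (sg n t) = sg n (L t)"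
  by (simp add: sg_def free_pair.linear_neg)

context graded_vector_space
begin

lemma multi_cong:
  assumes "multi \<phi>" "\<And>u. typed G u \<Longrightarrow> u \<noteq> [] \<Longrightarrow> \<phi> u = \<psi> u"
  shows "multi \<psi>"
  unfolding multi_def
proof (intro allI impI)
  fix A C n x y a b
  assume t: "typed G A" "typed G C" "x \<in> G n" "y \<in> G n"
  then have "\<phi> (A @ (z, n) # C) = \<psi> (A @ (z, n) # C)" if "z \<in> G n" for z
    by (intro assms(2)) (use that in auto)
  then show "\<psi> (A @ (s a x + s b y, n) # C) = fscale a (\<psi> (A @ (x, n) # C)) + fscale b (\<psi> (A @ (y, n) # C))"
    using multiD[OF assms(1) t, of a b] t G_add G_scale by metis
qed

lemma multi_append:
  assumes "multi \<phi>" "typed G v"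
  shows "multi (\<lambda>u. \<phi> (u @ v))"
  using assms by (simp add: multi_def)

lemma multi_hunsh:
  assumes "bimulti \<phi>"
  shows "multi (\<lambda>u. hunsh snd u \<phi>)"
  unfolding multi_def
proof (intro allI impI)
  fix A C n x y a b
  assume t: "typed G A" "typed G C" and xy: "x \<in> G n" "y \<in> G n"
  show "hunsh snd (A @ (s a x + s b y, n) # C) \<phi> =
    fscale a (hunsh snd (A @ (x, n) # C) \<phi>) + fscale b (hunsh snd (A @ (y, n) # C) \<phi>)"
  proof (cases C rule: rev_cases)
    case Nil
    show ?thesis
      unfolding Nil hunsh_def butlast_snoc last_snoc
    proof (rule unsh_comb)
      fix A' B assume "set A' \<subseteq> set A" "set B \<subseteq> set A"
      then have "typed G A'" "typed G B" using t by (auto intro: typed_subset)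
      then show "\<phi> A' (B @ [(s a x + s b y, n)]) =
        fscale a (\<phi> A' (B @ [(x, n)])) + fscale b (\<phi> A' (B @ [(y, n)]))"
        using assms xy by (intro multiD) (auto simp: bimulti_def)
    qed
  next
    case (snoc C' c)
    have "bimulti (\<lambda>A B. \<phi> A (B @ [c]))"
      using assms t snoc multi_append[of _ "[c]"] by (auto simp: bimulti_def)
    from multiD[OF multi_unsh[OF this] t(1) _ xy, of C' a b] show ?thesis
      using t snoc by (simp add: hunsh_def butlast_append)
  qed
qed

lemma multi_cext_deg:
  assumes f: "f \<in> hom_arity s G i p" and \<phi>: "multi (\<lambda>u. \<phi> (map fst u))"
  shows "multi (\<lambda>u. cext (deg G) i p f \<phi> (map fst u))"
  by (rule multi_cong[OF multi_cext[OF f \<phi>]]) (simp add: cext_typed[OF f \<phi>])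

lemma hom_arity_homog:
  assumes f: "f \<in> hom_arity s G i p" and "set B \<subseteq> homog G" "length B = i"
  shows "f B \<in> homog G"
proof -
  have "f (map fst (canon B)) \<in> G (dg snd (canon B) + p)"
    by (rule hom_arity_degree[OF f]) (use assms typed_canon in \<open>auto simp: canon_def\<close>)
  then show ?thesis by (auto simp: homog_def)
qed

lemma term_in_words:
  assumes f: "f \<in> hom_arity s G i p" and "xs \<in> words G"
    and "mset A + mset B + mset C = mset xs" "length B = i"
  shows "A @ f B # C \<in> words G"
proof -
  have "set A \<union> set B \<union> set C = set xs"
    using assms(3) by (metis set_mset_mset set_mset_union)
  then show ?thesis
    using assms(2) hom_arity_homog[OF f _ assms(4)] by (auto simp: words_def)
qed

text \<open>Lets a test functional pass through an extension. Used twice, it turns a composite of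
  operators into nested \<open>cext\<close>, with the operator that acts first outermost.\<close>

lemma coder_ext_apply_single:
  assumes "1 \<le> i" and "Vector_Spaces.linear fscale fscale L"
  shows "L (coder_ext G i p f (Poly_Mapping.single xs (1 :: 'k))) =
    cext (deg G) i p f (\<lambda>u. L (Poly_Mapping.single u 1)) xs"
  unfolding coder_ext_single[OF assms(1)]
  by (rule cext_additive) (rule linear_additive[OF assms(2)])

lemma linear_eq_on_tensors:
  assumes L: "Vector_Spaces.linear fscale fscale L" and M: "Vector_Spaces.linear fscale fscale M"
    and "\<And>xs. xs \<in> words G \<Longrightarrow> L (Poly_Mapping.single xs (1 :: 'k)) = M (Poly_Mapping.single xs 1)"
    and "t \<in> tensors G"
  shows "L t = M t"
  using free_pair.linear_eq_on_span[OF L M _ assms(4)[unfolded tensors_eq_span]] assms(3) by blast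

text \<open>A linear projection whose kernel is the space of relations turns congruences into equations.\<close>

lemma relations_projection:
  obtains \<pi> :: "('v list \<Rightarrow>\<^sub>0 'k) \<Rightarrow> ('v list \<Rightarrow>\<^sub>0 'k)"
  where "Vector_Spaces.linear fscale fscale \<pi>" "\<And>t. \<pi> t = 0 \<longleftrightarrow> t \<in> tensor_relations s G"
    "\<And>t u. tensor_eq s G t u \<longleftrightarrow> \<pi> t = \<pi> u"
    "multi (\<lambda>u. \<pi> (Poly_Mapping.single (map fst u) 1))"
proof -
  obtain \<pi> :: "('v list \<Rightarrow>\<^sub>0 'k) \<Rightarrow> ('v list \<Rightarrow>\<^sub>0 'k)" where \<pi>: "Vector_Spaces.linear fscale fscale \<pi>" "\<And>t. \<pi> t = 0 \<longleftrightarrow> t \<in> tensor_relations s G"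
    using exists_linear_kernel[OF subspace_tensor_relations] by blast
  have eq: "tensor_eq s G t u \<longleftrightarrow> \<pi> t = \<pi> u" for t u
    unfolding tensor_eq_def \<pi>(2)[symmetric] free_pair.linear_diff[OF \<pi>(1)] by simp
  have "multi (\<lambda>u. \<pi> (Poly_Mapping.single (map fst u) 1))"
    by (rule multi_if_kills_relations[OF \<pi>(1)]) (simp add: \<pi>(2))
  with \<pi> eq show thesis by (rule that)
qed

lemma linear_compose: 
  assumes "Vector_Spaces.linear fscale fscale L" "Vector_Spaces.linear fscale fscale M"
  shows "Vector_Spaces.linear fscale fscale (\<lambda>t. L (M t))"
  using assms by (simp add: Vector_Spaces.linear_iff)

lemma coder_ext_tensors:
  assumes f: "f \<in> hom_arity s G i p" and i: "1 \<le> i" and "t \<in> tensors G"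
  shows "coder_ext G i p f (t :: 'v list \<Rightarrow>\<^sub>0 'k) \<in> tensors G"
proof -
  have "free.subspace (tensors G :: ('v list \<Rightarrow>\<^sub>0 'k) set)"
    unfolding tensors_eq_span by (rule free.subspace_span)
  moreover have "coder_ext G i p f (Poly_Mapping.single xs (1 :: 'k)) \<in> tensors G" if "xs \<in> words G" for xs
    unfolding coder_ext_single[OF i]
    \<comment> \<open>With the identity for L, only the closure half of \<open>cext_hom\<close> is
      used.\<close>
    by (rule cext_hom[where L = "\<lambda>x. x", THEN conjunct1])
      (use \<open>free.subspace _\<close> term_in_words[OF f that] in
        \<open>auto simp: free.subspace_0 free.subspace_add free.subspace_neg intro!: single_in_tensors\<close>)
  ultimately show ?thesis
    using assms(3) free_pair.linear_span_image[OF linear_coder_ext[of i p f]]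
      free.span_minimal[of "coder_ext G i p f ` (\<lambda>xs. Poly_Mapping.single xs 1) ` words G" "tensors G"]
    unfolding tensors_eq_span by fast
qed

text \<open>Followed by the projection, the extension is multilinear on words and hence kills the
  relations; the kernel of the projection consists of relations only.\<close>

lemma coder_ext_relations:
  assumes f: "f \<in> hom_arity s G i p" and i: "1 \<le> i" and "r \<in> tensor_relations s G"
  shows "coder_ext G i p f r \<in> tensor_relations s G"
proof -
  obtain \<pi> :: "('v list \<Rightarrow>\<^sub>0 'k) \<Rightarrow> ('v list \<Rightarrow>\<^sub>0 'k)" where \<pi>: "Vector_Spaces.linear fscale fscale \<pi>" "\<And>t. \<pi> t = 0 \<longleftrightarrow> t \<in> tensor_relations s G"
      "multi (\<lambda>u. \<pi> (Poly_Mapping.single (map fst u) 1))"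
    by (rule relations_projection) blast
  have "\<pi> (coder_ext G i p f r) = 0"
  proof (rule multi_kills_relations[OF _ _ assms(3)])
    show "Vector_Spaces.linear fscale fscale (\<lambda>t. \<pi> (coder_ext G i p f t))"
      by (rule linear_compose[OF \<pi>(1) linear_coder_ext])
    show "multi (\<lambda>u. \<pi> (coder_ext G i p f (Poly_Mapping.single (map fst u) 1)))"
      unfolding coder_ext_apply_single[OF i \<pi>(1)] by (rule multi_cext_deg[OF f \<pi>(3)])
  qed
  then show ?thesis by (simp add: \<pi>(2))
qed

text \<open>A word in \<open>tensors_deg\<close> may count an entry 0 in any degree. Its image is
  therefore computed with the degrees ds that come with the word instead of \<open>deg G\<close>; by
  \<open>cext_typed\<close> the two results agree modulo the relations.\<close>

lemma coder_ext_degree: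
  assumes f: "f \<in> hom_arity s G i p" and i: "1 \<le> i" and "t \<in> tensors_deg s G n"
  shows "coder_ext G i p f t \<in> tensors_deg s G (n + p)"
proof -
  let ?S = "\<lambda>n. {Poly_Mapping.single xs (1 :: 'k) | xs ds.
      xs \<noteq> [] \<and> list_all2 (\<lambda>x a. x \<in> G a) xs ds \<and> sum_list ds = n}"
  obtain \<pi> :: "('v list \<Rightarrow>\<^sub>0 'k) \<Rightarrow> ('v list \<Rightarrow>\<^sub>0 'k)" where \<pi>: "Vector_Spaces.linear fscale fscale \<pi>"
      "\<And>t u. tensor_eq s G t u \<longleftrightarrow> \<pi> t = \<pi> u"
      "multi (\<lambda>u. \<pi> (Poly_Mapping.single (map fst u) 1))"
    by (rule relations_projection) blast
  obtain u where u: "tensor_eq s G t u" "u \<in> free.span (?S n)"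
    using assms(3) unfolding tensors_deg_def by blast
  have "tensor_eq s G (coder_ext G i p f t) (coder_ext G i p f u)"
    using coder_ext_relations[OF f i, of "t - u"] u(1)
    unfolding tensor_eq_def by (simp add: free_pair.linear_diff[OF linear_coder_ext])
  moreover from u(2) have "\<exists>v. \<pi> (coder_ext G i p f u) = \<pi> v \<and> v \<in> free.span (?S (n + p))"
  proof (induction rule: free.span_induct_alt)
    case base
    then show ?case
      using free.span_zero by (auto simp: free_pair.linear_0[OF linear_coder_ext])
  next
    case (step c x y)
    from step(1) obtain xs ds where x: "x = Poly_Mapping.single xs 1" "xs \<noteq> []"
      "list_all2 (\<lambda>x a. x \<in> G a) xs ds" "sum_list ds = n" by blast
    define w where "w = zip xs ds"
    have len: "length xs = length ds" using x(3) by (rule list_all2_lengthD)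
    have w: "typed G w" "map fst w = xs" "dg snd w = n"
      using x len by (auto simp: w_def typed_def list_all2_iff dg_def)
    define v where "v = cext snd i p (hat p f) (\<lambda>u. Poly_Mapping.single (map fst u) (1 :: 'k)) w"
    have "\<pi> (coder_ext G i p f x) = cext snd i p (hat p f) (\<lambda>u. \<pi> (Poly_Mapping.single (map fst u) 1)) w"
      unfolding x(1) coder_ext_apply_single[OF i \<pi>(1)] w(2)[symmetric]
      by (rule cext_typed[OF f \<pi>(3) w(1)])
    also have "\<dots> = \<pi> v"
      unfolding v_def by (rule cext_additive[symmetric]) (rule linear_additive[OF \<pi>(1)])
    finally have 1: "\<pi> (coder_ext G i p f x) = \<pi> v" .
    have 2: "v \<in> free.span (?S (n + p))"
      unfolding v_def
    proof (rule cext_hom[where L = "\<lambda>x. x", THEN conjunct1])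
      fix A B C assume m: "mset A + mset B + mset C = mset w" and B: "length B = i"
      have sets: "set A \<union> set B \<union> set C = set w" using m by (metis set_mset_mset set_mset_union)
      then have ty: "typed G A" "typed G B" "typed G C" using w by (auto intro: typed_subset)
      let ?u = "A @ hat p f B # C"
      have "dg snd A + dg snd B + dg snd C = n"
        unfolding w(3)[symmetric] by (simp add: dg_mset flip: m)
      then have "sum_list (map snd ?u) = n + p" by (simp add: dg_def)
      moreover have "list_all2 (\<lambda>x a. x \<in> G a) (map fst ?u) (map snd ?u)"
        using ty typed_hat[OF f B]
          by (fastforce simp: list_all2_map1 list_all2_map2 typed_def intro!: list_all2_appendI list.rel_refl_strong)
      ultimately show "Poly_Mapping.single (map fst ?u) 1 \<in> free.span (?S (n + p))"
        by (intro free.span_base) blast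
    qed (auto intro: free.span_zero free.span_add free.span_neg)
    from step(2) obtain v' where v': "\<pi> (coder_ext G i p f y) = \<pi> v'" "v' \<in> free.span (?S (n + p))" by blast
    have "\<pi> (coder_ext G i p f (fscale c x + y)) = \<pi> (fscale c v + v')"
      by (simp add: free_pair.linear_add[OF linear_coder_ext] free_pair.linear_scale[OF linear_coder_ext]
          free_pair.linear_add[OF \<pi>(1)] free_pair.linear_scale[OF \<pi>(1)] 1 v'(1))
    moreover have "fscale c v + v' \<in> free.span (?S (n + p))"
      using 2 v'(2) by (intro free.span_add free.span_scale)
    ultimately show ?case by blast
  qed
  ultimately show ?thesis
    unfolding tensors_deg_def \<pi>(2) by auto
qed

lemma hunsh_canon:
  "hunsh snd (canon xs) \<phi> = hunsh (deg G) xs (\<lambda>A B. \<phi> (canon A) (canon B))" if "xs \<noteq> []"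
proof -
  obtain w x where xs: "xs = w @ [x]" using \<open>xs \<noteq> []\<close> by (metis append_butlast_last_id)
  show ?thesis
    by (simp add: hunsh_def xs canon_def unsh_map comp_def)
qed

lemma dg_canon [simp]: "dg snd (canon xs) = dg (deg G) xs"
  by (simp add: dg_def canon_def comp_def)

lemma hunsh_cong:
  assumes "w \<noteq> []"
    and "\<And>A B. set A \<subseteq> set w \<Longrightarrow> set B \<subseteq> set w \<Longrightarrow> B \<noteq> [] \<Longrightarrow> \<phi> A B = \<psi> A B"
  shows "hunsh \<delta> w \<phi> = hunsh \<delta> w \<psi>"
  unfolding hunsh_def
proof (rule unsh_cong')
  fix A B assume "set A \<subseteq> set (butlast w)" "set B \<subseteq> set (butlast w)"
  then show "\<phi> A (B @ [last w]) = \<psi> A (B @ [last w])"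
    using assms(1) by (intro assms(2)) (auto dest: in_set_butlastD)
qed

lemma coder_ext_comult:
  assumes f: "f \<in> hom_arity s G i p" and i: "1 \<le> i" and "t \<in> tensors G"
  shows "tensor2_eq s G (comult G (coder_ext G i p f t))
    (tensor_id_right (coder_ext G i p f) (comult G t) + tensor_id_left G p (coder_ext G i p f) (comult G t))"
proof -
  let ?P = "coder_ext G i p f" and ?s = "\<lambda>a. Poly_Mapping.single a (1 :: 'k)"
  obtain \<pi> :: "('v list \<times> 'v list \<Rightarrow>\<^sub>0 'k) \<Rightarrow> ('v list \<times> 'v list \<Rightarrow>\<^sub>0 'k)" where \<pi>: "Vector_Spaces.linear fscale fscale \<pi>" "\<And>t. \<pi> t = 0 \<longleftrightarrow> t \<in> tensor2_relations s G"
    using exists_linear_kernel[OF subspace_tensor2_relations] by blast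
  note add = linear_additive[OF \<pi>(1)]
  \<comment> \<open>Vanishing on empty words serves twice: \<open>hunsh\<close> has terms with an
    empty left factor and \<open>comult\<close> has not, and a relation tensored with a word counts
    as a relation of the tensor square only if the word is nonempty.\<close>
  define \<Phi> where "\<Phi> A B = (if A = [] \<or> B = [] then 0 else \<pi> (?s (A, B)))" for A B
  have bi: "bimulti (\<lambda>A B. \<Phi> (map fst A) (map fst B))"
    unfolding bimulti_def
  proof (intro conjI allI impI)
    fix B :: "('v \<times> int) list" assume B: "typed G B"
    show "multi (\<lambda>A. \<Phi> (map fst A) (map fst B))"
    proof (cases "B = []")
      case False
      then have "map fst B \<in> words G" using typed_homog[OF B] by (simp add: words_def)
      then have B': "?s (map fst B) \<in> tensors G" by (rule single_in_tensors)
      have "multi (\<lambda>u. \<pi> (ftensor (?s (map fst u)) (?s (map fst B))))"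
      proof (rule multi_if_kills_relations)
        show "Vector_Spaces.linear fscale fscale (\<lambda>t. \<pi> (ftensor t (?s (map fst B))))"
          by (rule linear_compose[OF \<pi>(1) linear_ftensor(1)])
        show "\<pi> (ftensor r (?s (map fst B))) = 0" if "r \<in> tensor_relations s G" for r
          unfolding \<pi>(2) tensor2_relations_def by (rule free.span_base) (use that B' in blast)
      qed
      then show ?thesis
        by (rule multi_cong) (use False in \<open>simp add: \<Phi>_def ftensor_single\<close>)
    qed (simp add: \<Phi>_def multi_def)
  next
    fix A :: "('v \<times> int) list" assume A: "typed G A"
    show "multi (\<lambda>B. \<Phi> (map fst A) (map fst B))"
    proof (cases "A = []")
      case False
      then have "map fst A \<in> words G" using typed_homog[OF A] by (simp add: words_def)
      then have A': "?s (map fst A) \<in> tensors G" by (rule single_in_tensors)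
      have "multi (\<lambda>u. \<pi> (ftensor (?s (map fst A)) (?s (map fst u))))"
      proof (rule multi_if_kills_relations)
        show "Vector_Spaces.linear fscale fscale (\<lambda>t. \<pi> (ftensor (?s (map fst A)) t))"
          by (rule linear_compose[OF \<pi>(1) linear_ftensor(2)])
        show "\<pi> (ftensor (?s (map fst A)) r) = 0" if "r \<in> tensor_relations s G" for r
          unfolding \<pi>(2) tensor2_relations_def by (rule free.span_base) (use that A' in blast)
      qed
      then show ?thesis
        by (rule multi_cong) (use False in \<open>simp add: \<Phi>_def ftensor_single\<close>)
    qed (simp add: \<Phi>_def multi_def)
  qed
  have lin: "Vector_Spaces.linear fscale fscale (comult G)" "Vector_Spaces.linear fscale fscale (tensor_id_right ?P)"
    "Vector_Spaces.linear fscale fscale (tensor_id_left G p ?P)"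
    unfolding comult_def tensor_id_right_def tensor_id_left_def by (rule linear_lin_ext)+
  have comult: "L (comult G (?s xs)) = hunsh (deg G) xs (\<lambda>A B. if A = [] then 0 else L (?s (A, B)))"
    if "xs \<noteq> []" and L: "Vector_Spaces.linear fscale fscale L" for xs and L :: "_ \<Rightarrow> ('v list \<times> 'v list \<Rightarrow>\<^sub>0 'k)"
  proof -
    have "L 0 = 0" by (rule free_pair.linear_0[OF L])
    then show ?thesis
      unfolding comult_single[OF that(1)] hunsh_def
      by (subst unsh_additive[of L, OF linear_additive[OF L]]) (auto simp: if_distrib cong: if_cong)
  qed
  have "\<pi> (comult G (?P t)) = \<pi> (tensor_id_right ?P (comult G t) + tensor_id_left G p ?P (comult G t))"
    unfolding add
  proof (rule linear_eq_on_tensors[OF _ _ _ assms(3)])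
    show "Vector_Spaces.linear fscale fscale (\<lambda>t. \<pi> (comult G (?P t)))"
      by (rule linear_compose[OF \<pi>(1) linear_compose[OF lin(1) linear_coder_ext]])
    show "Vector_Spaces.linear fscale fscale
        (\<lambda>t. \<pi> (tensor_id_right ?P (comult G t)) + \<pi> (tensor_id_left G p ?P (comult G t)))"
      by (rule free_pair.linear_compose_add[OF linear_compose[OF \<pi>(1) linear_compose[OF lin(2,1)]]
            linear_compose[OF \<pi>(1) linear_compose[OF lin(3,1)]]])
    fix xs assume xs: "xs \<in> words G"
    then have ne: "xs \<noteq> []" and hom: "set xs \<subseteq> homog G" by (auto simp: words_def)
    let ?F = "cext (deg G) i p f" and ?T = "cext snd i p (hat p f)" and ?\<Phi> = "\<lambda>A B. \<Phi> (map fst A) (map fst B)"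
    have multi: "multi (\<lambda>u. hunsh (deg G) (map fst u) \<Phi>)"
      by (rule multi_cong[OF multi_hunsh[OF bi]]) (simp add: hunsh_typed[OF bi])
    have "\<pi> (comult G (?P (?s xs))) = ?F (\<lambda>u. \<pi> (comult G (?s u))) xs"
      by (rule coder_ext_apply_single[OF i linear_compose[OF \<pi>(1) lin(1)]])
    also have "\<dots> = ?F (\<lambda>u. hunsh (deg G) u \<Phi>) xs"
    proof (rule cext_cong)
      fix A B C
      show "\<pi> (comult G (?s (A @ f B # C))) = hunsh (deg G) (A @ f B # C) \<Phi>"
        by (subst comult[OF _ \<pi>(1)]) (auto simp: \<Phi>_def intro!: hunsh_cong)
    qed
    \<comment> \<open>The coderivation identity is exact for formal degrees, so the calculation
      moves to typed words here and returns to \<open>deg G\<close> in each factor below.\<close>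
    also have "\<dots> = ?T (\<lambda>u. hunsh (deg G) (map fst u) \<Phi>) (canon xs)"
      using cext_typed[OF f multi typed_canon[OF hom]] by simp
    also have "\<dots> = ?T (\<lambda>u. hunsh snd u ?\<Phi>) (canon xs)"
    proof (rule cext_cong)
      fix A B C assume m: "mset A + mset B + mset C = mset (canon xs)" and B: "length B = i"
      have sets: "set A \<union> set B \<union> set C = set (canon xs)" using m by (metis set_mset_mset set_mset_union)
      then have "typed G A" "typed G B" "typed G C"
        using typed_canon[OF hom] by (auto intro: typed_subset)
      then have "typed G (A @ hat p f B # C)" using typed_hat[OF f B] by simp
      then show "hunsh (deg G) (map fst (A @ hat p f B # C)) \<Phi> = hunsh snd (A @ hat p f B # C) ?\<Phi>"
        by (rule hunsh_typed[OF bi]) simp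
    qed
    also have "\<dots> = hunsh snd (canon xs) (\<lambda>A B. ?T (\<lambda>u. ?\<Phi> u B) A) +
        hunsh snd (canon xs) (\<lambda>A B. sg (p * dg snd A) (?T (?\<Phi> A) B))"
      by (rule cext_hunsh[OF shifts_hat]) (simp add: ne)
    also have "hunsh snd (canon xs) (\<lambda>A B. ?T (\<lambda>u. ?\<Phi> u B) A) = \<pi> (tensor_id_right ?P (comult G (?s xs)))"
      unfolding comult[OF ne linear_compose[OF \<pi>(1) lin(2)]] hunsh_canon[OF ne]
    proof (rule hunsh_cong[OF ne])
      fix A B :: "'v list" assume AB: "set A \<subseteq> set xs" "set B \<subseteq> set xs" "B \<noteq> []"
      then have ty: "typed G (canon A)" "typed G (canon B)" using hom by (auto intro: typed_canon)
      have "multi (\<lambda>u. \<Phi> (map fst u) B)" using bi ty(2) unfolding bimulti_def by force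
      then have "?T (\<lambda>u. ?\<Phi> u (canon B)) (canon A) = ?F (\<lambda>u. \<Phi> u B) A"
        using cext_typed[OF f _ ty(1), of "\<lambda>u. \<Phi> u B"] by simp
      also have "\<dots> = ?F (\<lambda>u. \<pi> (ftensor (?s u) (?s B))) A"
        by (rule cext_cong) (simp add: \<Phi>_def ftensor_single AB)
      also have "\<dots> = \<pi> (ftensor (?P (?s A)) (?s B))"
        by (rule coder_ext_apply_single[OF i linear_compose[OF \<pi>(1) linear_ftensor(1)], symmetric])
      also have "\<dots> = (if A = [] then 0 else \<pi> (tensor_id_right ?P (?s (A, B))))"
        using free_pair.linear_0[OF \<pi>(1)]
        by (auto simp: tensor_id_right_def coder_ext_single[OF i] ftensor_def)
      finally show "?T (\<lambda>u. ?\<Phi> u (canon B)) (canon A) = (if A = [] then 0 else \<pi> (tensor_id_right ?P (?s (A, B))))" .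
    qed
    also have "hunsh snd (canon xs) (\<lambda>A B. sg (p * dg snd A) (?T (?\<Phi> A) B)) = \<pi> (tensor_id_left G p ?P (comult G (?s xs)))"
      unfolding comult[OF ne linear_compose[OF \<pi>(1) lin(3)]] hunsh_canon[OF ne]
    proof (rule hunsh_cong[OF ne])
      fix A B :: "'v list" assume AB: "set A \<subseteq> set xs" "set B \<subseteq> set xs" "B \<noteq> []"
      then have ty: "typed G (canon A)" "typed G (canon B)" using hom by (auto intro: typed_canon)
      show "sg (p * dg snd (canon A)) (?T (?\<Phi> (canon A)) (canon B)) =
        (if A = [] then 0 else \<pi> (tensor_id_left G p ?P (?s (A, B))))"
      proof (cases "A = []")
        case True
        then show ?thesis by (simp add: \<Phi>_def)
      next
        case False
        have "multi (\<lambda>u. \<Phi> A (map fst u))" using bi ty(1) unfolding bimulti_def by force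
        then have "?T (?\<Phi> (canon A)) (canon B) = ?F (\<Phi> A) B"
          using cext_typed[OF f _ ty(2), of "\<Phi> A"] by simp
        also have "\<dots> = ?F (\<lambda>u. \<pi> (ftensor (?s A) (?s u))) B"
          by (rule cext_cong) (simp add: \<Phi>_def ftensor_single False)
        also have "\<dots> = \<pi> (ftensor (?s A) (?P (?s B)))"
          by (rule coder_ext_apply_single[OF i linear_compose[OF \<pi>(1) linear_ftensor(2)], symmetric])
        finally show ?thesis
          using False by (simp add: tensor_id_left_def linear_sg[OF \<pi>(1)]
              free.powi_minus_one_scale flip: dg_def)
      qed
    qed
    finally show "\<pi> (comult G (?P (?s xs))) =
      \<pi> (tensor_id_right ?P (comult G (?s xs))) + \<pi> (tensor_id_left G p ?P (comult G (?s xs)))" .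
  qed
  then show ?thesis
    unfolding tensor2_eq_def \<pi>(2)[symmetric] free_pair.linear_diff[OF \<pi>(1)] by simp
qed

lemma coder_ext_in_Coder:
  assumes "f \<in> hom_arity s G i p" "1 \<le> i"
  shows "coder_ext G i p f \<in> Coder s G p"
  unfolding Coder_def
  using linear_coder_ext coder_ext_tensors[OF assms] coder_ext_relations[OF assms]
    coder_ext_degree[OF assms] coder_ext_comult[OF assms] by auto

end


section \<open>The commutator\<close>

lemma (in vector_space) linear_gcomm:
  assumes "Vector_Spaces.linear scale scale A" "Vector_Spaces.linear scale scale B"
  shows "Vector_Spaces.linear scale scale (gcomm scale p q A B)"
  using assms by (simp add: Vector_Spaces.linear_iff gcomm_def powi_minus_one_scale sg_def
      scale_right_diff_distrib scale_right_distrib)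

lemma cext_fun_cong:
  assumes "\<And>u. length u = i \<Longrightarrow> f u = g u"
  shows "cext \<delta> i p f \<phi> w = cext \<delta> i p g \<phi> w"
  unfolding cext_def using assms by (intro sum.cong refl unsh_cong if_cong) simp

context graded_vector_space
begin

lemma cext_cext_typed:
  assumes f: "f \<in> hom_arity s G i p" and g: "g \<in> hom_arity s G j q"
    and \<phi>: "multi (\<lambda>u. \<phi> (map fst u))" and w: "typed G w"
  shows "cext (deg G) j q g (cext (deg G) i p f \<phi>) (map fst w) =
    cext snd j q (hat q g) (cext snd i p (hat p f) (\<lambda>u. \<phi> (map fst u))) w"
  unfolding cext_typed[OF g multi_cext_deg[OF f \<phi>] w]
proof (rule cext_cong)
  fix A B C assume m: "mset A + mset B + mset C = mset w" and B: "length B = j"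
  have sets: "set A \<union> set B \<union> set C = set w" using m by (metis set_mset_mset set_mset_union)
  then have "typed G A" "typed G B" "typed G C"
    using w by (auto intro: typed_subset)
  then have "typed G (A @ hat q g B # C)" using typed_hat[OF g B] by simp
  then show "cext (deg G) i p f \<phi> (map fst (A @ hat q g B # C)) =
      cext snd i p (hat p f) (\<lambda>u. \<phi> (map fst u)) (A @ hat q g B # C)"
    by (rule cext_typed[OF f \<phi>])
qed

text \<open>Corestriction to V: relations between one-letter words hold in V, and words of other
  lengths are sent to 0.\<close>

lemma singleton_projection:
  obtains L where "Vector_Spaces.linear fscale s L" "\<And>r. r \<in> tensor_relations s G \<Longrightarrow> L r = 0"
    "\<And>x. L (Poly_Mapping.single [x] 1) = x"
proof -
  define L where "L t = (\<Sum>a\<in>Poly_Mapping.keys t. s (Poly_Mapping.lookup t a) (if length a = 1 then hd a else 0))" for t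
  have L: "Vector_Spaces.linear fscale s L"
    unfolding L_def by (rule linear_extension)
  interpret L: Vector_Spaces.linear fscale s L by (rule L)
  have single: "L (Poly_Mapping.single (ys @ x # zs) c) = (if ys = [] \<and> zs = [] then s c x else 0)" for ys x zs c
    by (cases ys) (auto simp: L_def)
  have "L r = 0" if "r \<in> tensor_relations s G" for r
    using that unfolding tensor_relations_def
    by (rule L.eq_0_on_span[rotated]) (auto simp: L.diff single)
  moreover have "L (Poly_Mapping.single [x] 1) = x" for x
    using single[of "[]" x "[]" 1] by simp
  ultimately show thesis
    using that[OF L] by simp
qed

text \<open>TV has only words with homogeneous entries, so an equation in TV does not reach other
  lists directly. Their entries are replaced, one after the other, by sums of homogeneous
  components.\<close>

lemma hom_arity_eqI:
  assumes f: "f \<in> hom_arity s G n p" and g: "g \<in> hom_arity s G n p"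
    and eq: "\<And>xs. length xs = n \<Longrightarrow> set xs \<subseteq> homog G \<Longrightarrow> f xs = g xs"
  shows "f = g"
proof
  fix xs
  \<comment> \<open>ys collects the entries already made homogeneous, and zs those still to be
    decomposed.\<close>
  have "f (ys @ zs) = g (ys @ zs)" if "length (ys @ zs) = n" "set ys \<subseteq> homog G" for ys zs
    using that
  proof (induction zs arbitrary: ys)
    case Nil
    then show ?case using eq by simp
  next
    case (Cons z zs)
    have len: "length ys + length zs + 1 = n" using Cons.prems by simp
    interpret F: Vector_Spaces.linear s s "\<lambda>x. f (ys @ x # zs)"
      using f len unfolding hom_arity_def by blast
    interpret G: Vector_Spaces.linear s s "\<lambda>x. g (ys @ x # zs)"
      using g len unfolding hom_arity_def by blast
    obtain c :: "int \<Rightarrow> 'v" where c: "\<forall>m. c m \<in> G m" "z = (\<Sum>m | c m \<noteq> 0. c m)"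
      using direct_sum[of z] by blast
    have "f (ys @ c m # zs) = g (ys @ c m # zs)" for m
      using Cons.IH[of "ys @ [c m]"] Cons.prems c(1) by (auto simp: homog_def)
    moreover have "f (ys @ z # zs) = (\<Sum>m | c m \<noteq> 0. f (ys @ c m # zs))"
      "g (ys @ z # zs) = (\<Sum>m | c m \<noteq> 0. g (ys @ c m # zs))"
      unfolding c(2) by (rule F.sum, rule G.sum)
    ultimately show ?case by simp
  qed
  from this[of "[]" xs] show "f xs = g xs"
    using f g by (cases "length xs = n") (auto simp: hom_arity_def)
qed

text \<open>On words of length n the extension gives the single letter f xs, which the corestriction
  reads off. This is the uniqueness that the description in \<open>hom_bracket\<close>
  requires.\<close>

lemma coder_ext_inj:
  assumes f: "f \<in> hom_arity s G n p" and g: "g \<in> hom_arity s G n p" and n: "1 \<le> n"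
    and eq: "coder_eq s G (coder_ext G n p f :: ('v list \<Rightarrow>\<^sub>0 'k) \<Rightarrow> _) (coder_ext G n p g)"
  shows "f = g"
proof (rule hom_arity_eqI[OF f g])
  fix xs assume xs: "length xs = n" "set xs \<subseteq> homog G"
  obtain L where L: "Vector_Spaces.linear fscale s L" "\<And>r. r \<in> tensor_relations s G \<Longrightarrow> L r = 0"
    "\<And>x. L (Poly_Mapping.single [x] 1) = x"
    using singleton_projection by blast
  interpret L: Vector_Spaces.linear fscale s L by (rule L)
  have ne: "xs \<noteq> []" using n xs by auto
  then have "xs \<in> words G" using xs by (simp add: words_def)
  then have "Poly_Mapping.single xs (1 :: 'k) \<in> tensors G" by (rule single_in_tensors)
  with eq have "tensor_eq s G (coder_ext G n p f (Poly_Mapping.single xs 1)) (coder_ext G n p g (Poly_Mapping.single xs 1))"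
    unfolding coder_eq_def by blast
  then have "Poly_Mapping.single [f xs] 1 - Poly_Mapping.single [g xs] 1 \<in> tensor_relations s G"
    unfolding tensor_eq_def coder_ext_single[OF n] cext_full[OF xs(1) ne] .
  from L(2)[OF this] show "f xs = g xs" by (simp add: L.diff L(3))
qed

end

section \<open>Nested brackets as elements of Hom(TV, V)\<close>

context graded_leibniz_algebra
begin

lemma nest_slot:
  assumes E: "Vector_Spaces.linear s s E"
  shows "nest br E (ys @ (x + y) # zs) = nest br E (ys @ x # zs) + nest br E (ys @ y # zs)"
    and "nest br E (ys @ s c x # zs) = s c (nest br E (ys @ x # zs))"
proof -
  have E': "E (x + y) = E x + E y" "E (s c x) = s c (E x)"
    using E by (simp_all add: Vector_Spaces.linear_iff)
  have step: "nest br E (ys @ u # zs @ [z]) = br (nest br E (ys @ u # zs)) z" for u z zs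
    using nest_snoc[of "ys @ u # zs" br E z] by simp
  have base: "nest br E (ys @ [u]) = (if ys = [] then E u else br (nest br E ys) u)" for u
    by simp
  show "nest br E (ys @ (x + y) # zs) = nest br E (ys @ x # zs) + nest br E (ys @ y # zs)"
    by (induction zs rule: rev_induct) (simp_all only: base step, simp_all add: E' br_add)
  show "nest br E (ys @ s c x # zs) = s c (nest br E (ys @ x # zs))"
    by (induction zs rule: rev_induct) (simp_all only: base step, simp_all add: E' br_scale)
qed

lemma N_op_eq_nest: "1 \<le> i \<Longrightarrow> length xs = i \<Longrightarrow> N_op br i E xs = nest br E xs"
  by (simp add: N_op_def nest_def)

lemma N_op_hom_arity:
  assumes E: "Vector_Spaces.linear s s E" and deg: "\<And>n x. x \<in> G n \<Longrightarrow> E x \<in> G (n + e)" and i: "1 \<le> i"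
  shows "N_op br i E \<in> hom_arity s G i e"
  unfolding hom_arity_def
proof (intro CollectI conjI allI impI)
  fix ys zs :: "'v list" assume "length ys + length zs + 1 = i"
  then have "N_op br i E (ys @ x # zs) = nest br E (ys @ x # zs)" for x
    by (intro N_op_eq_nest i) simp
  then show "Vector_Spaces.linear s s (\<lambda>x. N_op br i E (ys @ x # zs))"
    by (simp add: Vector_Spaces.linear_iff vector_space_axioms nest_slot[OF E])
next
  fix xs :: "'v list" assume "length xs \<noteq> i"
  then show "N_op br i E xs = 0" by (simp add: N_op_def)
next
  fix xs ds assume xs: "length xs = i" "list_all2 (\<lambda>x a. x \<in> G a) xs ds"
  have len: "length xs = length ds" using xs(2) by (rule list_all2_lengthD)
  have "nest br E (map fst (zip xs ds)) \<in> G (dg snd (zip xs ds) + e)"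
    by (rule nest_degree[OF deg]) (use xs i len in \<open>auto simp: typed_def list_all2_iff\<close>)
  then show "N_op br i E xs \<in> G (sum_list ds + e)"
    using len by (simp add: N_op_eq_nest[OF i xs(1)] dg_def)
qed

text \<open>\<phi> is additive in its last slot only within one component, so the value of the
  composite has to be located there while \<phi> is moved into the sum; \<open>cext_hom\<close> with
  S that component does both. The sum obtained is the nested term of
  \<open>cext_commutator_snoc\<close>.\<close>

lemma cext_nest_last:
  assumes E: "\<And>n x. x \<in> G n \<Longrightarrow> E x \<in> G (n + e)" and E': "\<And>n x. x \<in> G n \<Longrightarrow> E' x \<in> G (n + e')"
    and \<phi>: "multi \<phi>" and A: "typed G A" and z: "typed G z"
    and len: "length z = i + j - 1" "1 \<le> i" "1 \<le> j"
  shows "nest_comp br E e E' j z \<in> G (dg snd z + e + e') \<and>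
    \<phi> (A @ [(nest_comp br E e E' j z, dg snd z + e + e')]) =
    cext snd j e (hat e (nest br E)) (\<lambda>u. if length u = i then \<phi> (A @ [hat e' (nest br E') u]) else 0) z"
proof -
  let ?N = "dg snd z + e + e'"
  define L where "L y = \<phi> (A @ [(y, ?N)])" for y
  have L: "L (s a x + s b y) = fscale a (L x) + fscale b (L y)" if "x \<in> G ?N" "y \<in> G ?N" for a b x y
    unfolding L_def using multiD[OF \<phi> A _ that, of "[]"] by simp
  have "nest_comp br E e E' j z \<in> G ?N \<and>
    L (nest_comp br E e E' j z) = cext snd j e (hat e (nest br E)) (\<lambda>u. L (nest br E' (map fst u))) z"
    unfolding nest_comp_def
  proof (rule cext_hom)
    fix P B C assume m: "mset P + mset B + mset C = mset z" and B: "length B = j" "B \<noteq> []"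
    have "set P \<union> set B \<union> set C = set z" using m by (metis set_mset_mset set_mset_union)
    then have ty: "typed G P" "typed G B" "typed G C" using z by (auto intro: typed_subset)
    have "nest br E (map fst B) \<in> G (dg snd B + e)" by (rule nest_degree[OF E ty(2) B(2)])
    with ty have "typed G (P @ hat e (nest br E) B # C)" by simp
    from nest_degree[OF E' this]
    have "nest br E' (map fst (P @ hat e (nest br E) B # C)) \<in> G (dg snd (P @ hat e (nest br E) B # C) + e')"
      by simp
    moreover have "dg snd P + dg snd B + dg snd C = dg snd z"
      by (simp add: dg_mset flip: m)
    ultimately show "nest br E' (map fst (P @ hat e (nest br E) B # C)) \<in> G ?N"
      by (simp add: algebra_simps)
  next
    show "L (x + y) = L x + L y" if "x \<in> G ?N" "y \<in> G ?N" for x y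
      using L[OF that, of 1 1] by simp
    show "L (- x) = - L x" if "x \<in> G ?N" for x
      using L[OF that that, of "-1" 0] by (simp add: free.scale_minus_left)
  qed (auto intro: G_0 G_add G_minus)
  \<comment> \<open>Every word u that occurs has length i and degree \<open>dg snd z + e\<close>, so
    the degree fixed in L is the one \<open>hat\<close> assigns.\<close>
  moreover have "cext snd j e (hat e (nest br E)) (\<lambda>u. L (nest br E' (map fst u))) z =
    cext snd j e (hat e (nest br E)) (\<lambda>u. if length u = i then \<phi> (A @ [hat e' (nest br E') u]) else 0) z"
    by (rule cext_cong'[OF shifts_hat]) (use len in \<open>auto simp: L_def hat_def\<close>)
  ultimately show ?thesis by (simp add: L_def)
qed

end

section \<open>The bracket of N_i D and N_j D'\<close>

context leibniz_derivations
begin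

lemma gcomm_linear: "Vector_Spaces.linear s s (gcomm s p q D D')"
  using derivation_D derivation_D' by (simp add: derivation_def linear_gcomm)

lemma gcomm_degree: "x \<in> G m \<Longrightarrow> gcomm s p q D D' x \<in> G (m + (p + q))"
proof -
  assume x: "x \<in> G m"
  have "D (D' x) \<in> G (m + q + p)" "D' (D x) \<in> G (m + p + q)"
    using x D_degree by blast+
  then have "D (D' x) \<in> G (m + (p + q))" "- sg (p * q) (D' (D x)) \<in> G (m + (p + q))"
    by (auto simp: algebra_simps intro: G_sg G_minus)
  from G_add[OF this] show ?thesis by (simp add: gcomm_def powi_minus_one_scale)
qed

text \<open>After the cancellation in \<open>cext_commutator_snoc\<close>, the terms that leave x
  alone are the induction hypothesis for \<phi> with x appended, and the nested terms on a block
  ending in x are evaluated by \<open>nest_comp_commutator\<close>. Together they are the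
  last-letter recursion for N [D, D'].\<close>

lemma cext_commutator:
  assumes "multi \<phi>" "typed G w" and ij: "1 \<le> i" "1 \<le> j"
  shows "cext snd j q (hat q (nest br D')) (cext snd i p (hat p (nest br D)) \<phi>) w
      - sg (p * q) (cext snd i p (hat p (nest br D)) (cext snd j q (hat q (nest br D')) \<phi>) w) =
    cext snd (i + j - 1) (p + q) (hat (p + q) (nest br (gcomm s p q D D'))) \<phi> w"
  using assms(1,2)
proof (induction w arbitrary: \<phi> rule: rev_induct)
  case Nil
  then show ?case by simp
next
  case (snoc x w)
  let ?h = "gcomm s p q D D'"
  have x: "typed G [x]" "typed G w" using snoc.prems by auto
  have key: "cext snd j q (hat q (nest br D')) (\<lambda>u. if length u = i then \<phi> (A @ [hat p (nest br D) u]) else 0) z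
      - sg (p * q) (cext snd i p (hat p (nest br D)) (\<lambda>u. if length u = j then \<phi> (A @ [hat q (nest br D') u]) else 0) z) =
    (if length z = i + j - 1 then \<phi> (A @ [hat (p + q) (nest br ?h) z]) else 0)"
    if A: "typed G A" and z: "typed G z" for A z
  proof (cases "length z = i + j - 1")
    case True
    let ?N = "dg snd z + (p + q)"
    define L where "L y = \<phi> (A @ [(y, ?N)])" for y
    have 1: "P j z \<in> G ?N" "L (P j z) =
      cext snd j q (hat q (nest br D')) (\<lambda>u. if length u = i then \<phi> (A @ [hat p (nest br D) u]) else 0) z"
      using cext_nest_last[OF D_degree(2) D_degree(1) snoc.prems(1) A z True ij]
      by (simp_all add: L_def algebra_simps)
    have len: "length z = j + i - 1" using True by simp
    have 2: "Q i z \<in> G ?N" "L (Q i z) =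
      cext snd i p (hat p (nest br D)) (\<lambda>u. if length u = j then \<phi> (A @ [hat q (nest br D') u]) else 0) z"
      using cext_nest_last[OF D_degree(1) D_degree(2) snoc.prems(1) A z len ij(2,1)]
      by (simp_all add: L_def algebra_simps)
    have lin: "L (s a x + s b y) = fscale a (L x) + fscale b (L y)" if "x \<in> G ?N" "y \<in> G ?N" for a b x y
      unfolding L_def using multiD[OF snoc.prems(1) A _ that, of "[]"] by simp
    have "n ?h z = s 1 (P j z) + s (- ((-1) powi (p * q))) (Q i z)"
      using nest_comp_commutator[OF z True ij] by (simp add: powi_minus_one_scale scale_minus_left)
    then have "L (n ?h z) = L (P j z) - sg (p * q) (L (Q i z))"
      using lin[OF 1(1) 2(1), of 1 "- ((-1) powi (p * q))"]
      by (simp add: free.scale_minus_left free.powi_minus_one_scale)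
    moreover have "L (n ?h z) = \<phi> (A @ [hat (p + q) (nest br ?h) z])"
      by (simp add: hat_def L_def)
    ultimately show ?thesis
      using True unfolding 1(2) 2(2) by simp
  next
    \<comment> \<open>On a block of another length, the inner map never leaves a word of the length
      that the outer map takes.\<close>
    case False
    have "cext snd j q (hat q (nest br D')) (\<lambda>u. if length u = i then \<phi> (A @ [hat p (nest br D) u]) else 0) z =
      cext snd j q (hat q (nest br D')) (\<lambda>u. 0) z"
      by (rule cext_cong'[OF shifts_hat]) (use False in auto)
    moreover have "cext snd i p (hat p (nest br D)) (\<lambda>u. if length u = j then \<phi> (A @ [hat q (nest br D') u]) else 0) z =
      cext snd i p (hat p (nest br D)) (\<lambda>u. 0) z"
      by (rule cext_cong'[OF shifts_hat]) (use False in auto)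
    ultimately show ?thesis using False by simp
  qed
  have last: "unsh snd w (\<lambda>A B. sg ((p + q) * dg snd A)
      (cext snd j q (hat q (nest br D')) (\<lambda>u. if length u = i then \<phi> (A @ [hat p (nest br D) u]) else 0) (B @ [x])
      - sg (p * q) (cext snd i p (hat p (nest br D)) (\<lambda>u. if length u = j then \<phi> (A @ [hat q (nest br D') u]) else 0) (B @ [x])))) =
    unsh snd w (\<lambda>A B. if length B + 1 = i + j - 1
      then sg ((p + q) * dg snd A) (\<phi> (A @ [hat (p + q) (nest br ?h) (B @ [x])])) else 0)"
  proof (rule unsh_cong')
    fix A B assume "set A \<subseteq> set w" "set B \<subseteq> set w"
    then have "typed G A" "typed G (B @ [x])" using x by (auto intro: typed_subset)
    from key[OF this]
    show "sg ((p + q) * dg snd A)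
      (cext snd j q (hat q (nest br D')) (\<lambda>u. if length u = i then \<phi> (A @ [hat p (nest br D) u]) else 0) (B @ [x])
      - sg (p * q) (cext snd i p (hat p (nest br D)) (\<lambda>u. if length u = j then \<phi> (A @ [hat q (nest br D') u]) else 0) (B @ [x]))) =
      (if length B + 1 = i + j - 1
      then sg ((p + q) * dg snd A) (\<phi> (A @ [hat (p + q) (nest br ?h) (B @ [x])])) else 0)"
      by simp
  qed
  show ?case
    unfolding cext_commutator_snoc[OF shifts_hat shifts_hat] last
      snoc.IH[OF multi_append[OF snoc.prems(1) x(1)] x(2)]
    by (rule cext_snoc[symmetric])
qed

lemma N_op_arity:
  assumes "1 \<le> i"
  shows "N_op br i D \<in> hom_arity s G i p" "N_op br i D' \<in> hom_arity s G i q"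
    "N_op br i (gcomm s p q D D') \<in> hom_arity s G i (p + q)"
  using derivation_D derivation_D' D_degree gcomm_degree gcomm_linear assms
  by (auto intro!: N_op_hom_arity simp: derivation_def)

lemma coder_eq_N_op:
  assumes ij: "1 \<le> i" "1 \<le> j"
  shows "coder_eq s G (coder_ext G (i + j - 1) (p + q) (N_op br (i + j - 1) (gcomm s p q D D')))
    (gcomm fscale p q (coder_ext G i p (N_op br i D)) (coder_ext G j q (N_op br j D')))"
proof -
  let ?h = "gcomm s p q D D'" and ?n = "i + j - 1"
  let ?F = "coder_ext G i p (N_op br i D) :: ('v list \<Rightarrow>\<^sub>0 'k) \<Rightarrow> ('v list \<Rightarrow>\<^sub>0 'k)"
  let ?G = "coder_ext G j q (N_op br j D') :: ('v list \<Rightarrow>\<^sub>0 'k) \<Rightarrow> ('v list \<Rightarrow>\<^sub>0 'k)"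
  let ?H = "coder_ext G ?n (p + q) (N_op br ?n ?h) :: ('v list \<Rightarrow>\<^sub>0 'k) \<Rightarrow> ('v list \<Rightarrow>\<^sub>0 'k)"
  let ?s = "\<lambda>u. Poly_Mapping.single u (1 :: 'k)"
  have n: "1 \<le> ?n" using ij by simp
  obtain \<pi> :: "('v list \<Rightarrow>\<^sub>0 'k) \<Rightarrow> ('v list \<Rightarrow>\<^sub>0 'k)" where \<pi>: "Vector_Spaces.linear fscale fscale \<pi>"
      "\<And>t u. tensor_eq s G t u \<longleftrightarrow> \<pi> t = \<pi> u"
      "multi (\<lambda>u. \<pi> (Poly_Mapping.single (map fst u) 1))"
    by (rule relations_projection) blast
  note f = N_op_arity(1)[OF ij(1)] and g = N_op_arity(2)[OF ij(2)] and h = N_op_arity(3)[OF n]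
  have linG: "Vector_Spaces.linear fscale fscale (gcomm fscale p q ?F ?G)"
    by (rule free.linear_gcomm[OF linear_coder_ext linear_coder_ext])
  have "\<pi> (?H t) = \<pi> (gcomm fscale p q ?F ?G t)" if "t \<in> tensors G" for t
  proof (rule linear_eq_on_tensors[OF linear_compose[OF \<pi>(1) linear_coder_ext] linear_compose[OF \<pi>(1) linG] _ that])
    fix xs assume "xs \<in> words G"
    then have "set xs \<subseteq> homog G" by (simp add: words_def)
    define w where "w = canon xs"
    have w: "typed G w" "map fst w = xs"
      unfolding w_def using \<open>set xs \<subseteq> homog G\<close> by (auto intro: typed_canon)
    let ?\<phi> = "\<lambda>u. \<pi> (?s (map fst u))"
    \<comment> \<open>\<open>cext\<close> feeds its map only blocks of length k, where the arity
      test of \<open>N_op\<close> is met.\<close>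
    have hat: "cext snd k r (hat r (N_op br k E)) \<phi> w = cext snd k r (hat r (nest br E)) \<phi> w"
      if "1 \<le> k" for k r E w and \<phi> :: "('v \<times> int) list \<Rightarrow> ('v list \<Rightarrow>\<^sub>0 'k)"
      by (rule cext_fun_cong) (simp add: hat_def N_op_eq_nest[OF that])
    have "\<pi> (?F (?G (?s xs))) = cext (deg G) j q (N_op br j D') (cext (deg G) i p (N_op br i D) (\<lambda>u. \<pi> (?s u))) (map fst w)"
      unfolding coder_ext_apply_single[OF ij(2) linear_compose[OF \<pi>(1) linear_coder_ext]]
        coder_ext_apply_single[OF ij(1) \<pi>(1)] w(2) ..
    also have "\<dots> = cext snd j q (hat q (nest br D')) (cext snd i p (hat p (nest br D)) ?\<phi>) w"
      unfolding cext_cext_typed[OF f g \<pi>(3) w(1)] hat[OF ij(1)] hat[OF ij(2)] ..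
    finally have 1: "\<pi> (?F (?G (?s xs))) = \<dots>" .
    have "\<pi> (?G (?F (?s xs))) = cext (deg G) i p (N_op br i D) (cext (deg G) j q (N_op br j D') (\<lambda>u. \<pi> (?s u))) (map fst w)"
      unfolding coder_ext_apply_single[OF ij(1) linear_compose[OF \<pi>(1) linear_coder_ext]]
        coder_ext_apply_single[OF ij(2) \<pi>(1)] w(2) ..
    also have "\<dots> = cext snd i p (hat p (nest br D)) (cext snd j q (hat q (nest br D')) ?\<phi>) w"
      unfolding cext_cext_typed[OF g f \<pi>(3) w(1)] hat[OF ij(1)] hat[OF ij(2)] ..
    finally have 2: "\<pi> (?G (?F (?s xs))) = \<dots>" .
    have "\<pi> (?H (?s xs)) = cext (deg G) ?n (p + q) (N_op br ?n ?h) (\<lambda>u. \<pi> (?s u)) (map fst w)"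
      unfolding coder_ext_apply_single[OF n \<pi>(1)] w(2) ..
    also have "\<dots> = cext snd ?n (p + q) (hat (p + q) (nest br ?h)) ?\<phi> w"
      unfolding cext_typed[OF h \<pi>(3) w(1)] hat[OF n] ..
    also have "\<dots> = \<pi> (?F (?G (?s xs))) - sg (p * q) (\<pi> (?G (?F (?s xs))))"
      unfolding 1 2 by (rule cext_commutator[OF \<pi>(3) w(1) ij, symmetric])
    also have "\<dots> = \<pi> (gcomm fscale p q ?F ?G (?s xs))"
      by (simp add: gcomm_def free_pair.linear_diff[OF \<pi>(1)] linear_sg[OF \<pi>(1)] free.powi_minus_one_scale)
    finally show "\<pi> (?H (?s xs)) = \<pi> (gcomm fscale p q ?F ?G (?s xs))" .
  qed
  then show ?thesis by (simp add: coder_eq_def \<pi>(2))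
qed

lemma hom_bracket_N_op:
  assumes ij: "1 \<le> i" "1 \<le> j"
  shows "hom_bracket s G i p (N_op br i D) j q (N_op br j D') = N_op br (i + j - 1) (gcomm s p q D D')"
  unfolding hom_bracket_def
proof (rule the_equality, intro conjI)
  have n: "1 \<le> i + j - 1" using ij by simp
  let ?N = "N_op br (i + j - 1) (gcomm s p q D D')"
  show N: "?N \<in> hom_arity s G (i + j - 1) (p + q)"
    by (rule N_op_arity(3)[OF n])
  show eq: "coder_eq s G (coder_ext G (i + j - 1) (p + q) ?N)
    (gcomm fscale p q (coder_ext G i p (N_op br i D)) (coder_ext G j q (N_op br j D')))"
    by (rule coder_eq_N_op[OF ij])
  fix h assume h: "h \<in> hom_arity s G (i + j - 1) (p + q) \<and>
    coder_eq s G (coder_ext G (i + j - 1) (p + q) h)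
      (gcomm fscale p q (coder_ext G i p (N_op br i D)) (coder_ext G j q (N_op br j D')))"
  \<comment> \<open>The projection turns the two congruences with the same commutator into
    equations, which can be chained.\<close>
  obtain \<pi> :: "('v list \<Rightarrow>\<^sub>0 'k) \<Rightarrow> ('v list \<Rightarrow>\<^sub>0 'k)"
    where "\<And>t u. tensor_eq s G t u \<longleftrightarrow> \<pi> t = \<pi> u"
    by (rule relations_projection) blast
  with h eq have "coder_eq s G (coder_ext G (i + j - 1) (p + q) h :: ('v list \<Rightarrow>\<^sub>0 'k) \<Rightarrow> _)
      (coder_ext G (i + j - 1) (p + q) ?N)"
    by (simp add: coder_eq_def)
  then show "h = ?N" using coder_ext_inj[OF _ N n] h by blast
qed

end

theorem lemma4p2:
  fixes s :: "'k::field_char_0 \<Rightarrow> 'v::ab_group_add \<Rightarrow> 'v"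
    and G :: "int \<Rightarrow> 'v set"
    and br :: "'v \<Rightarrow> 'v \<Rightarrow> 'v"
    and D D' :: "'v \<Rightarrow> 'v"
    and d d' :: int
    and i j :: nat
  assumes "graded_leibniz_algebra s G br"
    and "derivation s G br d D"
    and "derivation s G br d' D'"
    and "1 \<le> i" and "1 \<le> j"
  shows "N_op br (i + j - 1) (gcomm s d d' D D')
           = hom_bracket s G i d (N_op br i D) j d' (N_op br j D') \<and>
    N_coder G br i d D \<in> Coder s G d \<and>
    N_coder G br j d' D' \<in> Coder s G d' \<and>
    N_coder G br (i + j - 1) (d + d') (gcomm s d d' D D') \<in> Coder s G (d + d') \<and>
    coder_eq s G (N_coder G br (i + j - 1) (d + d') (gcomm s d d' D D'))
           (gcomm fscale d d' (N_coder G br i d D) (N_coder G br j d' D'))"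
proof -
  interpret leibniz_derivations s G br D D' d d'
    using assms by (simp add: leibniz_derivations_def leibniz_derivations_axioms_def)
  have n: "1 \<le> i + j - 1" using assms(4,5) by simp
  show ?thesis
    unfolding N_coder_def
    using hom_bracket_N_op[OF assms(4,5)] coder_eq_N_op[OF assms(4,5)]
      coder_ext_in_Coder[OF N_op_arity(1)[OF assms(4)] assms(4)]
      coder_ext_in_Coder[OF N_op_arity(2)[OF assms(5)] assms(5)]
      coder_ext_in_Coder[OF N_op_arity(3)[OF n] n] by simp
qed

end
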